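(* Let $b_1,b_2\in H^\infty_1$ be two non-extreme points of $H^\infty_1$. Then $S_{b_1}\cong S_{b_2}$ (unitary equivalence of the forward shift operators on the de Branges-Rovnyak spaces $\mathcal H(b_1)$ and $\mathcal H(b_2)$) if and only if for every $\omega\in\mathbb D$, $$\frac{|b_1'(\omega)|}{1-|b_1(\omega)|^2}=\frac{|b_2'(\omega)|}{1-|b_2(\omega)|^2}.$$
   Context: $\mathbb D=\{z\in\mathbb C:|z|<1\}$, $\mathbb T=\partial\mathbb D$, $m$ is Lebesgue measure on $\mathbb T$. $H^2$ is the Hardy space of analytic functions on $\mathbb D$ with square-summable Taylor coefficients, $H^\infty$ is the algebra of bounded analytic functions on $\mathbb D$ with the supremum norm, and $H^\infty_1=\{b\in H^\infty:\|b\|_\infty\leq 1\}$. For $b\in H^\infty_1$, $T_b:H^2\to H^2$ is multiplication by $b$ and $T_{\overline b}=T_b^*$. The de Branges-Rovnyak space is $\mathcal H(b)=(I-T_bT_{\overline b})^{1/2}H^2$ with inner product $\langle (I-T_bT_{\overline b})^{1/2}f,(I-T_bT_{\overline b})^{1/2}g\rangle_b=\langle f,g\rangle_2$ for $f,g\in H^2\ominus\ker (I-T_bT_{\overline b})^{1/2}$, where $\langle\cdot,\cdot\rangle_2$ is the inner product of $H^2$. It is a reproducing kernel Hilbert space on $\mathbb D$ with kernel $k^b_\omega(z)=\frac{1-\overline{b(\omega)}b(z)}{1-\overline\omega z}$. An extreme point of $H^\infty_1$ is an element of $H^\infty_1$ that does not lie in any open line segment connecting two distinct points of $H^\infty_1$;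 it is known that $b\in H^\infty_1$ is non-extreme (not an extreme point) if and only if $\int_{\mathbb T}\log(1-|b|^2)\,dm>-\infty$ (using radial boundary values of $b$). It is known that if $b$ is non-extreme, then the forward shift $Sf(z)=zf(z)$ maps $\mathcal H(b)$ into itself, and $S_b=S|_{\mathcal H(b)}$ is a bounded operator on $\mathcal H(b)$. Bounded operators $T_1$ on $\mathcal H_1$ and $T_2$ on $\mathcal H_2$ (Hilbert spaces) are unitarily equivalent, written $T_1\cong T_2$, if there is a unitary $U:\mathcal H_1\to\mathcal H_2$ with $UT_1=T_2U$. *)

theory Defs
  imports "HOL-Complex_Analysis.Complex_Analysis" "HOL-Library.FuncSet"
begin

abbreviation unit_disc :: "complex set" ("\<bbbD>") where
  "\<bbbD> \<equiv> ball 0 1"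

section \<open>Bounded analytic functions\<close>

text \<open>Elements of \<open>Hinf\<close> are functions on the whole plane of which only the values on the disc
  matter; two of them are the same point of the space iff they agree on the disc.\<close>

definition Hinf :: "(complex \<Rightarrow> complex) set" where
  "Hinf = {b. b holomorphic_on \<bbbD> \<and> bounded (b ` \<bbbD>)}"

definition Hinf_norm :: "(complex \<Rightarrow> complex) \<Rightarrow> real" where
  "Hinf_norm b = (SUP z\<in>\<bbbD>. cmod (b z))"

definition Hinf1 :: "(complex \<Rightarrow> complex) set" where
  "Hinf1 = {b \<in> Hinf. Hinf_norm b \<le> 1}"

definition extreme_Hinf1 :: "(complex \<Rightarrow> complex) \<Rightarrow> bool" where
  "extreme_Hinf1 b \<longleftrightarrow> b \<in> Hinf1 \<and>
     \<not> (\<exists>f\<in>Hinf1. \<exists>g\<in>Hinf1. (\<exists>z\<in>\<bbbD>. f z \<noteq> g z) \<and>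
         (\<exists>t::real. 0 < t \<and> t < 1 \<and>
            (\<forall>z\<in>\<bbbD>. b z = (1 - of_real t) * f z + of_real t * g z)))"

section \<open>The Hardy space\<close>

definition taylor_coeff :: "(complex \<Rightarrow> complex) \<Rightarrow> nat \<Rightarrow> complex" where
  "taylor_coeff f n = (deriv ^^ n) f 0 / fact n"

text \<open>Elements of \<open>H2\<close> are extended by 0 outside the disc, so that equality in the space is
  equality of functions.\<close>

definition H2 :: "(complex \<Rightarrow> complex) set" where
  "H2 = {f. f holomorphic_on \<bbbD> \<and> (\<forall>z. z \<notin> \<bbbD> \<longrightarrow> f z = 0) \<and>
            summable (\<lambda>n. (cmod (taylor_coeff f n))\<^sup>2)}"

definition H2_inner :: "(complex \<Rightarrow> complex) \<Rightarrow> (complex \<Rightarrow> complex) \<Rightarrow> complex" where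
  "H2_inner f g = (\<Sum>n. taylor_coeff f n * cnj (taylor_coeff g n))"

definition H2_norm :: "(complex \<Rightarrow> complex) \<Rightarrow> real" where
  "H2_norm f = sqrt (Re (H2_inner f f))"

definition clinear_on ::
    "(complex \<Rightarrow> complex) set \<Rightarrow> ((complex \<Rightarrow> complex) \<Rightarrow> complex \<Rightarrow> complex) \<Rightarrow> bool" where
  "clinear_on V T \<longleftrightarrow>
     (\<forall>f\<in>V. \<forall>g\<in>V. \<forall>c d. T (\<lambda>z. c * f z + d * g z) = (\<lambda>z. c * T f z + d * T g z))"

definition H2_adjoint ::
    "((complex \<Rightarrow> complex) \<Rightarrow> complex \<Rightarrow> complex) \<Rightarrow> (complex \<Rightarrow> complex) \<Rightarrow> complex \<Rightarrow> complex" where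
  "H2_adjoint T g = (THE h. h \<in> H2 \<and> (\<forall>f\<in>H2. H2_inner (T f) g = H2_inner f h))"

definition H2_positive :: "((complex \<Rightarrow> complex) \<Rightarrow> complex \<Rightarrow> complex) \<Rightarrow> bool" where
  "H2_positive R \<longleftrightarrow> R ` H2 \<subseteq> H2 \<and> clinear_on H2 R \<and>
     (\<exists>K. \<forall>f\<in>H2. H2_norm (R f) \<le> K * H2_norm f) \<and>
     (\<forall>f\<in>H2. H2_inner (R f) f \<in> \<real>\<^sub>\<ge>\<^sub>0)"

text \<open>The positive square root of a positive operator; extensionality makes it unique as a
  HOL function.\<close>

definition H2_sqrt ::
    "((complex \<Rightarrow> complex) \<Rightarrow> complex \<Rightarrow> complex) \<Rightarrow> (complex \<Rightarrow> complex) \<Rightarrow> complex \<Rightarrow> complex" where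
  "H2_sqrt A = (THE R. R \<in> extensional H2 \<and> H2_positive R \<and> (\<forall>f\<in>H2. R (R f) = A f))"

section \<open>De Branges--Rovnyak spaces\<close>

definition toeplitz :: "(complex \<Rightarrow> complex) \<Rightarrow> (complex \<Rightarrow> complex) \<Rightarrow> complex \<Rightarrow> complex" where
  "toeplitz b f = (\<lambda>z. b z * f z)"

definition dBR_root :: "(complex \<Rightarrow> complex) \<Rightarrow> (complex \<Rightarrow> complex) \<Rightarrow> complex \<Rightarrow> complex" where
  "dBR_root b = H2_sqrt (\<lambda>f z. f z - toeplitz b (H2_adjoint (toeplitz b) f) z)"

definition dBR :: "(complex \<Rightarrow> complex) \<Rightarrow> (complex \<Rightarrow> complex) set" where
  "dBR b = dBR_root b ` H2"

definition dBR_coker :: "(complex \<Rightarrow> complex) \<Rightarrow> (complex \<Rightarrow> complex) set" where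
  "dBR_coker b =
     {f \<in> H2. \<forall>k\<in>H2. dBR_root b k = (\<lambda>z. 0) \<longrightarrow> H2_inner f k = 0}"

text \<open>The root is a bijection from the orthogonal complement \<open>dBR_coker b\<close> of its kernel onto
  \<open>dBR b\<close>; the inner product is transported along it.\<close>

definition dBR_inner ::
    "(complex \<Rightarrow> complex) \<Rightarrow> (complex \<Rightarrow> complex) \<Rightarrow> (complex \<Rightarrow> complex) \<Rightarrow> complex" where
  "dBR_inner b f g =
     H2_inner (the_inv_into (dBR_coker b) (dBR_root b) f)
              (the_inv_into (dBR_coker b) (dBR_root b) g)"

definition dBR_shift :: "(complex \<Rightarrow> complex) \<Rightarrow> (complex \<Rightarrow> complex) \<Rightarrow> complex \<Rightarrow> complex" where
  "dBR_shift b = restrict (\<lambda>f z. z * f z) (dBR b)"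

section \<open>Unitary equivalence\<close>

text \<open>Here \<open>V\<close>, \<open>W\<close> are linear spaces of functions, Hilbert spaces for the inner products \<open>ip\<close>,
  \<open>iq\<close>, and \<open>T\<close>, \<open>R\<close> are bounded operators on them.\<close>

definition unitary_between ::
    "(complex \<Rightarrow> complex) set \<Rightarrow> ((complex \<Rightarrow> complex) \<Rightarrow> (complex \<Rightarrow> complex) \<Rightarrow> complex) \<Rightarrow>
     (complex \<Rightarrow> complex) set \<Rightarrow> ((complex \<Rightarrow> complex) \<Rightarrow> (complex \<Rightarrow> complex) \<Rightarrow> complex) \<Rightarrow>
     ((complex \<Rightarrow> complex) \<Rightarrow> complex \<Rightarrow> complex) \<Rightarrow> bool" where
  "unitary_between V ip W iq U \<longleftrightarrow>
     clinear_on V U \<and> bij_betw U V W \<and> (\<forall>f\<in>V. \<forall>g\<in>V. iq (U f) (U g) = ip f g)"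

definition unitarily_equivalent ::
    "(complex \<Rightarrow> complex) set \<Rightarrow> ((complex \<Rightarrow> complex) \<Rightarrow> (complex \<Rightarrow> complex) \<Rightarrow> complex) \<Rightarrow>
     ((complex \<Rightarrow> complex) \<Rightarrow> complex \<Rightarrow> complex) \<Rightarrow>
     (complex \<Rightarrow> complex) set \<Rightarrow> ((complex \<Rightarrow> complex) \<Rightarrow> (complex \<Rightarrow> complex) \<Rightarrow> complex) \<Rightarrow>
     ((complex \<Rightarrow> complex) \<Rightarrow> complex \<Rightarrow> complex) \<Rightarrow> bool" where
  "unitarily_equivalent V ip T W iq R \<longleftrightarrow>
     (\<exists>U. unitary_between V ip W iq U \<and> (\<forall>f\<in>V. U (T f) = R (U f)))"

end

theory Submission
  imports Defs
begin

text \<open>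
  Write \<open>K\<^sub>b(z,w) = 1 - b(z) cnj (b(w))\<close>, so that the reproducing kernel of the space of \<open>b\<close> is
  \<open>K\<^sub>b(z,w) / (1 - z cnj w)\<close>. Both sides of the equivalence say the same thing about the two symbols:
  there is a function \<open>\<phi>\<close> on the disc with
  \<open>K\<^sub>2(z,w) = \<phi>(z) cnj (\<phi>(w)) K\<^sub>1(z,w)\<close>.

  A unitary \<open>U\<close> that intertwines the shifts maps functions vanishing at \<open>w\<close> to functions vanishing at
  \<open>w\<close>, because \<open>f(w) = 0\<close> allows one to write \<open>f = (z - w) g\<close> inside the space (\<open>dBR_divide\<close>).
  So \<open>U\<close> is multiplication by a function \<open>\<phi>\<close>, and comparing reproducing kernels gives the
  factorization (\<open>kernel_factor\<close>). This is where non-extremality enters: without it \<open>z g\<close> could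
  leave the space. A non-extreme \<open>b\<close> is the middle point of a segment from \<open>b - h\<close> to \<open>b + h\<close> in the
  unit ball with \<open>h\<close> not zero. Then \<open>|b|\<^sup>2 + |h|\<^sup>2 \<le> 1\<close>, and since the constants lie in the range of
  \<open>T\<^sub>h\<^sup>*\<close> this forces \<open>b\<close> into its own space, from which shift invariance follows
  (\<open>dBR_shift_invariant\<close>).

  In the quotient \<open>K(z,z) K(w,w) / |K(z,w)|\<^sup>2\<close> the factor \<open>\<phi>\<close> cancels. The quotient is one minus the
  square of the pseudo-hyperbolic distance of \<open>b(z)\<close> and \<open>b(w)\<close>, whose infinitesimal form is
  \<open>|b'| / (1 - |b|\<^sup>2)\<close> (\<open>hyperbolic_derivative_eq\<close>).

  Conversely, equality of the hyperbolic derivatives is an identity on the diagonal \<open>z = w\<close> between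
  finite sums of holomorphic times antiholomorphic functions. Such identities polarize, and this
  produces \<open>\<phi>\<close>, which is moreover bounded (\<open>factor_from_hyperbolic_derivative\<close>). The factorization
  then reads \<open>I - T\<^sub>2 T\<^sub>2\<^sup>* = T\<^sub>\<phi> (I - T\<^sub>1 T\<^sub>1\<^sup>*) T\<^sub>\<phi>\<^sup>*\<close>, so the positive root for \<open>b\<^sub>2\<close> has the same range,
  with the same norm, as \<open>T\<^sub>\<phi>\<close> times the root for \<open>b\<^sub>1\<close>: multiplication by \<open>\<phi>\<close> is the required
  unitary (\<open>unitarily_equivalent_from_factor\<close>).

  The spaces are defined through adjoints and positive square roots of operators on the Hardy space.
  These are constructed for a general Hilbert space, which is then specialized to square-summable
  sequences. Membership in the range of an operator is always decided by Douglas's criterion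
  (\<open>douglas\<close>), that is, by an inequality between norms.
\<close>

section \<open>Operators on a real Hilbert space\<close>

text \<open>The representing vector minimizes \<open>|v|\<^sup>2 - 2 l v\<close>; the parallelogram law makes a minimizing
  sequence a Cauchy sequence. The subspace is not assumed to be closed, since the lemma is used on
  the range of an operator.\<close>

lemma riesz_on_subspace:
  fixes l :: "'a::{real_inner,banach} \<Rightarrow> real"
  assumes V: "subspace V" and "0 \<le> C"
    and add: "\<And>u v. u \<in> V \<Longrightarrow> v \<in> V \<Longrightarrow> l (u + v) = l u + l v"
    and scale: "\<And>c v. v \<in> V \<Longrightarrow> l (c *\<^sub>R v) = c * l v"
    and bound: "\<And>v. v \<in> V \<Longrightarrow> l v \<le> C * norm v"
  obtains y where "y \<in> closure V" "\<And>v. v \<in> V \<Longrightarrow> y \<bullet> v = l v" "norm y \<le> C"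
proof -
  define J where "J v = v \<bullet> v - 2 * l v" for v
  have J_ge: "- C\<^sup>2 \<le> J v" if "v \<in> V" for v
  proof -
    have "0 \<le> (norm v - C)\<^sup>2" by simp
    also have "\<dots> = v \<bullet> v - 2 * (C * norm v) + C\<^sup>2"
      by (simp add: power2_diff power2_norm_eq_inner)
    finally show ?thesis unfolding J_def using bound[OF that] by linarith
  qed
  have V0: "0 \<in> V" using V by (rule subspace_0)
  define m where "m = Inf (J ` V)"
  have bdd: "bdd_below (J ` V)" using J_ge by (auto intro!: bdd_belowI)
  have m_le: "m \<le> J v" if "v \<in> V" for v
    unfolding m_def using bdd that by (auto intro: cInf_lower)
  have "\<exists>v\<in>V. J v < m + 1 / real (Suc n)" for n
  proof -
    have "Inf (J ` V) < m + 1 / real (Suc n)" by (simp add: m_def)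
    then show ?thesis using cInf_lessD[of "J ` V"] V0 by blast
  qed
  then obtain v where vV: "\<And>n. v n \<in> V" and vm: "\<And>n. J (v n) < m + 1 / real (Suc n)"
    by metis
  have close: "(norm (v i - v j))\<^sup>2 \<le> 2 / real (Suc i) + 2 / real (Suc j)" for i j
  proof -
    let ?w = "(1/2) *\<^sub>R (v i + v j)"
    have w: "?w \<in> V" using V vV by (intro subspace_scale subspace_add)
    have lw: "l ?w = (l (v i) + l (v j)) / 2"
      using V vV by (simp add: scale add subspace_add)
    have "(norm (v i - v j))\<^sup>2 = 2 * J (v i) + 2 * J (v j) - 4 * J ?w"
      unfolding J_def lw
      by (simp add: power2_norm_eq_inner inner_diff inner_add inner_commute field_simps)
    also have "\<dots> \<le> 2 / real (Suc i) + 2 / real (Suc j)"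
      using vm[of i] vm[of j] m_le[OF w] by argo
    finally show ?thesis .
  qed
  have "Cauchy v"
  proof (rule CauchyI)
    fix e :: real assume "0 < e"
    then obtain N :: nat where N: "4 / e\<^sup>2 < real N" using reals_Archimedean2 by blast
    have "norm (v i - v j) < e" if "N \<le> i" "N \<le> j" for i j
    proof -
      have N0: "0 < real N" using N \<open>0 < e\<close> by (smt (verit) divide_pos_pos zero_less_power)
      have "2 / real (Suc i) \<le> 2 / real N" "2 / real (Suc j) \<le> 2 / real N"
        using that N0 by (auto intro!: divide_left_mono)
      then have "(norm (v i - v j))\<^sup>2 \<le> 4 / real N" using close[of i j] by argo
      also have "\<dots> < e\<^sup>2" using N \<open>0 < e\<close> N0 by (simp add: field_simps)
      finally show ?thesis using \<open>0 < e\<close> by (simp add: power2_less_imp_less)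
    qed
    then show "\<exists>M. \<forall>i\<ge>M. \<forall>j\<ge>M. norm (v i - v j) < e" by blast
  qed
  then obtain y where y: "v \<longlonglongrightarrow> y" using Cauchy_convergent convergent_def by blast
  have ycl: "y \<in> closure V" using y vV closure_sequential by blast
  have eq: "y \<bullet> u = l u" if u: "u \<in> V" for u
  proof -
    have pos: "0 \<le> 2 * t * (y \<bullet> u - l u) + t\<^sup>2 * (u \<bullet> u)" for t :: real
    proof -
      have "m \<le> J (v n) + 2 * t * (v n \<bullet> u - l u) + t\<^sup>2 * (u \<bullet> u)" for n
      proof -
        have "v n + t *\<^sub>R u \<in> V" using V vV u by (intro subspace_add subspace_scale)
        moreover have "J (v n + t *\<^sub>R u) = J (v n) + 2 * t * (v n \<bullet> u - l u) + t\<^sup>2 * (u \<bullet> u)"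
          unfolding J_def using V vV u
          by (simp add: add scale subspace_scale inner_add inner_commute algebra_simps power2_eq_square)
        ultimately show ?thesis using m_le by metis
      qed
      then have "0 \<le> 1 / real (Suc n) + (2 * t * (v n \<bullet> u - l u) + t\<^sup>2 * (u \<bullet> u))" for n
        using vm[of n] by (smt (verit, best))
      moreover have "(\<lambda>n. 1 / real (Suc n) + (2 * t * (v n \<bullet> u - l u) + t\<^sup>2 * (u \<bullet> u)))
          \<longlonglongrightarrow> 0 + (2 * t * (y \<bullet> u - l u) + t\<^sup>2 * (u \<bullet> u))"
        using y LIMSEQ_Suc[OF lim_1_over_n] by (intro tendsto_intros) auto
      ultimately show ?thesis by (intro LIMSEQ_le_const) auto
    qed
    define q where "q = u \<bullet> u + 1"
    have q: "1 \<le> q" by (simp add: q_def)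
    \<comment> \<open>the value of \<open>t\<close> at which the quadratic polynomial is visibly nonpositive\<close>
    define t where "t = (l u - y \<bullet> u) / q"
    have d: "y \<bullet> u - l u = - (t * q)" using q by (simp add: t_def)
    have "0 \<le> 2 * t * (y \<bullet> u - l u) + t\<^sup>2 * (u \<bullet> u)" by (rule pos)
    also have "\<dots> = - (t\<^sup>2 * (q + 1))"
      unfolding d by (simp add: q_def algebra_simps power2_eq_square)
    finally have "t\<^sup>2 * (q + 1) \<le> 0" by simp
    then have "t = 0" using q by (auto simp: mult_le_0_iff)
    then show ?thesis using d by simp
  qed
  have "norm y \<le> C"
  proof -
    have "y \<bullet> v n \<le> C * norm (v n)" for n using eq vV bound by simp
    moreover have "(\<lambda>n. y \<bullet> v n) \<longlonglongrightarrow> y \<bullet> y" "(\<lambda>n. C * norm (v n)) \<longlonglongrightarrow> C * norm y"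
      by (intro tendsto_intros y)+
    ultimately have "y \<bullet> y \<le> C * norm y" by (blast intro: LIMSEQ_le)
    then have "norm y * norm y \<le> C * norm y" by (simp flip: power2_norm_eq_inner power2_eq_square)
    then show ?thesis using \<open>0 \<le> C\<close> by (cases "y = 0") auto
  qed
  with ycl eq that show thesis by blast
qed

definition adj :: "('a::{real_inner,banach} \<Rightarrow>\<^sub>L 'a) \<Rightarrow> 'a \<Rightarrow>\<^sub>L 'a" where
  "adj A = Blinfun (adjoint (blinfun_apply A))"

lemma adj_right:
  fixes A :: "'a::{real_inner,banach} \<Rightarrow>\<^sub>L 'a"
  shows "A x \<bullet> y = x \<bullet> adj A y"
proof -
  have "\<exists>g. \<forall>x. A x \<bullet> y = g \<bullet> x \<and> norm g \<le> norm A * norm y" for y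
  proof -
    have "A x \<bullet> y \<le> norm A * norm y * norm x" for x
    proof -
      have "A x \<bullet> y \<le> norm (A x) * norm y" by (rule norm_cauchy_schwarz)
      also have "\<dots> \<le> norm A * norm x * norm y" by (intro mult_right_mono norm_blinfun) auto
      finally show ?thesis by (simp add: mult_ac)
    qed
    then obtain g where "\<And>x. x \<in> UNIV \<Longrightarrow> g \<bullet> x = A x \<bullet> y" "norm g \<le> norm A * norm y"
      using riesz_on_subspace[of UNIV "norm A * norm y" "\<lambda>x. A x \<bullet> y", OF subspace_UNIV]
      by (simp add: blinfun.add_right blinfun.scaleR_right inner_add_left) blast
    then show ?thesis by (intro exI[of _ g]) simp
  qed
  then obtain g where g: "\<And>y x. A x \<bullet> y = g y \<bullet> x" "\<And>y. norm (g y) \<le> norm A * norm y"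
    by metis
  have "bounded_linear g"
  proof (rule bounded_linear_intro)
    show "g (x + y) = g x + g y" for x y
      by (metis g(1) inner_add_left inner_add_right vector_eq_rdot)
    show "g (r *\<^sub>R x) = r *\<^sub>R g x" for r x
      by (metis g(1) inner_scaleR_left inner_scaleR_right vector_eq_rdot)
    show "norm (g x) \<le> norm x * norm A" for x using g(2)[of x] by (simp add: mult.commute)
  qed
  moreover have "adjoint (blinfun_apply A) = g"
    using g(1) by (intro adjoint_unique) (simp add: inner_commute)
  ultimately show ?thesis
    unfolding adj_def using g(1) by (simp add: bounded_linear_Blinfun_apply inner_commute)
qed

lemma adj_left:
  fixes A :: "'a::{real_inner,banach} \<Rightarrow>\<^sub>L 'a"
  shows "adj A x \<bullet> y = x \<bullet> A y"
  by (metis adj_right inner_commute)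

lemma adj_eqI:
  fixes A B :: "'a::{real_inner,banach} \<Rightarrow>\<^sub>L 'a"
  shows "(\<And>x y. A x \<bullet> y = x \<bullet> B y) \<Longrightarrow> adj A = B"
  by (intro blinfun_eqI) (metis adj_right vector_eq_ldot)

text \<open>The orthogonal complement of the kernel, equivalently the closure of the range of the adjoint.\<close>

definition coker :: "('a::{real_inner,banach} \<Rightarrow>\<^sub>L 'a) \<Rightarrow> 'a set" where
  "coker A = {x. \<forall>k. A k = 0 \<longrightarrow> x \<bullet> k = 0}"

lemma subspace_coker: "subspace (coker A)"
  by (auto simp: coker_def subspace_def inner_add_left)

lemma coker_inj:
  fixes A :: "'a::{real_inner,banach} \<Rightarrow>\<^sub>L 'a"
  shows "x \<in> coker A \<Longrightarrow> y \<in> coker A \<Longrightarrow> A x = A y \<Longrightarrow> x = y"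
proof -
  assume x: "x \<in> coker A" and y: "y \<in> coker A" and eq: "A x = A y"
  have "x - y \<in> coker A" using x y by (intro subspace_diff subspace_coker)
  moreover have "A (x - y) = 0" by (simp add: blinfun.diff_right eq)
  ultimately have "(x - y) \<bullet> (x - y) = 0" by (simp add: coker_def)
  then show "x = y" by simp
qed

text \<open>This is the substantial half of Douglas's range inclusion theorem, one vector at a time:
  \<open>B\<^sup>* v \<mapsto> g \<bullet> v\<close> is a well-defined bounded functional on the range of \<open>B\<^sup>*\<close>, and a vector
  representing it is a preimage of \<open>g\<close>. Membership in the range of an operator thus becomes an
  inequality between norms of adjoints.\<close>

lemma douglas:
  fixes B :: "'a::{real_inner,banach} \<Rightarrow>\<^sub>L 'a"
  assumes "0 \<le> C" and bd: "\<And>v. g \<bullet> v \<le> C * norm (adj B v)"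
  obtains y where "y \<in> coker B" "B y = g" "norm y \<le> C"
proof -
  let ?V = "range (adj B)"
  define l where "l w = g \<bullet> (SOME v. adj B v = w)" for w
  have l: "l (adj B v) = g \<bullet> v" for v
  proof -
    let ?v = "SOME v'. adj B v' = adj B v"
    have "adj B ?v = adj B v" by (rule someI) simp
    then have "norm (adj B (?v - v)) = 0" "norm (adj B (v - ?v)) = 0"
      by (simp_all add: blinfun.diff_right)
    then have "g \<bullet> (?v - v) \<le> 0" "g \<bullet> (v - ?v) \<le> 0"
      using bd[of "?v - v"] bd[of "v - ?v"] by simp_all
    then show ?thesis unfolding l_def by (simp add: inner_diff_right)
  qed
  have V: "subspace ?V"
    by (rule linear_subspace_image[OF _ subspace_UNIV])
      (simp add: blinfun.bounded_linear_right bounded_linear.linear)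
  obtain y where y: "y \<in> closure ?V" "\<And>w. w \<in> ?V \<Longrightarrow> y \<bullet> w = l w" "norm y \<le> C"
  proof (rule riesz_on_subspace[of ?V C l])
    show "l (u + v) = l u + l v" if "u \<in> ?V" "v \<in> ?V" for u v
      using that by (auto simp: l inner_add_right simp flip: blinfun.add_right)
    show "l (c *\<^sub>R v) = c * l v" if "v \<in> ?V" for c v
      using that by (auto simp: l simp flip: blinfun.scaleR_right)
    show "l v \<le> C * norm v" if "v \<in> ?V" for v
      using that bd by (auto simp: l)
  qed (use V \<open>0 \<le> C\<close> in auto)
  have "B y \<bullet> v = g \<bullet> v" for v using y(2)[of "adj B v"] by (simp add: adj_right l)
  then have "B y = g" using vector_eq_rdot by blast
  moreover have "y \<in> coker B"
    unfolding coker_def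
  proof (intro CollectI allI impI)
    fix k assume k: "B k = 0"
    obtain w where w: "\<And>n. w n \<in> ?V" "w \<longlonglongrightarrow> y" using y(1) closure_sequential by metis
    have "w n \<bullet> k = 0" for n using w(1)[of n] k by (auto simp: adj_left)
    moreover have "(\<lambda>n. w n \<bullet> k) \<longlonglongrightarrow> y \<bullet> k" using w(2) by (intro tendsto_intros)
    ultimately show "y \<bullet> k = 0" by (simp add: LIMSEQ_const_iff)
  qed
  ultimately show thesis using y(3) that by blast
qed

text \<open>The preimages produced by Douglas's criterion are orthogonal to the kernel, which replaces an
  orthogonal decomposition of the space.\<close>

lemma range_eq_image_coker:
  fixes A :: "'a::{real_inner,banach} \<Rightarrow>\<^sub>L 'a"
  shows "range (blinfun_apply A) = blinfun_apply A ` coker A"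
proof -
  have "A x \<in> A ` coker A" for x
  proof (rule douglas[of "norm x" "A x" A])
    show "A x \<bullet> v \<le> norm x * norm (adj A v)" for v
      by (simp add: adj_right norm_cauchy_schwarz)
  qed (auto simp: image_iff, metis)
  then show ?thesis by blast
qed

text \<open>The hypothesis is a form of \<open>A A\<^sup>* = B B\<^sup>*\<close>. By Douglas's criterion every \<open>A x\<close> has a preimage
  under \<open>B\<close> that is not longer than \<open>x\<close>; passing back from \<open>B\<close> to \<open>A\<close> must return \<open>x\<close>, because \<open>A\<close> is
  injective on the complement of its kernel, so no length is lost.\<close>

lemma same_range_norm:
  fixes A B :: "'a::{real_inner,banach} \<Rightarrow>\<^sub>L 'a"
  assumes eq: "\<And>v. norm (adj A v) = norm (adj B v)" and x: "x \<in> coker A"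
  obtains y where "y \<in> coker B" "B y = A x" "norm y = norm x"
proof -
  have transfer: "\<exists>y\<in>coker B. B y = A x \<and> norm y \<le> norm x"
    if eq: "\<And>v. norm (adj A v) = norm (adj B v)" for A B :: "'a \<Rightarrow>\<^sub>L 'a" and x
  proof (rule douglas[of "norm x" "A x" B])
    show "A x \<bullet> v \<le> norm x * norm (adj B v)" for v
      unfolding adj_right eq[symmetric] by (rule norm_cauchy_schwarz)
  qed auto
  obtain y where y: "y \<in> coker B" "B y = A x" "norm y \<le> norm x"
    using transfer[OF eq] by blast
  obtain x' where x': "x' \<in> coker A" "A x' = B y" "norm x' \<le> norm y"
    using transfer[OF eq[symmetric]] by blast
  have "x' = x" using coker_inj[OF x'(1) x] x'(2) y(2) by simp
  with x' y that show thesis by force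
qed

definition selfadj :: "('a::{real_inner,banach} \<Rightarrow>\<^sub>L 'a) \<Rightarrow> bool" where
  "selfadj A \<longleftrightarrow> (\<forall>x y. A x \<bullet> y = x \<bullet> A y)"

lemma selfadj_adj: "selfadj A \<Longrightarrow> adj A = A"
  unfolding selfadj_def by (blast intro: adj_eqI)

text \<open>If \<open>R = I - Y\<close> then \<open>R\<^sup>2 = I - B\<close> says that \<open>Y = (B + Y\<^sup>2)/2\<close>. The iteration of this map
  from \<open>0\<close> converges in norm, as it is dominated by the same iteration for the number \<open>1\<close> in
  place of \<open>B\<close>, whose limit is \<open>1\<close>.\<close>

lemma pos_sqrt_exists:
  fixes B :: "'a::{real_inner,banach} \<Rightarrow>\<^sub>L 'a"
  assumes nB: "norm B \<le> 1" and sB: "selfadj B"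
  obtains R where "selfadj R" "\<And>x. 0 \<le> R x \<bullet> x" "\<And>x. R (R x) = x - B x"
    "\<And>(C :: 'a \<Rightarrow>\<^sub>L 'a) x. (\<And>x. C (B x) = B (C x)) \<Longrightarrow> C (R x) = R (C x)"
proof -
  define Y where "Y = rec_nat (0 :: 'a \<Rightarrow>\<^sub>L 'a) (\<lambda>_ Z. (1/2) *\<^sub>R (B + (Z o\<^sub>L Z)))"
  define y where "y = rec_nat (0 :: real) (\<lambda>_ t. (1 + t\<^sup>2) / 2)"
  have Y0: "Y 0 = 0" and YS: "Y (Suc n) = (1/2) *\<^sub>R (B + (Y n o\<^sub>L Y n))" for n
    by (simp_all add: Y_def)
  have y0: "y 0 = 0" and yS: "y (Suc n) = (1 + (y n)\<^sup>2) / 2" for n by (simp_all add: y_def)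
  have y_bd: "0 \<le> y n \<and> y n \<le> 1" for n
  proof (induction n)
    case (Suc n)
    then have "(y n)\<^sup>2 \<le> 1" by (simp add: power_le_one)
    then show ?case by (simp add: yS)
  qed (simp add: y0)
  have nY: "norm (Y n) \<le> y n" for n
  proof (induction n)
    case (Suc n)
    have "norm (Y n o\<^sub>L Y n) \<le> norm (Y n) * norm (Y n)" by (rule norm_blinfun_compose)
    also have "\<dots> \<le> (y n)\<^sup>2" unfolding power2_eq_square using Suc y_bd[of n] by (intro mult_mono) auto
    finally have "norm (B + (Y n o\<^sub>L Y n)) \<le> 1 + (y n)\<^sup>2" 
      using nB norm_triangle_ineq[of B "Y n o\<^sub>L Y n"] by linarith
    then show ?case by (simp add: YS yS)
  qed (simp add: Y0 y0)
  have step: "norm (Y (Suc n) - Y n) \<le> y (Suc n) - y n" for n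
  proof (induction n)
    case 0 then show ?case using nB by (simp add: YS Y0 yS y0)
  next
    case (Suc n)
    let ?D = "Y (Suc n) - Y n"
    have "Y (Suc (Suc n)) - Y (Suc n)
        = (1/2) *\<^sub>R (B + (Y (Suc n) o\<^sub>L Y (Suc n))) - (1/2) *\<^sub>R (B + (Y n o\<^sub>L Y n))"
      by (rule arg_cong2[OF YS YS])
    also have "\<dots> = (1/2) *\<^sub>R ((Y (Suc n) o\<^sub>L ?D) + (?D o\<^sub>L Y n))"
      by (intro blinfun_eqI) (simp add: blinfun.add_left blinfun.diff_left blinfun.diff_right
          blinfun.scaleR_left scaleR_diff_right scaleR_add_right)
    finally have "Y (Suc (Suc n)) - Y (Suc n) = (1/2) *\<^sub>R ((Y (Suc n) o\<^sub>L ?D) + (?D o\<^sub>L Y n))" .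
    then have "norm (Y (Suc (Suc n)) - Y (Suc n))
        \<le> (norm (Y (Suc n) o\<^sub>L ?D) + norm (?D o\<^sub>L Y n)) / 2"
      using norm_triangle_ineq[of "Y (Suc n) o\<^sub>L ?D" "?D o\<^sub>L Y n"] by simp
    also have "\<dots> \<le> (y (Suc n) * (y (Suc n) - y n) + (y (Suc n) - y n) * y n) / 2"
    proof -
      have "norm (Y (Suc n) o\<^sub>L ?D) \<le> y (Suc n) * (y (Suc n) - y n)"
        using norm_blinfun_compose[of "Y (Suc n)" ?D] nY[of "Suc n"] Suc y_bd[of "Suc n"]
        by (meson mult_mono norm_ge_zero order_trans)
      moreover have "norm (?D o\<^sub>L Y n) \<le> (y (Suc n) - y n) * y n"
        using norm_blinfun_compose[of ?D "Y n"] nY[of n] Suc y_bd[of n]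
        by (meson mult_mono norm_ge_zero order_trans)
      ultimately show ?thesis by (simp add: add_mono del: distrib_left right_diff_distrib)
    qed
    also have "\<dots> = y (Suc (Suc n)) - y (Suc n)"
      using arg_cong2[OF yS yS, of "(-)" "Suc n" n] by (simp add: field_simps power2_eq_square)
    finally show ?case .
  qed
  have diff: "norm (Y (n + k) - Y n) \<le> y (n + k) - y n" for n k
  proof (induction k)
    case (Suc k)
    have "norm (Y (n + Suc k) - Y n) \<le> norm (Y (Suc (n + k)) - Y (n + k)) + norm (Y (n + k) - Y n)"
      using norm_triangle_ineq[of "Y (Suc (n + k)) - Y (n + k)" "Y (n + k) - Y n"] by simp
    then show ?case using Suc step[of "n + k"] by simp
  qed simp
  have "incseq y" using order_trans[OF norm_ge_zero step] by (intro incseq_SucI) simp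
  then have "Cauchy y"
    using y_bd by (metis incseq_convergent LIMSEQ_imp_Cauchy)
  have "Cauchy Y"
  proof (rule CauchyI)
    fix e :: real assume "0 < e"
    then obtain N where N: "\<And>i j. i \<ge> N \<Longrightarrow> j \<ge> N \<Longrightarrow> norm (y i - y j) < e"
      using CauchyD[OF \<open>Cauchy y\<close>] by blast
    have le: "norm (Y i - Y j) < e" if "N \<le> j" "j \<le> i" for i j
      using diff[of j "i - j"] N[of i j] that by auto
    then have "norm (Y i - Y j) < e" if "N \<le> i" "N \<le> j" for i j
      using that by (metis nat_le_linear norm_minus_commute)
    then show "\<exists>M. \<forall>i\<ge>M. \<forall>j\<ge>M. norm (Y i - Y j) < e" by blast
  qed
  then obtain Z where Z: "Y \<longlonglongrightarrow> Z" using Cauchy_convergent convergent_def by blast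
  have Zx: "(\<lambda>n. Y n x) \<longlonglongrightarrow> Z x" for x using Z by (intro tendsto_intros)
  have "norm Z \<le> 1"
    using Z nY y_bd by (intro Lim_bounded[OF tendsto_norm[OF Z], of 0]) (meson order_trans)
  have "(\<lambda>n. Y (Suc n)) \<longlonglongrightarrow> (1/2) *\<^sub>R (B + (Z o\<^sub>L Z))"
    unfolding YS using Z by (intro tendsto_intros bounded_bilinear.tendsto[OF bounded_bilinear_blinfun_compose])
  then have fixZ: "Z = (1/2) *\<^sub>R (B + (Z o\<^sub>L Z))" using LIMSEQ_unique LIMSEQ_Suc[OF Z] by blast
  have saY: "Y n x \<bullet> v = x \<bullet> Y n v" for n x v
  proof (induction n arbitrary: x v)
    case (Suc n)
    then show ?case using sB
      by (simp add: YS selfadj_def blinfun.scaleR_left blinfun.add_left inner_add)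
  qed (simp add: Y0)
  have saZ: "Z x \<bullet> v = x \<bullet> Z v" for x v
    using tendsto_inner[OF Zx tendsto_const, of x v] tendsto_inner[OF tendsto_const Zx, of x v]
    unfolding saY by (rule LIMSEQ_unique)
  define R where "R = id_blinfun - Z"
  have Rx: "R x = x - Z x" for x by (simp add: R_def blinfun.diff_left)
  show thesis
  proof
    show "selfadj R" by (simp add: selfadj_def Rx inner_diff saZ)
    show "0 \<le> R x \<bullet> x" for x
    proof -
      have "Z x \<bullet> x \<le> norm (Z x) * norm x" by (rule norm_cauchy_schwarz)
      also have "\<dots> \<le> 1 * norm x * norm x"
        using norm_blinfun[of Z x] \<open>norm Z \<le> 1\<close>
        by (intro mult_right_mono order_trans[OF norm_blinfun] ) auto
      also have "\<dots> = x \<bullet> x" by (simp add: power2_norm_eq_inner flip: power2_eq_square)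
      finally show ?thesis by (simp add: Rx inner_diff_left)
    qed
    show "R (R x) = x - B x" for x
    proof -
      have "Z x = (1/2) *\<^sub>R (B x + Z (Z x))"
        by (subst fixZ) (simp add: blinfun.scaleR_left blinfun.add_left)
      then have "Z x + Z x = B x + Z (Z x)" by (metis scaleR_half_double scaleR_add_right)
      then show ?thesis by (simp add: Rx blinfun.diff_right algebra_simps)
    qed
    show "C (R x) = R (C x)" if C: "\<And>x. C (B x) = B (C x)" for C :: "'a \<Rightarrow>\<^sub>L 'a" and x
    proof -
      have "C (Y n x) = Y n (C x)" for n x
      proof (induction n arbitrary: x)
        case (Suc n)
        then show ?case
          by (simp add: YS C blinfun.scaleR_left blinfun.scaleR_right blinfun.add_left blinfun.add_right)
      qed (simp add: Y0 blinfun.zero_right)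
      moreover have "(\<lambda>n. C (Y n x)) \<longlonglongrightarrow> C (Z x)"
        by (rule bounded_linear.tendsto[OF blinfun.bounded_linear_right Zx])
      ultimately have "C (Z x) = Z (C x)" using Zx[of "C x"] LIMSEQ_unique by fastforce
      then show ?thesis by (simp add: Rx blinfun.diff_right)
    qed
  qed
qed

text \<open>An instance of the Cauchy--Schwarz inequality for the form \<open>R x \<bullet> y\<close>, proved by looking for a
  negative value of the form.\<close>

lemma pos_operator_zero:
  fixes R :: "'a::{real_inner,banach} \<Rightarrow>\<^sub>L 'a"
  assumes sR: "selfadj R" and pos: "\<And>x. 0 \<le> R x \<bullet> x" and z: "R x \<bullet> x = 0"
  shows "R x = 0"
proof (rule ccontr)
  assume nz: "R x \<noteq> 0"
  let ?y = "R x"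
  define a where "a = ?y \<bullet> ?y"
  define q where "q = R ?y \<bullet> ?y + 1"
  have q: "1 \<le> q" using pos[of ?y] by (simp add: q_def)
  have a: "0 < a" using nz by (simp add: a_def)
  define t where "t = a / q"
  have t: "0 < t" "t * q = a" using a q by (auto simp: t_def)
  \<comment> \<open>positivity of the form along the line \<open>x - t R x\<close> for a small \<open>t > 0\<close>\<close>
  have "0 \<le> R (x - t *\<^sub>R ?y) \<bullet> (x - t *\<^sub>R ?y)" by (rule pos)
  also have "\<dots> = t * (t * q - t) - 2 * t * a"
    using sR z by (simp add: selfadj_def blinfun.diff_right blinfun.scaleR_right inner_diff
        inner_commute q_def a_def algebra_simps)
  also have "\<dots> = - t * (t + a)" using t(2) by (simp add: algebra_simps)
  also have "\<dots> < 0" using t a by (simp add: add_pos_pos mult_pos_pos)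
  finally show False by simp
qed

text \<open>Commuting roots satisfy \<open>(R + Q) (R - Q) x = 0\<close>. Positivity then makes \<open>R\<close> and \<open>Q\<close> vanish
  separately on \<open>(R - Q) x\<close>.\<close>

lemma pos_sqrt_unique:
  fixes R Q :: "'a::{real_inner,banach} \<Rightarrow>\<^sub>L 'a"
  assumes "selfadj R" "\<And>x. 0 \<le> R x \<bullet> x" "selfadj Q" "\<And>x. 0 \<le> Q x \<bullet> x"
    and sq: "\<And>x. R (R x) = Q (Q x)" and comm: "\<And>x. Q (R x) = R (Q x)"
  shows "R = Q"
proof (rule blinfun_eqI)
  fix x
  let ?y = "R x - Q x"
  have "R ?y + Q ?y = 0" by (simp add: blinfun.diff_right sq comm)
  then have "R ?y \<bullet> ?y + Q ?y \<bullet> ?y = 0" by (metis inner_add_left inner_zero_left)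
  then have "R ?y \<bullet> ?y = 0" "Q ?y \<bullet> ?y = 0" using assms(2,4)[of ?y] by linarith+
  then have "R ?y = 0" "Q ?y = 0" using assms by (auto intro: pos_operator_zero)
  moreover have "?y \<bullet> ?y = x \<bullet> (R ?y - Q ?y)"
    using assms(1,3) by (simp add: selfadj_def inner_diff blinfun.diff_right)
  ultimately have "?y \<bullet> ?y = 0" by simp
  then show "R x = Q x" by simp
qed

section \<open>Square-summable sequences\<close>

text \<open>The sequences of Taylor coefficients of functions in the Hardy space. As a type they are a
  Banach space in the sense of the type classes, which makes the preceding section applicable; the
  type classes know real scalars only, so complex scalars are a separate operation \<open>cs\<close> below.\<close>

typedef ell2 = "{x :: nat \<Rightarrow> complex. summable (\<lambda>n. (cmod (x n))\<^sup>2)}"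
  morphisms cf ell2_of
  by (rule exI[of _ "\<lambda>_. 0"]) simp

setup_lifting type_definition_ell2

lemma summable_cf: "summable (\<lambda>n. (cmod (cf x n))\<^sup>2)"
  using cf by blast

lemma cf_ell2_of: "summable (\<lambda>n. (cmod (x n))\<^sup>2) \<Longrightarrow> cf (ell2_of x) = x"
  by (simp add: ell2_of_inverse)

lemma ell2_eqI: "(\<And>n. cf x n = cf y n) \<Longrightarrow> x = y"
  using cf_inject[of x y] by (simp add: fun_eq_iff)

lemma abs_inner_le: "\<bar>(a::complex) \<bullet> b\<bar> \<le> (cmod a)\<^sup>2 + (cmod b)\<^sup>2"
proof -
  have "\<bar>a \<bullet> b\<bar> \<le> cmod a * cmod b" by (rule Cauchy_Schwarz_ineq2)
  also have "\<dots> \<le> (cmod a)\<^sup>2 + (cmod b)\<^sup>2"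
    using sum_squares_bound[of "cmod a" "cmod b"] mult_nonneg_nonneg[OF norm_ge_zero norm_ge_zero, of a b]
    by linarith
  finally show ?thesis .
qed

lemma cmod_add_sq_le: "(cmod (a + b))\<^sup>2 \<le> 2 * (cmod a)\<^sup>2 + 2 * (cmod b)\<^sup>2"
proof -
  have "(cmod (a + b))\<^sup>2 \<le> (cmod a + cmod b)\<^sup>2" by (simp add: norm_triangle_ineq power_mono)
  also have "\<dots> \<le> 2 * (cmod a)\<^sup>2 + 2 * (cmod b)\<^sup>2"
    using sum_squares_bound[of "cmod a" "cmod b"] by (simp add: power2_sum)
  finally show ?thesis .
qed

lemma summable_inner_cf: "summable (\<lambda>n. cf x n \<bullet> cf y n)"
  by (rule summable_comparison_test'[OF summable_add[OF summable_cf[of x] summable_cf[of y]]])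
    (simp add: abs_inner_le)

instantiation ell2 :: real_inner
begin

lift_definition zero_ell2 :: ell2 is "\<lambda>_. 0" by simp

lift_definition plus_ell2 :: "ell2 \<Rightarrow> ell2 \<Rightarrow> ell2" is "\<lambda>x y n. x n + y n"
proof -
  fix x y :: "nat \<Rightarrow> complex"
  assume "summable (\<lambda>n. (cmod (x n))\<^sup>2)" "summable (\<lambda>n. (cmod (y n))\<^sup>2)"
  then have "summable (\<lambda>n. 2 * (cmod (x n))\<^sup>2 + 2 * (cmod (y n))\<^sup>2)"
    by (intro summable_add summable_mult)
  then show "summable (\<lambda>n. (cmod (x n + y n))\<^sup>2)"
    by (rule summable_comparison_test[rotated]) (auto simp: cmod_add_sq_le)
qed

lift_definition uminus_ell2 :: "ell2 \<Rightarrow> ell2" is "\<lambda>x n. - x n" by simp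

lift_definition scaleR_ell2 :: "real \<Rightarrow> ell2 \<Rightarrow> ell2" is "\<lambda>c x n. c *\<^sub>R x n"
  by (simp add: power_mult_distrib summable_mult)

definition minus_ell2 :: "ell2 \<Rightarrow> ell2 \<Rightarrow> ell2" where "minus_ell2 x y = x + - y"

definition inner_ell2 :: "ell2 \<Rightarrow> ell2 \<Rightarrow> real" where
  "inner_ell2 x y = (\<Sum>n. cf x n \<bullet> cf y n)"

definition norm_ell2 :: "ell2 \<Rightarrow> real" where "norm_ell2 x = sqrt (inner x x)"
definition sgn_ell2 :: "ell2 \<Rightarrow> ell2" where "sgn_ell2 x = inverse (norm x) *\<^sub>R x"
definition dist_ell2 :: "ell2 \<Rightarrow> ell2 \<Rightarrow> real" where "dist_ell2 x y = norm (x - y)"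
definition uniformity_ell2 :: "(ell2 \<times> ell2) filter" where
  "uniformity_ell2 = (INF e\<in>{0<..}. principal {(x, y). dist x y < e})"
definition open_ell2 :: "ell2 set \<Rightarrow> bool" where
  "open_ell2 U = (\<forall>x\<in>U. eventually (\<lambda>(x', y). x' = x \<longrightarrow> y \<in> U) uniformity)"

instance
proof
  fix x y z :: ell2 and a b :: real
  show "x + y + z = x + (y + z)" by transfer (simp add: add.assoc)
  show "x + y = y + x" by transfer (simp add: add.commute)
  show "0 + x = x" by transfer simp
  show "- x + x = 0" by transfer simp
  show "x - y = x + - y" by (simp add: minus_ell2_def)
  show "a *\<^sub>R (x + y) = a *\<^sub>R x + a *\<^sub>R y" by transfer (simp add: algebra_simps)
  show "(a + b) *\<^sub>R x = a *\<^sub>R x + b *\<^sub>R x" by transfer (simp add: algebra_simps)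
  show "a *\<^sub>R b *\<^sub>R x = (a * b) *\<^sub>R x" by transfer simp
  show "1 *\<^sub>R x = x" by transfer simp
  show "inner x y = inner y x" by (simp add: inner_ell2_def inner_commute)
  show "inner (x + y) z = inner x z + inner y z"
    unfolding inner_ell2_def
    by (simp add: plus_ell2.rep_eq inner_add_left suminf_add summable_inner_cf)
  show "inner (a *\<^sub>R x) y = a * inner x y"
    unfolding inner_ell2_def by (simp add: scaleR_ell2.rep_eq suminf_mult summable_inner_cf)
  show "0 \<le> inner x x" unfolding inner_ell2_def by (intro suminf_nonneg summable_inner_cf) simp
  show "inner x x = 0 \<longleftrightarrow> x = 0"
  proof -
    have "inner x x = 0 \<longleftrightarrow> (\<forall>n. cf x n \<bullet> cf x n = 0)"
      unfolding inner_ell2_def by (intro suminf_eq_zero_iff summable_inner_cf) simp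
    also have "\<dots> \<longleftrightarrow> x = 0" by (auto simp: zero_ell2.rep_eq intro!: ell2_eqI)
    finally show ?thesis .
  qed
  show "norm x = sqrt (inner x x)" by (simp add: norm_ell2_def)
  show "sgn x = inverse (norm x) *\<^sub>R x" by (simp add: sgn_ell2_def)
  show "dist x y = norm (x - y)" by (simp add: dist_ell2_def)
qed (rule uniformity_ell2_def open_ell2_def)+

end

lemmas cf_simps [simp] = zero_ell2.rep_eq plus_ell2.rep_eq uminus_ell2.rep_eq scaleR_ell2.rep_eq

lemma cf_diff [simp]: "cf (x - y) n = cf x n - cf y n"
  unfolding minus_ell2_def plus_ell2.rep_eq uminus_ell2.rep_eq by (rule add_uminus_conv_diff)

lemma norm_ell2_sums: "(\<lambda>n. (cmod (cf x n))\<^sup>2) sums (norm x)\<^sup>2"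
  using summable_sums[OF summable_inner_cf[of x x]]
  by (simp only: power2_norm_eq_inner inner_ell2_def)

lemma inner_ell2_sums: "(\<lambda>n. cf x n \<bullet> cf y n) sums (x \<bullet> y)"
  using summable_inner_cf by (simp add: inner_ell2_def summable_sums)

lemma sum_cf_le: "(\<Sum>n<N. (cmod (cf x n))\<^sup>2) \<le> (norm x)\<^sup>2"
  unfolding sums_unique[OF norm_ell2_sums] by (rule sum_le_suminf[OF summable_cf]) auto

lemma cmod_cf_le: "cmod (cf x n) \<le> norm x"
proof -
  have "(cmod (cf x n))\<^sup>2 \<le> (\<Sum>n<Suc n. (cmod (cf x n))\<^sup>2)" by (simp add: sum_nonneg)
  also have "\<dots> \<le> (norm x)\<^sup>2" by (rule sum_cf_le)
  finally show ?thesis by (rule power2_le_imp_le) simp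
qed

lemma ell2_of_bounded:
  assumes "0 \<le> C" "\<And>N. (\<Sum>n<N. (cmod (a n))\<^sup>2) \<le> C\<^sup>2"
  shows "summable (\<lambda>n. (cmod (a n))\<^sup>2)" "cf (ell2_of a) = a" "norm (ell2_of a) \<le> C"
proof -
  show s: "summable (\<lambda>n. (cmod (a n))\<^sup>2)"
    by (rule summableI_nonneg_bounded[of _ "C\<^sup>2"]) (use assms in auto)
  then show c: "cf (ell2_of a) = a" by (rule cf_ell2_of)
  have "(norm (ell2_of a))\<^sup>2 \<le> C\<^sup>2"
    unfolding sums_unique[OF norm_ell2_sums] c by (rule suminf_le_const[OF s]) (rule assms(2))
  then show "norm (ell2_of a) \<le> C" using assms(1) by (rule power2_le_imp_le)
qed

text \<open>Completeness: the coordinates converge, and the Cauchy estimate survives in the limit for each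
  finite section of the sequence.\<close>

instance ell2 :: banach
proof
  fix X :: "nat \<Rightarrow> ell2"
  assume X: "Cauchy X"
  have "Cauchy (\<lambda>k. cf (X k) n)" for n
  proof (rule CauchyI)
    fix e :: real assume "0 < e"
    then obtain M where "\<And>i j. i \<ge> M \<Longrightarrow> j \<ge> M \<Longrightarrow> norm (X i - X j) < e"
      using CauchyD[OF X] by blast
    then show "\<exists>M. \<forall>i\<ge>M. \<forall>j\<ge>M. norm (cf (X i) n - cf (X j) n) < e"
      using order_le_less_trans[OF cmod_cf_le[of "X i - X j" n for i j]] by simp blast
  qed
  then have a: "(\<lambda>k. cf (X k) n) \<longlonglongrightarrow> lim (\<lambda>k. cf (X k) n)" for n
    using Cauchy_convergent convergent_LIMSEQ_iff by blast
  define a where "a n = lim (\<lambda>k. cf (X k) n)" for n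
  note a = a[folded a_def]
  have tail: "\<exists>M. \<forall>i\<ge>M. \<forall>N. (\<Sum>n<N. (cmod (a n - cf (X i) n))\<^sup>2) \<le> e\<^sup>2" if "0 < e" for e :: real
  proof -
    obtain M where M: "\<And>i j. i \<ge> M \<Longrightarrow> j \<ge> M \<Longrightarrow> norm (X i - X j) < e"
      using CauchyD[OF X \<open>0 < e\<close>] by blast
    have "(\<Sum>n<N. (cmod (a n - cf (X i) n))\<^sup>2) \<le> e\<^sup>2" if i: "i \<ge> M" for i N
    proof (rule LIMSEQ_le_const2)
      show "(\<lambda>j. \<Sum>n<N. (cmod (cf (X j) n - cf (X i) n))\<^sup>2) \<longlonglongrightarrow> (\<Sum>n<N. (cmod (a n - cf (X i) n))\<^sup>2)"
        by (intro tendsto_intros a)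
      have "(\<Sum>n<N. (cmod (cf (X j) n - cf (X i) n))\<^sup>2) \<le> e\<^sup>2" if "j \<ge> M" for j
      proof -
        have "(\<Sum>n<N. (cmod (cf (X j) n - cf (X i) n))\<^sup>2) \<le> (norm (X j - X i))\<^sup>2"
          using sum_cf_le[of "X j - X i" N] by simp
        also have "\<dots> \<le> e\<^sup>2" using M[OF that i] by (intro power_mono) auto
        finally show ?thesis .
      qed
      then show "\<exists>K. \<forall>j\<ge>K. (\<Sum>n<N. (cmod (cf (X j) n - cf (X i) n))\<^sup>2) \<le> e\<^sup>2" by blast
    qed
    then show ?thesis by blast
  qed
  obtain i where i: "\<And>N. (\<Sum>n<N. (cmod (a n - cf (X i) n))\<^sup>2) \<le> 1\<^sup>2" using tail[of 1] by auto
  define L where "L = ell2_of (\<lambda>n. a n - cf (X i) n) + X i"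
  have L: "cf L n = a n" for n
    unfolding L_def by (simp add: ell2_of_bounded(2)[OF _ i])
  have "X \<longlonglongrightarrow> L"
  proof (rule LIMSEQ_I)
    fix e :: real assume e: "0 < e"
    obtain M where M: "\<And>j N. j \<ge> M \<Longrightarrow> (\<Sum>n<N. (cmod (a n - cf (X j) n))\<^sup>2) \<le> (e / 2)\<^sup>2"
      using tail[of "e / 2"] e by auto
    have "norm (X j - L) < e" if "j \<ge> M" for j
    proof -
      have "L - X j = ell2_of (\<lambda>n. a n - cf (X j) n)"
        by (rule ell2_eqI) (use e in \<open>simp add: L ell2_of_bounded(2)[OF _ M[OF that]]\<close>)
      then have "norm (L - X j) \<le> e / 2" using ell2_of_bounded(3)[OF _ M[OF that]] e by simp
      then show ?thesis using e by (simp add: norm_minus_commute)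
    qed
    then show "\<exists>no. \<forall>n\<ge>no. norm (X n - L) < e" by blast
  qed
  then show "convergent X" by (rule convergentI)
qed

lift_definition cs :: "complex \<Rightarrow> ell2 \<Rightarrow> ell2" is "\<lambda>c x n. c * x n"
  by (simp add: norm_mult power_mult_distrib summable_mult)

lemmas cf_cs [simp] = cs.rep_eq

lemma cs_cs [simp]: "cs c (cs d x) = cs (c * d) x"
  by (intro ell2_eqI) simp

lemma cs_1 [simp]: "cs 1 x = x"
  by (intro ell2_eqI) simp

lemma cs_add_right: "cs c (x + y) = cs c x + cs c y"
  by (intro ell2_eqI) (simp add: algebra_simps)

lemma cs_of_real: "cs (of_real r) x = r *\<^sub>R x"
  by (intro ell2_eqI) (simp add: scaleR_conv_of_real)

lemma cs_decomp: "cs c x = Re c *\<^sub>R x + Im c *\<^sub>R cs \<i> x"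
  by (intro ell2_eqI) (simp add: complex_eq_iff)

lemma norm_cs [simp]: "norm (cs c x) = cmod c * norm x"
proof -
  have "(\<lambda>n. (cmod c)\<^sup>2 * (cmod (cf x n))\<^sup>2) sums ((cmod c)\<^sup>2 * (norm x)\<^sup>2)"
    by (intro sums_mult norm_ell2_sums)
  moreover have "(\<lambda>n. (cmod c)\<^sup>2 * (cmod (cf x n))\<^sup>2) sums (norm (cs c x))\<^sup>2"
    using norm_ell2_sums[of "cs c x"] by (simp add: norm_mult power_mult_distrib)
  ultimately have "(norm (cs c x))\<^sup>2 = (cmod c * norm x)\<^sup>2"
    unfolding power_mult_distrib by (rule sums_unique2[rotated])
  then show ?thesis by (rule power2_eq_imp_eq) auto
qed

lemma inner_cs_left: "cs c x \<bullet> y = x \<bullet> cs (cnj c) y"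
  unfolding inner_ell2_def by (intro arg_cong[of _ _ suminf] ext) (simp add: inner_complex_def algebra_simps)

lift_definition cs_op :: "complex \<Rightarrow> ell2 \<Rightarrow>\<^sub>L ell2" is cs
proof (rule bounded_linear_intro)
  fix c r x y
  show "cs c (x + y) = cs c x + cs c y" by (rule cs_add_right)
  show "cs c (r *\<^sub>R x) = r *\<^sub>R cs c x" by (intro ell2_eqI) (simp add: algebra_simps)
  show "norm (cs c x) \<le> norm x * cmod c" by (simp add: mult.commute)
qed

lemmas cs_op_apply [simp] = cs_op.rep_eq

text \<open>The complex inner product, conjugate-linear in the second argument, recovered from its real
  part.\<close>

definition cinner :: "ell2 \<Rightarrow> ell2 \<Rightarrow> complex" where
  "cinner x y = Complex (x \<bullet> y) (x \<bullet> cs \<i> y)"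

lemma cinner_suminf: "cinner x y = (\<Sum>n. cf x n * cnj (cf y n))"
proof -
  have "(\<lambda>n. of_real (cf x n \<bullet> cf y n) + \<i> * of_real (cf x n \<bullet> cf (cs \<i> y) n))
      sums (of_real (x \<bullet> y) + \<i> * of_real (x \<bullet> cs \<i> y))"
    by (intro sums_add sums_mult sums_of_real inner_ell2_sums)
  moreover have "of_real (cf x n \<bullet> cf y n) + \<i> * of_real (cf x n \<bullet> cf (cs \<i> y) n) = cf x n * cnj (cf y n)" for n
    by (simp add: complex_eq_iff inner_complex_def)
  ultimately show ?thesis by (simp add: cinner_def Complex_eq sums_iff)
qed

lemma Re_cinner [simp]: "Re (cinner x y) = x \<bullet> y"
  by (simp add: cinner_def)

lemma cinner_add_left: "cinner (x + y) z = cinner x z + cinner y z"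
  by (simp add: cinner_def inner_add_left complex_eq_iff)

lemma cinner_cs_left: "cinner (cs c x) y = c * cinner x y"
  by (simp add: cinner_def complex_eq_iff inner_cs_left)
    (simp add: cs_decomp[of "cnj c"] cs_decomp[of "cnj c * \<i>"] inner_add_right inner_diff_right)

lemma cinner_commute: "cinner y x = cnj (cinner x y)"
proof -
  have "y \<bullet> cs \<i> x = cs (- \<i>) y \<bullet> x" by (simp add: inner_cs_left)
  also have "\<dots> = - (x \<bullet> cs \<i> y)"
    by (simp add: cs_decomp[of "- \<i>"] inner_commute)
  finally show ?thesis by (simp add: cinner_def complex_eq_iff inner_commute)
qed

lemma cinner_cs_right: "cinner x (cs c y) = cnj c * cinner x y"
  unfolding cinner_commute[of x "cs c y"] cinner_commute[of x y] by (simp add: cinner_cs_left)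

lemma cinner_add_right: "cinner x (y + z) = cinner x y + cinner x z"
  unfolding cinner_commute[of x "y + z"] cinner_commute[of x y] cinner_commute[of x z]
  by (simp add: cinner_add_left)

lemma cmod_cinner_le: "cmod (cinner x y) \<le> norm x * norm y"
proof (cases "cinner x y = 0")
  case False
  \<comment> \<open>rotating \<open>x\<close> makes the inner product real\<close>
  define w where "w = cinner x y"
  let ?c = "cnj w / of_real (cmod w)"
  have "?c * w = of_real ((cmod w)\<^sup>2) / of_real (cmod w)"
    unfolding complex_norm_square by simp
  also have "\<dots> = of_real (cmod w)" by (simp add: power2_eq_square)
  finally have "cinner (cs ?c x) y = of_real (cmod w)" by (simp add: cinner_cs_left w_def)
  then have "Re (cinner (cs ?c x) y) = cmod w" by simp
  then have "cmod w = cs ?c x \<bullet> y" unfolding Re_cinner by simp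
  also have "\<dots> \<le> norm (cs ?c x) * norm y" by (rule norm_cauchy_schwarz)
  also have "\<dots> = norm x * norm y" using False by (simp add: norm_divide flip: w_def)
  finally show ?thesis unfolding w_def .
qed simp

text \<open>A real operator is complex-linear as soon as it commutes with multiplication by \<open>\<i>\<close>.\<close>

definition clin :: "(ell2 \<Rightarrow>\<^sub>L ell2) \<Rightarrow> bool" where
  "clin A \<longleftrightarrow> (\<forall>x. A (cs \<i> x) = cs \<i> (A x))"

lemma clinD: "clin A \<Longrightarrow> A (cs c x) = cs c (A x)"
  unfolding clin_def
  unfolding cs_decomp[of c] by (simp add: blinfun.add_right blinfun.scaleR_right)

lemma clin_adj:
  assumes "clin A"
  shows "clin (adj A)"
  unfolding clin_def
proof
  fix x
  have "adj A (cs \<i> x) \<bullet> y = cs \<i> (adj A x) \<bullet> y" for y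
    using clinD[OF assms, of "- \<i>" y] by (simp add: adj_left inner_cs_left)
  then show "adj A (cs \<i> x) = cs \<i> (adj A x)" using vector_eq_rdot by blast
qed

lemma cinner_adj: "clin A \<Longrightarrow> cinner (A x) y = cinner x (adj A y)"
  using clin_adj[of A] by (simp add: cinner_def adj_right clin_def)

section \<open>The Hardy space as a space of power series\<close>

definition hardy :: "ell2 \<Rightarrow> complex \<Rightarrow> complex" where
  "hardy x z = (if z \<in> \<bbbD> then \<Sum>n. cf x n * z ^ n else 0)"

lemma hardy_outside [simp]: "z \<notin> \<bbbD> \<Longrightarrow> hardy x z = 0"
  by (simp add: hardy_def)

lemma hardy_sums:
  assumes "z \<in> \<bbbD>"
  shows "(\<lambda>n. cf x n * z ^ n) sums hardy x z"
proof -
  have "summable (\<lambda>n. cf x n * z ^ n)"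
  proof (rule summable_comparison_test')
    show "summable (\<lambda>n. norm x * cmod z ^ n)" using assms by (intro summable_mult summable_geometric) simp
    show "norm (cf x n * z ^ n) \<le> norm x * cmod z ^ n" for n
      by (simp add: norm_mult norm_power mult_right_mono cmod_cf_le)
  qed
  then show ?thesis using assms by (simp add: hardy_def summable_sums)
qed

lemma holomorphic_hardy: "hardy x holomorphic_on \<bbbD>"
  by (rule power_series_holomorphic[where a = "cf x"]) (use hardy_sums in simp)

lemma taylor_coeff_unique:
  assumes "0 < r" "\<And>z. z \<in> ball 0 r \<Longrightarrow> (\<lambda>n. a n * z ^ n) sums f z"
  shows "taylor_coeff f n = a n"
proof -
  have "f has_fps_expansion Abs_fps a"
    by (rule has_fps_expansionI, rule eventually_nhds_in_open[of "ball 0 r", THEN eventually_mono])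
      (use assms in auto)
  then show ?thesis using fps_nth_fps_expansion by (fastforce simp: taylor_coeff_def)
qed

lemma taylor_coeff_hardy [simp]: "taylor_coeff (hardy x) n = cf x n"
  by (rule taylor_coeff_unique[of 1]) (auto intro: hardy_sums)

lemma taylor_coeff_sums:
  assumes "f holomorphic_on \<bbbD>" "z \<in> \<bbbD>"
  shows "(\<lambda>n. taylor_coeff f n * z ^ n) sums f z"
  using holomorphic_power_series[OF assms] by (simp add: taylor_coeff_def)

lemma hardy_ell2_of:
  assumes f: "f holomorphic_on \<bbbD>" and s: "summable (\<lambda>n. (cmod (taylor_coeff f n))\<^sup>2)" and z: "z \<in> \<bbbD>"
  shows "hardy (ell2_of (taylor_coeff f)) z = f z"
  using hardy_sums[OF z, of "ell2_of (taylor_coeff f)"] taylor_coeff_sums[OF f z]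
  unfolding cf_ell2_of[OF s] by (rule sums_unique2)

lemma H2_eq: "H2 = range hardy"
proof -
  have "f \<in> range hardy" if "f \<in> H2" for f
  proof -
    have "hardy (ell2_of (taylor_coeff f)) z = f z" for z
      using that hardy_ell2_of[of f z] by (cases "z \<in> \<bbbD>") (auto simp: H2_def)
    then show ?thesis by (metis ext rangeI)
  qed
  moreover have "hardy x \<in> H2" for x
    by (auto simp: H2_def holomorphic_hardy summable_cf)
  ultimately show ?thesis by blast
qed

lemma hardy_in_H2 [simp]: "hardy x \<in> H2"
  by (simp add: H2_eq)

lemma hardy_eq_iff [simp]: "hardy x = hardy y \<longleftrightarrow> x = y"
proof
  assume "hardy x = hardy y"
  then have "cf x n = cf y n" for n using taylor_coeff_hardy[of x n] by simp
  then show "x = y" by (rule ell2_eqI)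
qed simp

lemma hardy_eqI: "(\<And>z. z \<in> \<bbbD> \<Longrightarrow> hardy x z = hardy y z) \<Longrightarrow> x = y"
  unfolding hardy_eq_iff[symmetric] fun_eq_iff by (metis hardy_outside)

lemma hardy_add: "hardy (x + y) z = hardy x z + hardy y z"
proof (cases "z \<in> \<bbbD>")
  case True
  have "(\<lambda>n. cf (x + y) n * z ^ n) sums (hardy x z + hardy y z)"
    using sums_add[OF hardy_sums[OF True, of x] hardy_sums[OF True, of y]] by (simp add: algebra_simps)
  then show ?thesis using hardy_sums[OF True] by (rule sums_unique2[symmetric])
qed simp

lemma hardy_cs: "hardy (cs c x) z = c * hardy x z"
proof (cases "z \<in> \<bbbD>")
  case True
  have "(\<lambda>n. cf (cs c x) n * z ^ n) sums (c * hardy x z)"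
    using sums_mult[OF hardy_sums[OF True, of x], of c] by (simp add: algebra_simps)
  then show ?thesis using hardy_sums[OF True] by (rule sums_unique2[symmetric])
qed simp

lemma hardy_zero: "hardy 0 = (\<lambda>z. 0)"
  by (simp add: hardy_def fun_eq_iff)

lemma hardy_scaleR: "hardy (r *\<^sub>R x) z = of_real r * hardy x z"
  by (simp flip: cs_of_real add: hardy_cs)

lemma hardy_diff: "hardy (x - y) z = hardy x z - hardy y z"
  using hardy_add[of "x - y" y z] by simp

lemma H2_inner_hardy [simp]: "H2_inner (hardy x) (hardy y) = cinner x y"
  by (simp add: H2_inner_def cinner_suminf)

lemma H2_norm_hardy [simp]: "H2_norm (hardy x) = norm x"
  by (simp add: H2_norm_def norm_eq_sqrt_inner)

definition szego :: "complex \<Rightarrow> ell2" where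
  "szego w = ell2_of (\<lambda>n. cnj w ^ n)"

lemma cf_szego:
  assumes "w \<in> \<bbbD>"
  shows "cf (szego w) n = cnj w ^ n"
proof -
  have "summable (\<lambda>n. ((cmod w)\<^sup>2) ^ n)"
    using assms by (intro summable_geometric) (simp add: power_less_one_iff abs_square_less_1)
  then have "summable (\<lambda>n. (cmod (cnj w ^ n))\<^sup>2)"
    by (simp add: norm_power power_mult[symmetric] mult.commute)
  then show ?thesis by (simp add: szego_def cf_ell2_of)
qed

lemma cinner_szego: "w \<in> \<bbbD> \<Longrightarrow> cinner x (szego w) = hardy x w"
  by (simp add: cinner_suminf cf_szego hardy_def)

lemma hardy_szego:
  assumes "w \<in> \<bbbD>" "z \<in> \<bbbD>"
  shows "hardy (szego w) z = 1 / (1 - cnj w * z)"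
proof -
  have "cmod (cnj w * z) < 1"
    using assms mult_strict_mono'[of "cmod w" 1 "cmod z" 1] by (simp add: norm_mult)
  then have "(\<lambda>n. cf (szego w) n * z ^ n) sums (1 / (1 - cnj w * z))"
    using geometric_sums[of "cnj w * z"] assms(1) by (simp add: cf_szego power_mult_distrib)
  then show ?thesis using hardy_sums[OF assms(2)] by (rule sums_unique2[symmetric])
qed

section \<open>Multiplication operators\<close>

lemma taylor_coeff_mult:
  assumes "f holomorphic_on \<bbbD>" "g holomorphic_on \<bbbD>"
  shows "taylor_coeff (\<lambda>z. f z * g z) n = (\<Sum>i\<le>n. taylor_coeff f i * taylor_coeff g (n - i))"
proof -
  have "(deriv ^^ n) (\<lambda>z. f z * g z) 0
      = (\<Sum>i\<le>n. of_nat (n choose i) * (deriv ^^ i) f 0 * (deriv ^^ (n - i)) g 0)"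
    using higher_deriv_mult[OF assms, of 0 n] by (simp add: atLeast0AtMost)
  moreover have "of_nat (n choose i) * (deriv ^^ i) f 0 * (deriv ^^ (n - i)) g 0 / fact n
      = taylor_coeff f i * taylor_coeff g (n - i)" if "i \<le> n" for i
    using that by (simp add: taylor_coeff_def binomial_fact)
  ultimately show ?thesis
    unfolding taylor_coeff_def[of "\<lambda>z. f z * g z"] by (simp add: sum_divide_distrib)
qed

abbreviation circ :: "real \<Rightarrow> real \<Rightarrow> complex" where
  "circ r t \<equiv> of_real r * exp (2 * of_real pi * \<i> * of_real t)"

lemma norm_circ: "0 \<le> r \<Longrightarrow> cmod (circ r t) = r"
  by (simp add: norm_mult)

text \<open>Cauchy's formula for Taylor coefficients; on the circle of radius \<open>r\<close> a negative power of the
  variable is a power of its conjugate up to a power of \<open>r\<close>.\<close>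

lemma circle_mean_taylor:
  assumes g: "g holomorphic_on \<bbbD>" and r: "0 < r" "r < 1"
  shows "((\<lambda>t. g (circ r t) * cnj (circ r t) ^ n) has_integral (taylor_coeff g n * of_real r ^ (2 * n))) {0..1}"
proof -
  let ?C = "2 * of_real pi * \<i> :: complex"
  have "cball 0 r \<subseteq> \<bbbD>" using r by auto
  then have "continuous_on (cball 0 r) g" "g holomorphic_on ball 0 r"
    using g r by (auto intro!: holomorphic_on_imp_continuous_on holomorphic_on_subset[OF g])
  then have "((\<lambda>u. g u / (u - 0) ^ Suc n) has_contour_integral (?C / fact n * (deriv ^^ n) g 0)) (circlepath 0 r)"
    using Cauchy_has_contour_integral_higher_derivative_circlepath[of 0 r g 0 n] r by simp
  moreover have "circlepath 0 r t = circ r t" for t by (simp add: circlepath)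
  moreover have "vector_derivative (circlepath 0 r) (at t) = ?C * circ r t" for t
    by (simp add: vector_derivative_circlepath)
  ultimately have "((\<lambda>t. g (circ r t) / circ r t ^ Suc n * (?C * circ r t)) has_integral (?C * taylor_coeff g n)) {0..1}"
    unfolding has_contour_integral by (simp add: taylor_coeff_def del: power_Suc)
  then have "((\<lambda>t. of_real r ^ (2 * n) / ?C * (g (circ r t) / circ r t ^ Suc n * (?C * circ r t)))
      has_integral (of_real r ^ (2 * n) / ?C * (?C * taylor_coeff g n))) {0..1}"
    by (rule has_integral_mult_right)
  moreover have "of_real r ^ (2 * n) / ?C * (g (circ r t) / circ r t ^ Suc n * (?C * circ r t))
      = g (circ r t) * cnj (circ r t) ^ n" for t
  proof -
    let ?w = "circ r t"
    have w: "?w \<noteq> 0" using r by simp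
    have "of_real r ^ (2 * n) = (?w * cnj ?w) ^ n"
      unfolding complex_norm_square[symmetric] norm_circ[OF less_imp_le[OF r(1)]] by (simp add: power_mult)
    then show ?thesis using w by (simp add: power_mult_distrib field_simps)
  qed
  ultimately show ?thesis by (simp add: mult.commute)
qed

lemma circle_mean_poly:
  assumes g: "g holomorphic_on \<bbbD>" and r: "0 < r" "r < 1"
  shows "((\<lambda>t. g (circ r t) * cnj (\<Sum>k<N. p k * circ r t ^ k)) has_integral
    (\<Sum>k<N. taylor_coeff g k * cnj (p k) * of_real r ^ (2 * k))) {0..1}"
proof -
  have "((\<lambda>t. \<Sum>k<N. cnj (p k) * (g (circ r t) * cnj (circ r t) ^ k)) has_integral
      (\<Sum>k<N. cnj (p k) * (taylor_coeff g k * of_real r ^ (2 * k)))) {0..1}"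
    by (intro has_integral_sum has_integral_mult_right circle_mean_taylor assms) auto
  then show ?thesis by (simp add: sum_distrib_left mult_ac)
qed

lemma taylor_coeff_poly: "taylor_coeff (\<lambda>z. \<Sum>k<N. p k * z ^ k) n = (if n < N then p n else 0)"
proof (rule taylor_coeff_unique[of 1])
  fix z :: complex
  show "(\<lambda>n. (if n < N then p n else 0) * z ^ n) sums (\<Sum>k<N. p k * z ^ k)"
    using sums_If_finite_set[of "{..<N}" "\<lambda>n. p n * z ^ n"] by (simp add: if_distrib if_distribR cong: if_cong)
qed simp

text \<open>Bessel's inequality on a circle of radius \<open>r < 1\<close> bounds the first coefficients of \<open>\<phi> P\<close> by
  the mean of \<open>|\<phi> P|\<^sup>2 \<le> M\<^sup>2 |P|\<^sup>2\<close>, which is computed by orthogonality.\<close>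

lemma taylor_mult_poly_le:
  assumes \<phi>: "\<phi> holomorphic_on \<bbbD>" and M: "\<And>z. z \<in> \<bbbD> \<Longrightarrow> cmod (\<phi> z) \<le> M" and r: "0 < r" "r < 1"
  shows "(\<Sum>k<N. (cmod (taylor_coeff (\<lambda>z. \<phi> z * (\<Sum>k<N. p k * z ^ k)) k))\<^sup>2 * r ^ (2 * k))
    \<le> M\<^sup>2 * (\<Sum>k<N. (cmod (p k))\<^sup>2 * r ^ (2 * k))"
proof -
  define P where "P z = (\<Sum>k<N. p k * z ^ k)" for z :: complex
  define G where "G z = \<phi> z * P z" for z
  define q where "q = taylor_coeff G"
  define Q where "Q z = (\<Sum>k<N. q k * z ^ k)" for z :: complex
  have hP: "P holomorphic_on \<bbbD>" and hQ: "Q holomorphic_on \<bbbD>"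
    unfolding P_def Q_def by (intro holomorphic_intros)+
  have hG: "G holomorphic_on \<bbbD>" unfolding G_def by (intro holomorphic_intros \<phi> hP)
  have cD: "circ r t \<in> \<bbbD>" for t using r by (simp add: norm_circ del: norm_mult)
  have sq: "z * cnj z = of_real ((cmod z)\<^sup>2)" for z by (rule complex_norm_square[symmetric])
  have Re_int: "((\<lambda>t. Re (f t)) has_integral Re i) {0..1}" if "(f has_integral i) {0..1}" for f i
    using has_integral_linear[OF that bounded_linear_Re] by (simp add: o_def)
  have PP: "((\<lambda>t. (cmod (P (circ r t)))\<^sup>2) has_integral (\<Sum>k<N. (cmod (p k))\<^sup>2 * r ^ (2 * k))) {0..1}"
  proof -
    have "((\<lambda>t. P (circ r t) * cnj (P (circ r t))) has_integral
        (\<Sum>k<N. p k * cnj (p k) * of_real r ^ (2 * k))) {0..1}"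
      using circle_mean_poly[OF hP r, where p = p and N = N]
      unfolding P_def taylor_coeff_poly by (simp cong: if_cong)
    from Re_int[OF this] show ?thesis by (simp add: sq flip: of_real_power of_real_mult)
  qed
  have QQ: "((\<lambda>t. (cmod (Q (circ r t)))\<^sup>2) has_integral (\<Sum>k<N. (cmod (q k))\<^sup>2 * r ^ (2 * k))) {0..1}"
  proof -
    have "((\<lambda>t. Q (circ r t) * cnj (Q (circ r t))) has_integral
        (\<Sum>k<N. q k * cnj (q k) * of_real r ^ (2 * k))) {0..1}"
      using circle_mean_poly[OF hQ r, where p = q and N = N]
      unfolding Q_def taylor_coeff_poly by (simp cong: if_cong)
    from Re_int[OF this] show ?thesis by (simp add: sq flip: of_real_power of_real_mult)
  qed
  have GQ: "((\<lambda>t. Re (G (circ r t) * cnj (Q (circ r t)))) has_integral (\<Sum>k<N. (cmod (q k))\<^sup>2 * r ^ (2 * k))) {0..1}"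
  proof -
    have "((\<lambda>t. G (circ r t) * cnj (Q (circ r t))) has_integral
        (\<Sum>k<N. q k * cnj (q k) * of_real r ^ (2 * k))) {0..1}"
      using circle_mean_poly[OF hG r, where p = q and N = N] by (simp add: Q_def q_def)
    from Re_int[OF this] show ?thesis by (simp add: sq flip: of_real_power of_real_mult)
  qed
  have expand: "(cmod (a - b))\<^sup>2 = (cmod a)\<^sup>2 - 2 * Re (a * cnj b) + (cmod b)\<^sup>2" for a b
    unfolding cmod_power2 by (simp add: power2_eq_square algebra_simps)
  have "((\<lambda>t. M\<^sup>2 * (cmod (P (circ r t)))\<^sup>2 - 2 * Re (G (circ r t) * cnj (Q (circ r t))) + (cmod (Q (circ r t)))\<^sup>2)
      has_integral (M\<^sup>2 * (\<Sum>k<N. (cmod (p k))\<^sup>2 * r ^ (2 * k))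
        - 2 * (\<Sum>k<N. (cmod (q k))\<^sup>2 * r ^ (2 * k)) + (\<Sum>k<N. (cmod (q k))\<^sup>2 * r ^ (2 * k)))) {0..1}"
    by (intro has_integral_add has_integral_diff has_integral_mult_right PP QQ GQ)
  moreover have "0 \<le> M\<^sup>2 * (cmod (P (circ r t)))\<^sup>2 - 2 * Re (G (circ r t) * cnj (Q (circ r t))) + (cmod (Q (circ r t)))\<^sup>2" for t
  proof -
    have "cmod (G (circ r t)) \<le> M * cmod (P (circ r t))"
      unfolding G_def norm_mult by (intro mult_right_mono M cD) simp
    then have "(cmod (G (circ r t)))\<^sup>2 \<le> M\<^sup>2 * (cmod (P (circ r t)))\<^sup>2"
      unfolding power_mult_distrib[symmetric] by (intro power_mono) auto
    moreover have "0 \<le> (cmod (G (circ r t) - Q (circ r t)))\<^sup>2" by simp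
    ultimately show ?thesis unfolding expand by linarith
  qed
  ultimately have "0 \<le> M\<^sup>2 * (\<Sum>k<N. (cmod (p k))\<^sup>2 * r ^ (2 * k))
        - 2 * (\<Sum>k<N. (cmod (q k))\<^sup>2 * r ^ (2 * k)) + (\<Sum>k<N. (cmod (q k))\<^sup>2 * r ^ (2 * k))"
    by (rule has_integral_nonneg)
  then show ?thesis by (simp add: q_def G_def[abs_def] P_def[abs_def])
qed

lemma taylor_mult_le:
  assumes \<phi>: "\<phi> holomorphic_on \<bbbD>" and M: "\<And>z. z \<in> \<bbbD> \<Longrightarrow> cmod (\<phi> z) \<le> M"
  shows "(\<Sum>k<N. (cmod (taylor_coeff (\<lambda>z. \<phi> z * hardy x z) k))\<^sup>2) \<le> (M * norm x)\<^sup>2"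
proof -
  \<comment> \<open>the first \<open>N\<close> coefficients of the product depend only on the first \<open>N\<close> coefficients of \<open>x\<close>\<close>
  define P where "P z = (\<Sum>k<N. cf x k * z ^ k)" for z :: complex
  have hP: "P holomorphic_on \<bbbD>" unfolding P_def by (intro holomorphic_intros)
  define c where "c k = (cmod (taylor_coeff (\<lambda>z. \<phi> z * P z) k))\<^sup>2" for k
  have eq: "taylor_coeff (\<lambda>z. \<phi> z * hardy x z) k = taylor_coeff (\<lambda>z. \<phi> z * P z) k" if "k < N" for k
    unfolding taylor_coeff_mult[OF \<phi> holomorphic_hardy] taylor_coeff_mult[OF \<phi> hP]
    by (intro sum.cong) (use that in \<open>auto simp: P_def[abs_def] taylor_coeff_poly\<close>)
  have "(\<Sum>k<N. c k * r ^ (2 * k)) \<le> (M * norm x)\<^sup>2" if r: "0 < r" "r < 1" for r :: real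
  proof -
    have "(\<Sum>k<N. c k * r ^ (2 * k)) \<le> M\<^sup>2 * (\<Sum>k<N. (cmod (cf x k))\<^sup>2 * r ^ (2 * k))"
      unfolding c_def P_def by (rule taylor_mult_poly_le[OF \<phi> M r])
    also have "\<dots> \<le> M\<^sup>2 * (\<Sum>k<N. (cmod (cf x k))\<^sup>2)"
      using r by (intro mult_left_mono sum_mono) (auto simp: mult_left_le power_le_one)
    also have "\<dots> \<le> M\<^sup>2 * (norm x)\<^sup>2" by (intro mult_left_mono sum_cf_le) auto
    finally show ?thesis by (simp add: power_mult_distrib)
  qed
  then have "\<forall>\<^sub>F r in at_left (1::real). (\<Sum>k<N. c k * r ^ (2 * k)) \<le> (M * norm x)\<^sup>2"
    by (auto simp: eventually_at_left_field intro!: exI[of _ 0])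
  moreover have "((\<lambda>r::real. \<Sum>k<N. c k * r ^ (2 * k)) \<longlongrightarrow> (\<Sum>k<N. c k * 1 ^ (2 * k))) (at_left 1)"
    by (intro tendsto_intros)
  ultimately have "(\<Sum>k<N. c k * 1 ^ (2 * k)) \<le> (M * norm x)\<^sup>2"
    by (intro tendsto_upperbound) auto
  then show ?thesis by (simp add: c_def eq)
qed

text \<open>Multiplication by \<open>\<phi>\<close> on the level of coefficients, meaningful for bounded holomorphic \<open>\<phi>\<close>.\<close>

definition mult_op :: "(complex \<Rightarrow> complex) \<Rightarrow> ell2 \<Rightarrow>\<^sub>L ell2" where
  "mult_op \<phi> = Blinfun (\<lambda>x. ell2_of (taylor_coeff (\<lambda>z. \<phi> z * hardy x z)))"

lemma
  assumes \<phi>: "\<phi> holomorphic_on \<bbbD>" and M: "\<And>z. z \<in> \<bbbD> \<Longrightarrow> cmod (\<phi> z) \<le> M"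
  shows hardy_mult_bounded: "hardy (mult_op \<phi> x) = (\<lambda>z. \<phi> z * hardy x z)"
    and norm_mult_le: "norm (mult_op \<phi> x) \<le> M * norm x"
proof -
  define m where "m x = ell2_of (taylor_coeff (\<lambda>z. \<phi> z * hardy x z))" for x
  have M0: "0 \<le> M" using M[of 0] by (simp add: order_trans[OF norm_ge_zero])
  have hm: "hardy (m x) z = \<phi> z * hardy x z" for x z
  proof (cases "z \<in> \<bbbD>")
    case True
    show ?thesis unfolding m_def
    proof (rule hardy_ell2_of[OF _ _ True])
      show "(\<lambda>z. \<phi> z * hardy x z) holomorphic_on \<bbbD>" by (intro holomorphic_intros \<phi> holomorphic_hardy)
      show "summable (\<lambda>n. (cmod (taylor_coeff (\<lambda>z. \<phi> z * hardy x z) n))\<^sup>2)"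
        by (rule ell2_of_bounded(1)[OF _ taylor_mult_le[OF \<phi> M]]) (use M0 in auto)
    qed
  qed simp
  have nm: "norm (m x) \<le> M * norm x" for x
    unfolding m_def by (rule ell2_of_bounded(3)[OF _ taylor_mult_le[OF \<phi> M]]) (use M0 in auto)
  have "bounded_linear m"
  proof (rule bounded_linear_intro)
    show "m (x + y) = m x + m y" for x y
      by (rule hardy_eqI) (simp add: hm hardy_add algebra_simps)
    show "m (c *\<^sub>R x) = c *\<^sub>R m x" for c x
      by (rule hardy_eqI) (simp add: hm hardy_scaleR algebra_simps)
    show "norm (m x) \<le> norm x * M" for x using nm by (simp add: mult.commute)
  qed
  then have "mult_op \<phi> x = m x" by (simp add: mult_op_def m_def[abs_def] bounded_linear_Blinfun_apply)
  then show "hardy (mult_op \<phi> x) = (\<lambda>z. \<phi> z * hardy x z)" "norm (mult_op \<phi> x) \<le> M * norm x"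
    using hm nm by (auto simp: fun_eq_iff)
qed

lemma hardy_mult:
  assumes "\<phi> \<in> Hinf"
  shows "hardy (mult_op \<phi> x) = (\<lambda>z. \<phi> z * hardy x z)"
proof -
  obtain M where "\<forall>z\<in>\<bbbD>. cmod (\<phi> z) \<le> M"
    using assms unfolding Hinf_def bounded_iff by blast
  then show ?thesis using assms by (intro hardy_mult_bounded) (auto simp: Hinf_def)
qed

lemma clin_mult: "\<phi> \<in> Hinf \<Longrightarrow> clin (mult_op \<phi>)"
  unfolding clin_def by (auto intro!: hardy_eqI simp: hardy_mult hardy_cs)

lemma adj_mult_szego:
  assumes \<phi>: "\<phi> \<in> Hinf" and w: "w \<in> \<bbbD>"
  shows "adj (mult_op \<phi>) (szego w) = cs (cnj (\<phi> w)) (szego w)"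
proof -
  have "x \<bullet> adj (mult_op \<phi>) (szego w) = x \<bullet> cs (cnj (\<phi> w)) (szego w)" for x
  proof -
    have "cinner x (adj (mult_op \<phi>) (szego w)) = cinner x (cs (cnj (\<phi> w)) (szego w))"
      using w by (simp flip: cinner_adj[OF clin_mult[OF \<phi>]]
          add: cinner_szego hardy_mult[OF \<phi>] cinner_cs_right)
    then show ?thesis by (metis Re_cinner)
  qed
  then show ?thesis using vector_eq_ldot by blast
qed

text \<open>The value of \<open>A\<^sup>* x\<close> at \<open>w\<close> is the pairing of \<open>x\<close> with the image of the Szego kernel at \<open>w\<close>, so
  two such operators have the same adjoint.\<close>

lemma eq_on_szego:
  assumes "clin A" "clin B" "\<And>w. w \<in> \<bbbD> \<Longrightarrow> A (szego w) = B (szego w)"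
  shows "A = B"
proof -
  have "adj A x = adj B x" for x
  proof (rule hardy_eqI)
    fix w assume w: "w \<in> \<bbbD>"
    have "hardy (adj C x) w = cnj (cinner (C (szego w)) x)" if "clin C" for C
      unfolding cinner_adj[OF that] cinner_commute[of "szego w"] using w by (simp add: cinner_szego)
    then show "hardy (adj A x) w = hardy (adj B x) w" using assms w by simp
  qed
  then have "A x \<bullet> y = B x \<bullet> y" for x y by (simp add: adj_right)
  then show ?thesis by (intro blinfun_eqI) (metis vector_eq_rdot)
qed

section \<open>De Branges--Rovnyak spaces\<close>

lemma Hinf1_bound:
  assumes "b \<in> Hinf1" "z \<in> \<bbbD>"
  shows "cmod (b z) \<le> 1"
proof -
  have "bdd_above ((\<lambda>z. cmod (b z)) ` \<bbbD>)"
    using assms(1) unfolding Hinf1_def Hinf_def bounded_iff bdd_above_def by blast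
  then have "cmod (b z) \<le> Hinf_norm b"
    unfolding Hinf_norm_def using assms(2) by (rule cSUP_upper[rotated])
  then show ?thesis using assms(1) by (simp add: Hinf1_def)
qed

lemma Hinf1_iff: "b \<in> Hinf1 \<longleftrightarrow> b holomorphic_on \<bbbD> \<and> (\<forall>z\<in>\<bbbD>. cmod (b z) \<le> 1)"
proof
  assume r: "b holomorphic_on \<bbbD> \<and> (\<forall>z\<in>\<bbbD>. cmod (b z) \<le> 1)"
  have "Hinf_norm b \<le> 1" unfolding Hinf_norm_def by (rule cSUP_least) (use r in auto)
  moreover have "bounded (b ` \<bbbD>)" unfolding bounded_iff using r by blast
  ultimately show "b \<in> Hinf1" using r by (simp add: Hinf1_def Hinf_def)
qed (use Hinf1_bound in \<open>auto simp: Hinf1_def Hinf_def\<close>)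

lemma Hinf1_Hinf: "b \<in> Hinf1 \<Longrightarrow> b \<in> Hinf"
  by (simp add: Hinf1_def)

lemma norm_mult_Hinf1: "b \<in> Hinf1 \<Longrightarrow> norm (mult_op b x) \<le> norm x"
  using norm_mult_le[of b 1 x] by (simp add: Hinf1_iff)

lemma norm_adj_le:
  fixes A :: "'a::{real_inner,banach} \<Rightarrow>\<^sub>L 'a"
  assumes "\<And>x. norm (A x) \<le> M * norm x" "0 \<le> M"
  shows "norm (adj A y) \<le> M * norm y"
proof -
  have "norm (adj A y) * norm (adj A y) = A (adj A y) \<bullet> y"
    by (simp add: adj_right flip: power2_norm_eq_inner power2_eq_square)
  also have "\<dots> \<le> norm (A (adj A y)) * norm y" by (rule norm_cauchy_schwarz)
  also have "\<dots> \<le> M * norm (adj A y) * norm y" by (intro mult_right_mono assms) simp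
  finally have "norm (adj A y) * norm (adj A y) \<le> (M * norm y) * norm (adj A y)" by (simp add: mult_ac)
  then show ?thesis using \<open>0 \<le> M\<close> by (cases "adj A y = 0") auto
qed

lemma norm_adj_mult_Hinf1: "b \<in> Hinf1 \<Longrightarrow> norm (adj (mult_op b) x) \<le> norm x"
  using norm_adj_le[of "mult_op b" 1 x] norm_mult_Hinf1 by simp

lemma toeplitz_hardy: "b \<in> Hinf \<Longrightarrow> toeplitz b (hardy x) = hardy (mult_op b x)"
  by (simp add: toeplitz_def hardy_mult)

lemma cinner_left_eqI: "(\<And>x. cinner x y = cinner x z) \<Longrightarrow> y = z"
  by (metis Re_cinner vector_eq_ldot)

lemma H2_adjoint_toeplitz:
  assumes "b \<in> Hinf"
  shows "H2_adjoint (toeplitz b) (hardy y) = hardy (adj (mult_op b) y)"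
  unfolding H2_adjoint_def
proof (rule the_equality)
  show "hardy (adj (mult_op b) y) \<in> H2 \<and>
      (\<forall>f\<in>H2. H2_inner (toeplitz b f) (hardy y) = H2_inner f (hardy (adj (mult_op b) y)))"
    by (auto simp: H2_eq toeplitz_hardy[OF assms] cinner_adj clin_mult[OF assms])
next
  fix h assume h: "h \<in> H2 \<and> (\<forall>f\<in>H2. H2_inner (toeplitz b f) (hardy y) = H2_inner f h)"
  then obtain u where u: "h = hardy u" by (auto simp: H2_eq)
  have "cinner x u = cinner x (adj (mult_op b) y)" for x
    using h[THEN conjunct2, rule_format, OF hardy_in_H2[of x]] unfolding u
    by (simp add: toeplitz_hardy[OF assms] cinner_adj clin_mult[OF assms])
  then show "h = hardy (adj (mult_op b) y)" unfolding u hardy_eq_iff by (rule cinner_left_eqI)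
qed

text \<open>The positive root of \<open>I - T\<^sub>b T\<^sub>b\<^sup>*\<close>. The last clause, that it commutes with everything that
  commutes with \<open>T\<^sub>b T\<^sub>b\<^sup>*\<close>, is what the comparison with another positive root requires.\<close>

definition rootop :: "(complex \<Rightarrow> complex) \<Rightarrow> ell2 \<Rightarrow>\<^sub>L ell2" where
  "rootop b = (SOME R. selfadj R \<and> (\<forall>x. 0 \<le> R x \<bullet> x) \<and>
     (\<forall>x. R (R x) = x - mult_op b (adj (mult_op b) x)) \<and> clin R \<and>
     (\<forall>C :: ell2 \<Rightarrow>\<^sub>L ell2. (\<forall>x. C (mult_op b (adj (mult_op b) x)) = mult_op b (adj (mult_op b) (C x))) \<longrightarrow> (\<forall>x. C (R x) = R (C x))))"

lemma rootop:
  fixes C :: "ell2 \<Rightarrow>\<^sub>L ell2"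
  assumes b: "b \<in> Hinf1"
  shows "selfadj (rootop b)" "0 \<le> rootop b x \<bullet> x"
    and rootop_square: "rootop b (rootop b x) = x - mult_op b (adj (mult_op b) x)"
    and clin_rootop: "clin (rootop b)"
    and rootop_commute: "(\<And>x. C (mult_op b (adj (mult_op b) x)) = mult_op b (adj (mult_op b) (C x))) \<Longrightarrow>
      C (rootop b x) = rootop b (C x)"
proof -
  let ?B = "mult_op b o\<^sub>L adj (mult_op b)"
  have "norm ?B \<le> 1"
  proof (rule norm_blinfun_bound)
    show "norm (?B x) \<le> 1 * norm x" for x
      using norm_mult_Hinf1[OF b, of "adj (mult_op b) x"] norm_adj_mult_Hinf1[OF b, of x] by simp
  qed simp
  moreover have "selfadj ?B" by (simp add: selfadj_def adj_right[of "mult_op b"] adj_left)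
  ultimately obtain R where R: "selfadj R" "\<And>x. 0 \<le> R x \<bullet> x" "\<And>x. R (R x) = x - ?B x"
    "\<And>(D :: ell2 \<Rightarrow>\<^sub>L ell2) x. (\<And>x. D (?B x) = ?B (D x)) \<Longrightarrow> D (R x) = R (D x)"
    by (rule pos_sqrt_exists) blast
  have cm: "clin (mult_op b)" "clin (adj (mult_op b))" using clin_mult[OF Hinf1_Hinf[OF b]] clin_adj by blast+
  have "cs_op \<i> (R x) = R (cs_op \<i> x)" for x
    by (rule R(4)) (use cm in \<open>simp add: clinD\<close>)
  then have "clin R" by (simp add: clin_def)
  have R4: "D (R x) = R (D x)" if "\<forall>x. D (mult_op b (adj (mult_op b) x)) = mult_op b (adj (mult_op b) (D x))"
    for D :: "ell2 \<Rightarrow>\<^sub>L ell2" and x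
    by (rule R(4)) (use that in simp)
  have ex: "\<exists>R. selfadj R \<and> (\<forall>x. 0 \<le> R x \<bullet> x) \<and>
     (\<forall>x. R (R x) = x - mult_op b (adj (mult_op b) x)) \<and> clin R \<and>
     (\<forall>C :: ell2 \<Rightarrow>\<^sub>L ell2. (\<forall>x. C (mult_op b (adj (mult_op b) x)) = mult_op b (adj (mult_op b) (C x))) \<longrightarrow> (\<forall>x. C (R x) = R (C x)))"
    using R(1-3) \<open>clin R\<close> by (intro exI[of _ R] conjI allI impI) (auto intro: R4)
  show "selfadj (rootop b)" "0 \<le> rootop b x \<bullet> x"
    "rootop b (rootop b x) = x - mult_op b (adj (mult_op b) x)" "clin (rootop b)"
    "(\<And>x. C (mult_op b (adj (mult_op b) x)) = mult_op b (adj (mult_op b) (C x))) \<Longrightarrow>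
      C (rootop b x) = rootop b (C x)"
    using someI_ex[OF ex, folded rootop_def] by blast+
qed

lemma clinear_on_H2_add:
  assumes "clinear_on H2 R" "f \<in> H2" "g \<in> H2"
  shows "R (\<lambda>z. f z + g z) = (\<lambda>z. R f z + R g z)"
  using assms(1)[unfolded clinear_on_def, rule_format, OF assms(2,3), of 1 1] by simp

lemma clinear_on_H2_cmult:
  assumes "clinear_on H2 R" "f \<in> H2"
  shows "R (\<lambda>z. c * f z) = (\<lambda>z. c * R f z)"
  using assms(1)[unfolded clinear_on_def, rule_format, OF assms(2,2), of c 0] by simp

text \<open>A positive operator on the Hardy space, in the complex sense, becomes a self-adjoint positive
  operator on sequences: over the complex numbers a real quadratic form forces symmetry.\<close>

lemma H2_positive_operator:
  assumes "H2_positive R"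
  obtains Q :: "ell2 \<Rightarrow>\<^sub>L ell2" where
    "\<And>x. R (hardy x) = hardy (Q x)" "selfadj Q" "\<And>x. 0 \<le> Q x \<bullet> x"
proof -
  from assms have R: "R ` H2 \<subseteq> H2" "clinear_on H2 R" and Rpos: "\<And>f. f \<in> H2 \<Longrightarrow> H2_inner (R f) f \<in> \<real>\<^sub>\<ge>\<^sub>0"
    unfolding H2_positive_def by blast+
  obtain K where K: "\<And>f. f \<in> H2 \<Longrightarrow> H2_norm (R f) \<le> K * H2_norm f"
    using assms unfolding H2_positive_def by blast
  have "\<exists>q. \<forall>x. R (hardy x) = hardy (q x)"
    using R(1) unfolding H2_eq by (intro choice) blast
  then obtain q where q: "\<And>x. R (hardy x) = hardy (q x)" by blast
  have hardy_add': "hardy (x + y) = (\<lambda>z. hardy x z + hardy y z)" for x y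
    by (rule ext) (rule hardy_add)
  have hardy_cs': "hardy (cs c x) = (\<lambda>z. c * hardy x z)" for c x
    by (rule ext) (rule hardy_cs)
  have q_add: "q (x + y) = q x + q y" for x y
  proof -
    have "R (hardy (x + y)) = (\<lambda>z. R (hardy x) z + R (hardy y) z)"
      using clinear_on_H2_add[OF R(2) hardy_in_H2[of x] hardy_in_H2[of y]] by (simp add: hardy_add')
    then have "hardy (q (x + y)) = hardy (q x + q y)"
      by (simp only: q hardy_add'[of "q x" "q y"])
    then show ?thesis by simp
  qed
  have q_cs: "q (cs c x) = cs c (q x)" for c x
  proof -
    have "R (hardy (cs c x)) = (\<lambda>z. c * R (hardy x) z)"
      using clinear_on_H2_cmult[OF R(2) hardy_in_H2[of x], of c] by (simp add: hardy_cs')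
    then have "hardy (q (cs c x)) = hardy (cs c (q x))"
      by (simp only: q hardy_cs'[of c "q x"])
    then show ?thesis by simp
  qed
  have "bounded_linear q"
  proof (rule bounded_linear_intro)
    show "q (r *\<^sub>R x) = r *\<^sub>R q x" for r x using q_cs[of "of_real r" x] by (simp add: cs_of_real)
    show "norm (q x) \<le> norm x * K" for x using K[OF hardy_in_H2, of x] by (simp add: q mult.commute)
  qed (rule q_add)
  then have Qq: "Blinfun q x = q x" for x by (simp add: bounded_linear_Blinfun_apply)
  have pos: "0 \<le> q x \<bullet> x" "q x \<bullet> cs \<i> x = 0" for x
    using Rpos[OF hardy_in_H2, of x] by (auto simp: q cinner_def nonneg_Reals_def complex_eq_iff)
  have sym: "q x \<bullet> y = x \<bullet> q y" for x y
  proof -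
    have "q (x + cs \<i> y) \<bullet> cs \<i> (x + cs \<i> y) = 0" by (rule pos)
    moreover have "cs \<i> (cs \<i> y) = - y" using cs_of_real[of "-1" y] by simp
    moreover have "q (cs \<i> y) \<bullet> cs \<i> x = q y \<bullet> x" by (simp add: q_cs inner_cs_left)
    ultimately have "q y \<bullet> x - q x \<bullet> y = 0"
      using pos(2)[of x] pos(2)[of "cs \<i> y"] by (simp add: q_add cs_add_right inner_add inner_diff)
    then show ?thesis by (simp add: inner_commute)
  qed
  show thesis
  proof (rule that[of "Blinfun q"])
    show "R (hardy x) = hardy (Blinfun q x)" for x by (simp add: Qq q)
    show "selfadj (Blinfun q)" by (simp add: selfadj_def Qq sym)
    show "0 \<le> Blinfun q x \<bullet> x" for x by (simp add: Qq pos)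
  qed
qed

text \<open>Identification of the root in the definition of the spaces. A positive operator \<open>S\<close> with
  \<open>S\<^sup>2 = I - T\<^sub>b T\<^sub>b\<^sup>*\<close> commutes with its square, hence with \<open>rootop b\<close>, hence equals it.\<close>

lemma dBR_root_hardy:
  assumes b: "b \<in> Hinf1"
  shows "dBR_root b (hardy x) = hardy (rootop b x)"
proof -
  let ?A = "\<lambda>f z. f z - toeplitz b (H2_adjoint (toeplitz b) f) z"
  let ?R = "rootop b"
  define R where "R = restrict (\<lambda>f. hardy (?R (inv hardy f))) H2"
  have inj: "inj hardy" by (auto intro: injI)
  have Rh: "R (hardy x) = hardy (?R x)" for x by (simp add: R_def inv_f_f[OF inj])
  have A: "?A (hardy x) = hardy (x - mult_op b (adj (mult_op b) x))" for x
    using b by (auto simp: fun_eq_iff H2_adjoint_toeplitz toeplitz_hardy Hinf1_Hinf hardy_diff)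
  have comb: "(\<lambda>z. c * hardy x z + d * hardy y z) = hardy (cs c x + cs d y)" for c d x y
    by (simp add: fun_eq_iff hardy_add hardy_cs)
  have "dBR_root b = R"
    unfolding dBR_root_def H2_sqrt_def
  proof (rule the_equality)
    have "clinear_on H2 R"
      unfolding clinear_on_def H2_eq
      by (auto simp: comb Rh blinfun.add_right clinD[OF clin_rootop[OF b]])
    moreover have "H2_inner (R f) f \<in> \<real>\<^sub>\<ge>\<^sub>0" if f: "f \<in> H2" for f
    proof -
      obtain x where x: "f = hardy x" using f by (auto simp: H2_eq)
      have "?R x \<bullet> cs \<i> x = x \<bullet> cs \<i> (?R x)"
        using rootop(1)[OF b] clinD[OF clin_rootop[OF b]] by (simp add: selfadj_def)
      also have "\<dots> = - (?R x \<bullet> cs \<i> x)"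
        using cinner_commute[of "?R x" x] by (simp add: cinner_def complex_eq_iff)
      finally have "?R x \<bullet> cs \<i> x = 0" by simp
      then show ?thesis using rootop(2)[OF b, of x]
        by (simp add: x Rh cinner_def complex_nonneg_Reals_iff)
    qed
    moreover have "H2_norm (R f) \<le> norm ?R * H2_norm f" if f: "f \<in> H2" for f
      using f by (auto simp: H2_eq Rh norm_blinfun)
    moreover have "R ` H2 \<subseteq> H2" by (auto simp: H2_eq Rh)
    ultimately have "H2_positive R"
      unfolding H2_positive_def by blast
    moreover have "\<forall>f\<in>H2. R (R f) = ?A f"
      unfolding H2_eq by (auto simp only: Rh A rootop_square[OF b])
    ultimately show "R \<in> extensional H2 \<and> H2_positive R \<and> (\<forall>f\<in>H2. R (R f) = ?A f)"
      by (simp add: R_def)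
  next
    fix S assume S: "S \<in> extensional H2 \<and> H2_positive S \<and> (\<forall>f\<in>H2. S (S f) = ?A f)"
    then obtain Q :: "ell2 \<Rightarrow>\<^sub>L ell2" where Q: "\<And>x. S (hardy x) = hardy (Q x)" "selfadj Q" "\<And>x. 0 \<le> Q x \<bullet> x"
      using H2_positive_operator by blast
    have sq: "Q (Q x) = x - mult_op b (adj (mult_op b) x)" for x
    proof -
      have "S (S (hardy x)) = ?A (hardy x)" using S hardy_in_H2 by blast
      then show ?thesis unfolding A Q hardy_eq_iff .
    qed
    have "Q (mult_op b (adj (mult_op b) x)) = mult_op b (adj (mult_op b) (Q x))" for x
    proof -
      have "Q x - Q (Q (Q x)) = mult_op b (adj (mult_op b) (Q x))" using sq[of "Q x"] by simp
      moreover have "Q (Q (Q x)) = Q x - Q (mult_op b (adj (mult_op b) x))" by (simp add: sq[of x] blinfun.diff_right)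
      ultimately show ?thesis by simp
    qed
    then have comm: "Q (?R x) = ?R (Q x)" for x by (rule rootop_commute[OF b])
    have "?R = Q"
      by (rule pos_sqrt_unique[OF rootop(1)[OF b] rootop(2)[OF b] Q(2,3) _ comm])
        (simp add: sq rootop_square[OF b])
    then have "S f = R f" if "f \<in> H2" for f using that by (auto simp: H2_eq Q Rh)
    then show "S = R" using S by (intro extensionalityI[of _ H2]) (auto simp: R_def)
  qed
  then show ?thesis by (simp add: Rh)
qed

lemma dBR_eq: "b \<in> Hinf1 \<Longrightarrow> dBR b = hardy ` range (rootop b)"
  unfolding dBR_def H2_eq image_image by (simp add: dBR_root_hardy)

lemma rootop_in_coker: "b \<in> Hinf1 \<Longrightarrow> rootop b x \<in> coker (rootop b)"
  using rootop(1)[of b] by (auto simp: coker_def selfadj_def)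

lemma dBR_coker_eq:
  assumes b: "b \<in> Hinf1"
  shows "dBR_coker b = hardy ` coker (rootop b)"
proof -
  have "(\<forall>k. rootop b k = 0 \<longrightarrow> cinner x k = 0) \<longleftrightarrow> x \<in> coker (rootop b)" for x
  proof
    assume "\<forall>k. rootop b k = 0 \<longrightarrow> cinner x k = 0"
    then show "x \<in> coker (rootop b)" by (auto simp: coker_def cinner_def complex_eq_iff)
  next
    assume x: "x \<in> coker (rootop b)"
    have "cinner x k = 0" if "rootop b k = 0" for k
    proof -
      have "rootop b (cs \<i> k) = cs \<i> 0" using clinD[OF clin_rootop[OF b]] that by simp
      then have "rootop b (cs \<i> k) = 0" using cs_of_real[of 0 k] by (simp add: ell2_eqI)
      then show ?thesis using x that by (simp add: coker_def cinner_def complex_eq_iff)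
    qed
    then show "\<forall>k. rootop b k = 0 \<longrightarrow> cinner x k = 0" by blast
  qed
  then have "hardy x \<in> dBR_coker b \<longleftrightarrow> x \<in> coker (rootop b)" for x
    by (simp add: dBR_coker_def H2_eq dBR_root_hardy[OF b] flip: hardy_zero)
  moreover have "dBR_coker b \<subseteq> range hardy" by (auto simp: dBR_coker_def H2_eq)
  ultimately show ?thesis by blast
qed

lemma dBR_inner_root:
  assumes b: "b \<in> Hinf1" and x: "x \<in> coker (rootop b)" and y: "y \<in> coker (rootop b)"
  shows "dBR_inner b (hardy (rootop b x)) (hardy (rootop b y)) = cinner x y"
proof -
  have inj: "inj_on (dBR_root b) (dBR_coker b)"
    by (rule inj_onI) (auto simp: dBR_coker_eq[OF b] dBR_root_hardy[OF b] dest: coker_inj)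
  have "the_inv_into (dBR_coker b) (dBR_root b) (hardy (rootop b u)) = hardy u"
    if "u \<in> coker (rootop b)" for u
    using the_inv_into_f_f[OF inj, of "hardy u"] that by (simp add: dBR_coker_eq[OF b] dBR_root_hardy[OF b])
  then show ?thesis by (simp add: dBR_inner_def x y)
qed

lemma dBR_cases:
  assumes "b \<in> Hinf1" "f \<in> dBR b"
  obtains x where "x \<in> coker (rootop b)" "f = hardy (rootop b x)"
  using assms by (auto simp: dBR_eq range_eq_image_coker)

lemma dBR_inner_commute:
  assumes b: "b \<in> Hinf1" and f: "f \<in> dBR b" and g: "g \<in> dBR b"
  shows "dBR_inner b g f = cnj (dBR_inner b f g)"
proof -
  obtain x y where "x \<in> coker (rootop b)" "f = hardy (rootop b x)" "y \<in> coker (rootop b)" "g = hardy (rootop b y)"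
    using dBR_cases[OF b f] dBR_cases[OF b g] by metis
  then show ?thesis using b by (simp add: dBR_inner_root cinner_commute[of y x])
qed

subsection \<open>Reproducing kernels\<close>

text \<open>The operator \<open>I - T\<^sub>b T\<^sub>b\<^sup>*\<close> applied to the Szego kernel, written as the image under the root of
  a vector orthogonal to the kernel of the root.\<close>

definition dBR_kernel :: "(complex \<Rightarrow> complex) \<Rightarrow> complex \<Rightarrow> complex \<Rightarrow> complex" where
  "dBR_kernel b w = hardy (rootop b (rootop b (szego w)))"

lemma dBR_kernel_in: "b \<in> Hinf1 \<Longrightarrow> dBR_kernel b w \<in> dBR b"
  by (auto simp: dBR_kernel_def dBR_eq)

lemma dBR_kernel_eq:
  assumes b: "b \<in> Hinf1" and w: "w \<in> \<bbbD>" and z: "z \<in> \<bbbD>"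
  shows "dBR_kernel b w z = (1 - cnj (b w) * b z) / (1 - cnj w * z)"
proof -
  have "dBR_kernel b w z = hardy (szego w) z - b z * (cnj (b w) * hardy (szego w) z)"
    by (simp add: dBR_kernel_def rootop_square[OF b] hardy_diff hardy_mult Hinf1_Hinf[OF b]
        adj_mult_szego[OF Hinf1_Hinf[OF b] w] hardy_cs)
  then show ?thesis by (simp add: hardy_szego[OF w z] diff_divide_distrib mult_ac)
qed

lemma dBR_reproducing:
  assumes b: "b \<in> Hinf1" and f: "f \<in> dBR b" and w: "w \<in> \<bbbD>"
  shows "dBR_inner b f (dBR_kernel b w) = f w"
proof -
  obtain x where x: "x \<in> coker (rootop b)" "f = hardy (rootop b x)" using dBR_cases[OF b f] by blast
  have "dBR_inner b f (dBR_kernel b w) = cinner x (rootop b (szego w))"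
    unfolding x dBR_kernel_def by (rule dBR_inner_root[OF b x(1) rootop_in_coker[OF b]])
  also have "\<dots> = cinner (rootop b x) (szego w)"
    by (simp add: cinner_adj clin_rootop[OF b] selfadj_adj rootop(1)[OF b])
  finally show ?thesis by (simp add: cinner_szego[OF w] x)
qed

section \<open>The shift on a non-extreme space\<close>

definition unit_seq :: "nat \<Rightarrow> ell2" where
  "unit_seq n = ell2_of (\<lambda>k. if k = n then 1 else 0)"

lemma cf_unit_seq [simp]: "cf (unit_seq n) k = (if k = n then 1 else 0)"
proof -
  have "summable (\<lambda>k. if k = n then (1::real) else 0)" by (rule sums_summable[OF sums_single])
  then have "summable (\<lambda>k. (cmod (if k = n then 1 else 0))\<^sup>2)" by (rule back_subst[of summable]) auto
  then show ?thesis by (simp add: unit_seq_def cf_ell2_of)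
qed

lemma cinner_unit_seq: "cinner x (unit_seq n) = cf x n"
proof -
  have "(\<lambda>k. if k = n then cf x k else 0) sums cf x n" by (rule sums_single)
  moreover have "cf x k * cnj (cf (unit_seq n) k) = (if k = n then cf x k else 0)" for k by simp
  ultimately show ?thesis by (simp add: cinner_suminf sums_iff)
qed

abbreviation shift :: "ell2 \<Rightarrow>\<^sub>L ell2" where
  "shift \<equiv> mult_op (\<lambda>z. z)"

lemma id_Hinf1: "(\<lambda>z. z) \<in> Hinf1"
  by (auto simp: Hinf1_iff)

lemma cf_mult_op:
  assumes "\<phi> \<in> Hinf"
  shows "cf (mult_op \<phi> x) n = (\<Sum>i\<le>n. taylor_coeff \<phi> i * cf x (n - i))"
proof -
  have "cf (mult_op \<phi> x) n = taylor_coeff (\<lambda>z. \<phi> z * hardy x z) n"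
    unfolding hardy_mult[OF assms, symmetric] by simp
  also have "\<dots> = (\<Sum>i\<le>n. taylor_coeff \<phi> i * cf x (n - i))"
    using assms by (subst taylor_coeff_mult) (simp_all add: Hinf_def holomorphic_hardy)
  finally show ?thesis .
qed

lemma taylor_coeff_id: "taylor_coeff (\<lambda>z. z) n = (if n = 1 then 1 else 0)"
  using taylor_coeff_poly[of "\<lambda>n. if n = 1 then 1 else 0" 2 n] by (simp add: numeral_2_eq_2)

lemma cf_shift: "cf (shift x) (Suc n) = cf x n"
proof -
  have "cf (shift x) (Suc n) = (\<Sum>i\<le>Suc n. if i = 1 then cf x n else 0)"
    unfolding cf_mult_op[OF Hinf1_Hinf[OF id_Hinf1]] by (intro sum.cong) (auto simp: taylor_coeff_id)
  then show ?thesis by simp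
qed

lemma cf_shift_0: "cf (shift x) 0 = 0"
  by (simp add: cf_mult_op[OF Hinf1_Hinf[OF id_Hinf1]] taylor_coeff_id)

lemma cf_adj_shift: "cf (adj shift x) n = cf x (Suc n)"
proof -
  have "shift (unit_seq n) = unit_seq (Suc n)"
  proof (rule ell2_eqI)
    show "cf (shift (unit_seq n)) k = cf (unit_seq (Suc n)) k" for k
      by (cases k) (simp_all add: cf_shift cf_shift_0)
  qed
  then have "cinner (unit_seq (Suc n)) x = cinner (unit_seq n) (adj shift x)"
    using cinner_adj[OF clin_mult[OF Hinf1_Hinf[OF id_Hinf1]]] by metis
  then show ?thesis by (metis cinner_commute cinner_unit_seq)
qed

lemma norm_adj_shift: "(norm (adj shift x))\<^sup>2 = (norm x)\<^sup>2 - (cmod (cf x 0))\<^sup>2"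
proof -
  have "(\<lambda>n. (cmod (cf x (Suc n)))\<^sup>2) sums ((norm x)\<^sup>2 - (cmod (cf x 0))\<^sup>2)"
    using norm_ell2_sums[of x] sums_Suc_iff[of "\<lambda>n. (cmod (cf x n))\<^sup>2" "(norm x)\<^sup>2 - (cmod (cf x 0))\<^sup>2"] by simp
  moreover have "(\<lambda>n. (cmod (cf x (Suc n)))\<^sup>2) sums (norm (adj shift x))\<^sup>2"
    using norm_ell2_sums[of "adj shift x"] by (simp add: cf_adj_shift)
  ultimately show ?thesis by (rule sums_unique2[symmetric])
qed

lemma adj_shift_shift: "adj shift (shift x) = x"
  by (rule ell2_eqI) (simp add: cf_adj_shift cf_shift)

lemma mult_op_commute:
  assumes "\<phi> \<in> Hinf" "\<psi> \<in> Hinf"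
  shows "mult_op \<phi> (mult_op \<psi> x) = mult_op \<psi> (mult_op \<phi> x)"
  by (rule hardy_eqI) (simp add: hardy_mult assms)

lemma adj_mult_op_commute:
  assumes "\<phi> \<in> Hinf" "\<psi> \<in> Hinf"
  shows "adj (mult_op \<phi>) (adj (mult_op \<psi>) x) = adj (mult_op \<psi>) (adj (mult_op \<phi>) x)"
proof -
  have "y \<bullet> adj (mult_op \<phi>) (adj (mult_op \<psi>) x) = y \<bullet> adj (mult_op \<psi>) (adj (mult_op \<phi>) x)" for y
    unfolding adj_right[symmetric] mult_op_commute[OF assms] ..
  then show ?thesis using vector_eq_ldot by blast
qed

lemma norm_rootop:
  assumes b: "b \<in> Hinf1"
  shows "(norm (rootop b x))\<^sup>2 = (norm x)\<^sup>2 - (norm (adj (mult_op b) x))\<^sup>2"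
proof -
  have "rootop b x \<bullet> rootop b x = x \<bullet> rootop b (rootop b x)"
    using rootop(1)[OF b] by (simp add: selfadj_def)
  also have "\<dots> = x \<bullet> x - adj (mult_op b) x \<bullet> adj (mult_op b) x"
    by (simp add: rootop_square[OF b] inner_diff_right adj_left)
  finally show ?thesis unfolding power2_norm_eq_inner .
qed

lemma cinner_diff_right: "cinner x (y - z) = cinner x y - cinner x z"
  using cinner_add_right[of x "y - z" z] by simp

text \<open>Douglas's criterion for the self-adjoint operator \<open>rootop b\<close>.\<close>

lemma in_range_rootop:
  assumes b: "b \<in> Hinf1" and "0 \<le> C" "\<And>v. g \<bullet> v \<le> C * norm (rootop b v)"
  shows "hardy g \<in> dBR b"
proof -
  have "adj (rootop b) = rootop b" by (rule selfadj_adj[OF rootop(1)[OF b]])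
  then obtain y where "rootop b y = g" using douglas[of C g "rootop b"] assms(2,3) by metis
  then show ?thesis by (auto simp: dBR_eq[OF b])
qed

subsection \<open>Division by a linear factor\<close>

text \<open>With \<open>S\<close> the shift, \<open>T\<^sub>b\<^sup>* = S\<^sup>* T\<^sub>b\<^sup>* S\<close>, so that applying \<open>S\<close> does not decrease the norm of
  \<open>T\<^sub>b\<^sup>* x\<close>, while it preserves that of \<open>x\<close>.\<close>

lemma norm_rootop_shift:
  assumes b: "b \<in> Hinf1"
  shows "norm (rootop b (shift x)) \<le> norm (rootop b x)"
proof -
  let ?T = "adj (mult_op b)"
  have "?T x = adj shift (?T (shift x))"
    using adj_mult_op_commute[OF Hinf1_Hinf[OF b] Hinf1_Hinf[OF id_Hinf1], of "shift x"]
    by (simp add: adj_shift_shift)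
  then have "norm (?T x) \<le> norm (?T (shift x))"
    using norm_adj_mult_Hinf1[OF id_Hinf1] by metis
  then have "(norm (?T x))\<^sup>2 \<le> (norm (?T (shift x)))\<^sup>2" by (intro power_mono) auto
  moreover have "(norm (shift x))\<^sup>2 \<le> (norm x)\<^sup>2" by (intro power_mono norm_mult_Hinf1 id_Hinf1) auto
  ultimately have "(norm (rootop b (shift x)))\<^sup>2 \<le> (norm (rootop b x))\<^sup>2"
    unfolding norm_rootop[OF b] by linarith
  then show ?thesis by (rule power2_le_imp_le) simp
qed

lemma one_minus_nz: "w \<in> \<bbbD> \<Longrightarrow> cmod c \<le> 1 \<Longrightarrow> 1 - c * w \<noteq> 0"
proof
  assume w: "w \<in> \<bbbD>" and c: "cmod c \<le> 1" and "1 - c * w = 0"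
  then have "cmod c * cmod w = 1" by (metis eq_iff_diff_eq_0 norm_mult norm_one)
  moreover have "cmod c * cmod w \<le> cmod w" using c by (simp add: mult_left_le_one_le)
  ultimately show False using w by simp
qed

lemma inverse_linear_Hinf:
  assumes w: "w \<in> \<bbbD>" and p: "\<psi> \<in> Hinf"
  shows "(\<lambda>z. \<psi> z / (1 - cnj w * z)) \<in> Hinf"
proof -
  have w1: "cmod w < 1" using w by simp
  have nz: "1 - cnj w * z \<noteq> 0" if "z \<in> \<bbbD>" for z using one_minus_nz[OF that, of "cnj w"] w1 by simp
  obtain M where M: "\<forall>z\<in>\<bbbD>. cmod (\<psi> z) \<le> M"
    using p unfolding Hinf_def bounded_iff by blast
  have M0: "0 \<le> M" using M[rule_format, of 0] order_trans[OF norm_ge_zero] by simp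
  have "cmod (\<psi> z / (1 - cnj w * z)) \<le> M / (1 - cmod w)" if z: "z \<in> \<bbbD>" for z
  proof -
    have "1 - cmod w \<le> 1 - cmod (cnj w * z)"
      using z by (simp add: norm_mult mult_left_le)
    also have "\<dots> \<le> cmod (1 - cnj w * z)" using norm_triangle_ineq2[of 1 "cnj w * z"] by simp
    finally have "1 - cmod w \<le> cmod (1 - cnj w * z)" .
    then show ?thesis unfolding norm_divide using M M0 z w1 by (intro frac_le) auto
  qed
  then have "bounded ((\<lambda>z. \<psi> z / (1 - cnj w * z)) ` \<bbbD>)" unfolding bounded_iff by blast
  moreover have "(\<lambda>z. \<psi> z / (1 - cnj w * z)) holomorphic_on \<bbbD>"
    using p nz by (intro holomorphic_intros) (auto simp: Hinf_def)
  ultimately show ?thesis by (simp add: Hinf_def)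
qed

text \<open>The operator \<open>f \<mapsto> (f - f(w))/(z - w)\<close> is the adjoint of multiplication by
  \<open>\<psi>(z) = z \<rho>(z)\<close> with \<open>\<rho>(z) = 1 / (1 - z cnj w)\<close>. By Douglas's criterion it preserves the space as
  soon as \<open>R T\<^sub>\<psi>\<close> is dominated by \<open>R\<close> for the root \<open>R\<close>. This follows from the contraction property for
  the shift \<open>S\<close>, applied to \<open>u = \<rho> v\<close>, which satisfies \<open>u = v + cnj w S u\<close>.\<close>

lemma dBR_divide:
  assumes b: "b \<in> Hinf1" and f: "f \<in> dBR b" and w: "w \<in> \<bbbD>" and fw: "f w = 0"
  obtains g where "g \<in> dBR b" "f = (\<lambda>z. (z - w) * g z)"
proof -
  let ?R = "rootop b"
  obtain y where y: "f = hardy (?R y)" using f by (auto simp: dBR_eq[OF b])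
  define \<psi> where "\<psi> z = z / (1 - cnj w * z)" for z
  define \<rho> where "\<rho> z = 1 / (1 - cnj w * z)" for z
  have \<psi>: "\<psi> \<in> Hinf" and \<rho>: "\<rho> \<in> Hinf"
    using inverse_linear_Hinf[OF w Hinf1_Hinf[OF id_Hinf1]] inverse_linear_Hinf[OF w, of "\<lambda>_. 1"]
    by (auto simp: \<psi>_def[abs_def] \<rho>_def[abs_def] Hinf_def bounded_iff)
  have w1: "cmod w < 1" using w by simp
  have nz: "1 - cnj u * z \<noteq> 0" if "z \<in> \<bbbD>" "u \<in> \<bbbD>" for z u using one_minus_nz[OF that(1), of "cnj u"] that by simp
  have bd: "norm (?R (mult_op \<psi> v)) \<le> norm (?R v) / (1 - cmod w)" for v
  proof -
    let ?u = "mult_op \<rho> v"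
    have 1: "mult_op \<psi> v = shift ?u"
      by (rule hardy_eqI) (simp add: hardy_mult \<psi> \<rho> Hinf1_Hinf[OF id_Hinf1] \<psi>_def \<rho>_def)
    have "?u = v + cs (cnj w) (shift ?u)"
    proof (rule hardy_eqI)
      fix z assume z: "z \<in> \<bbbD>"
      show "hardy ?u z = hardy (v + cs (cnj w) (shift ?u)) z"
        using nz[OF z w] by (simp add: hardy_mult \<rho> Hinf1_Hinf[OF id_Hinf1] \<rho>_def hardy_add hardy_cs field_simps)
    qed
    then have "?R ?u = ?R v + cs (cnj w) (?R (shift ?u))"
      by (metis blinfun.add_right clinD[OF clin_rootop[OF b]])
    then have "norm (?R ?u) \<le> norm (?R v) + cmod w * norm (?R (shift ?u))"
      by (metis norm_triangle_ineq norm_cs complex_mod_cnj)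
    also have "\<dots> \<le> norm (?R v) + cmod w * norm (?R ?u)"
      by (intro add_left_mono mult_left_mono norm_rootop_shift b) simp
    finally have "(1 - cmod w) * norm (?R ?u) \<le> norm (?R v)" by (simp add: algebra_simps)
    then have "norm (?R ?u) \<le> norm (?R v) / (1 - cmod w)" using w1 by (simp add: field_simps)
    then show ?thesis unfolding 1 using norm_rootop_shift[OF b, of ?u] by linarith
  qed
  define g where "g = adj (mult_op \<psi>) (?R y)"
  have "hardy g \<in> dBR b"
  proof (rule in_range_rootop[OF b])
    show "0 \<le> norm y / (1 - cmod w)" using w1 by simp
    show "g \<bullet> v \<le> norm y / (1 - cmod w) * norm (?R v)" for v
    proof -
      have "g \<bullet> v = y \<bullet> ?R (mult_op \<psi> v)" using rootop(1)[OF b] by (simp add: g_def adj_left selfadj_def)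
      also have "\<dots> \<le> norm y * norm (?R (mult_op \<psi> v))" by (rule norm_cauchy_schwarz)
      also have "\<dots> \<le> norm y * (norm (?R v) / (1 - cmod w))" by (intro mult_left_mono bd) simp
      finally show ?thesis by simp
    qed
  qed
  moreover have "f z = (z - w) * hardy g z" for z
  proof (cases "z \<in> \<bbbD> \<and> z \<noteq> w")
    case True
    then have z: "z \<in> \<bbbD>" "cnj z - cnj w \<noteq> 0" by auto
    have eq: "mult_op \<psi> (szego z) = cs (1 / (cnj z - cnj w)) (szego z - szego w)"
    proof (rule hardy_eqI)
      fix u assume u: "u \<in> \<bbbD>"
      show "hardy (mult_op \<psi> (szego z)) u = hardy (cs (1 / (cnj z - cnj w)) (szego z - szego w)) u"
        using nz[OF u z(1)] nz[OF u w] z(2)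
        by (simp add: hardy_mult \<psi> \<psi>_def hardy_cs hardy_diff hardy_szego[OF z(1) u] hardy_szego[OF w u])
          (simp add: divide_simps, simp add: algebra_simps)
    qed
    have "hardy g z = cnj (cinner (mult_op \<psi> (szego z)) (?R y))"
      unfolding cinner_szego[OF z(1), symmetric] g_def cinner_adj[OF clin_mult[OF \<psi>]]
      by (rule cinner_commute)
    also have "\<dots> = cinner (?R y) (mult_op \<psi> (szego z))" by (rule cinner_commute[symmetric])
    also have "\<dots> = (f z - f w) / (z - w)"
      using z(1) w by (simp add: eq cinner_cs_right cinner_diff_right cinner_szego y)
    finally show ?thesis using True fw by simp
  qed (use fw y in auto)
  ultimately show thesis using that by blast
qed

subsection \<open>Multiplication by the coordinate\<close>

text \<open>Moving along the segment through \<open>b\<close> in both directions gives the perturbation \<open>h\<close>.\<close>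

lemma non_extreme_perturbation:
  assumes b: "b \<in> Hinf1" and ne: "\<not> extreme_Hinf1 b"
  obtains h z0 where "h \<in> Hinf" "z0 \<in> \<bbbD>" "h z0 \<noteq> 0"
    "(\<lambda>z. b z + h z) \<in> Hinf1" "(\<lambda>z. b z - h z) \<in> Hinf1"
proof -
  obtain f g z0 t where fg: "f \<in> Hinf1" "g \<in> Hinf1" and z0: "z0 \<in> \<bbbD>" "f z0 \<noteq> g z0"
    and t: "0 < t" "t < 1" and bt: "\<And>z. z \<in> \<bbbD> \<Longrightarrow> b z = (1 - of_real t) * f z + of_real t * g z"
    using b ne unfolding extreme_Hinf1_def by blast
  have hol: "f holomorphic_on \<bbbD>" "g holomorphic_on \<bbbD>" "b holomorphic_on \<bbbD>"
    using fg b by (auto simp: Hinf1_iff)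
  have seg: "cmod (b z + of_real s * (g z - f z)) \<le> 1" if z: "z \<in> \<bbbD>" and s: "- t \<le> s" "s \<le> 1 - t" for z s
  proof -
    have "b z + of_real s * (g z - f z) = of_real (1 - (t + s)) * f z + of_real (t + s) * g z"
      unfolding bt[OF z] by (simp add: algebra_simps)
    also have "cmod \<dots> \<le> (1 - (t + s)) * cmod (f z) + (t + s) * cmod (g z)"
      using s norm_triangle_ineq[of "of_real (1 - (t + s)) * f z" "of_real (t + s) * g z"]
      by (simp add: norm_mult del: of_real_diff of_real_add)
    also have "\<dots> \<le> (1 - (t + s)) * 1 + (t + s) * 1"
      using s z fg by (intro add_mono mult_left_mono) (auto simp: Hinf1_iff)
    finally show ?thesis by simp
  qed
  define s where "s = min t (1 - t)"
  define h where "h z = of_real s * (g z - f z)" for z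
  have s: "0 < s" "s \<le> t" "s \<le> 1 - t" using t by (auto simp: s_def)
  have hh: "h holomorphic_on \<bbbD>" unfolding h_def by (intro holomorphic_intros hol)
  have p: "(\<lambda>z. b z + h z) \<in> Hinf1"
    unfolding Hinf1_iff using seg[of _ s] s t by (auto simp: h_def intro!: holomorphic_intros hol hh)
  have m: "(\<lambda>z. b z - h z) \<in> Hinf1"
    unfolding Hinf1_iff using seg[of _ "- s"] s t by (auto simp: h_def intro!: holomorphic_intros hol hh)
  have "cmod (h z) \<le> 2" if "z \<in> \<bbbD>" for z
    using norm_triangle_ineq4[of "b z + h z" "b z"] Hinf1_bound[OF p that] Hinf1_bound[OF b that] by simp
  then have "h \<in> Hinf" using hh unfolding Hinf_def bounded_iff by blast
  moreover have "h z0 \<noteq> 0" using z0 s by (simp add: h_def)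
  ultimately show thesis using that z0(1) p m by blast
qed

lemma parallelogram: "(norm (x + y))\<^sup>2 + (norm (x - y))\<^sup>2 = 2 * (norm x)\<^sup>2 + 2 * (norm (y :: 'a::real_inner))\<^sup>2"
  unfolding power2_norm_eq_inner by (simp add: inner_add inner_diff)

text \<open>Otherwise \<open>b\<close> is a constant of modulus one by the maximum principle, and such a constant
  admits no perturbation in both directions.\<close>

lemma non_extreme_less_1:
  assumes b: "b \<in> Hinf1" and ne: "\<not> extreme_Hinf1 b" and z: "z \<in> \<bbbD>"
  shows "cmod (b z) < 1"
proof (rule ccontr)
  assume "\<not> cmod (b z) < 1"
  then have bz: "cmod (b z) = 1" using Hinf1_bound[OF b z] by simp
  obtain h z0 where h: "z0 \<in> \<bbbD>" "h z0 \<noteq> 0"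
    "(\<lambda>z. b z + h z) \<in> Hinf1" "(\<lambda>z. b z - h z) \<in> Hinf1"
    by (rule non_extreme_perturbation[OF b ne])
  have "b constant_on \<bbbD>"
    by (rule maximum_modulus_principle[of b \<bbbD> \<bbbD> z]) (use b z bz in \<open>auto simp: Hinf1_iff\<close>)
  then obtain c where "\<forall>x\<in>\<bbbD>. b x = c" unfolding constant_on_def by blast
  then have "cmod (b z0) = cmod (b z)" using z h(1) by simp
  then have "(cmod (b z0))\<^sup>2 = 1" using bz by simp
  moreover have "(cmod (b z0 + h z0))\<^sup>2 \<le> 1" "(cmod (b z0 - h z0))\<^sup>2 \<le> 1"
    using Hinf1_bound[OF h(3) h(1)] Hinf1_bound[OF h(4) h(1)] by (simp_all add: power_le_one)
  ultimately have "(cmod (h z0))\<^sup>2 \<le> 0" using parallelogram[of "b z0" "h z0"] by linarith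
  then show False using h(2) by simp
qed

text \<open>A power of the coordinate times a constant is mapped to the constant function \<open>1\<close> by the
  adjoint of multiplication by \<open>h\<close>: take for the power the order of the zero of \<open>h\<close> at the origin.\<close>

lemma adj_mult_op_one:
  assumes h: "h \<in> Hinf" and nz: "z0 \<in> \<bbbD>" "h z0 \<noteq> 0"
  obtains v where "adj (mult_op h) v = unit_seq 0"
proof -
  have hh: "h holomorphic_on \<bbbD>" using h by (simp add: Hinf_def)
  have ex: "\<exists>n. taylor_coeff h n \<noteq> 0"
  proof (rule ccontr)
    assume "\<nexists>n. taylor_coeff h n \<noteq> 0"
    then have "(\<lambda>n. 0) sums h z0" using taylor_coeff_sums[OF hh nz(1)] by simp
    then have "h z0 = 0" by (rule sums_unique2[OF _ sums_zero])
    then show False using nz(2) by simp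
  qed
  define n where "n = (LEAST n. taylor_coeff h n \<noteq> 0)"
  have n1: "taylor_coeff h n \<noteq> 0" unfolding n_def by (rule LeastI_ex[OF ex])
  have n2: "taylor_coeff h i = 0" if "i < n" for i
    using not_less_Least[OF that[unfolded n_def]] by simp
  have "adj (mult_op h) (unit_seq n) = cs (cnj (taylor_coeff h n)) (unit_seq 0)"
  proof (rule cinner_left_eqI)
    fix x
    have "cinner x (adj (mult_op h) (unit_seq n)) = cf (mult_op h x) n"
      by (simp add: cinner_unit_seq flip: cinner_adj[OF clin_mult[OF h]])
    also have "\<dots> = (\<Sum>i\<le>n. if i = n then taylor_coeff h n * cf x 0 else 0)"
      unfolding cf_mult_op[OF h] by (intro sum.cong) (auto simp: n2)
    also have "\<dots> = cinner x (cs (cnj (taylor_coeff h n)) (unit_seq 0))"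
      by (simp add: cinner_cs_right cinner_unit_seq)
    finally show "cinner x (adj (mult_op h) (unit_seq n))
      = cinner x (cs (cnj (taylor_coeff h n)) (unit_seq 0))" .
  qed
  then have "adj (mult_op h) (cs (1 / cnj (taylor_coeff h n)) (unit_seq n)) = unit_seq 0"
    using n1 by (simp add: clinD[OF clin_adj[OF clin_mult[OF h]]])
  then show thesis by (rule that)
qed

text \<open>For non-extreme \<open>b\<close> the function \<open>b\<close> itself lies in the space, in the form of an estimate for
  the pairing with \<open>b\<close>. The perturbation \<open>h\<close> satisfies \<open>|b|\<^sup>2 + |h|\<^sup>2 \<le> 1\<close>, so that
  \<open>T\<^sub>h\<^sup>* T\<^sub>h \<le> I - T\<^sub>b\<^sup>* T\<^sub>b\<close>.\<close>

lemma non_extreme_pairing: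
  assumes b: "b \<in> Hinf1" and ne: "\<not> extreme_Hinf1 b"
  obtains C where "0 \<le> C" "\<And>x. cmod (cf (adj (mult_op b) x) 0) \<le> C * norm (rootop b x)"
proof -
  obtain h z0 where h: "h \<in> Hinf" "z0 \<in> \<bbbD>" "h z0 \<noteq> 0"
    and p: "(\<lambda>z. b z + h z) \<in> Hinf1" and m: "(\<lambda>z. b z - h z) \<in> Hinf1"
    by (rule non_extreme_perturbation[OF b ne])
  obtain v where v: "adj (mult_op h) v = unit_seq 0" by (rule adj_mult_op_one[OF h])
  have h_le: "(norm (mult_op h x))\<^sup>2 \<le> (norm x)\<^sup>2 - (norm (mult_op b x))\<^sup>2" for x
  proof -
    have plus: "mult_op (\<lambda>z. b z + h z) x = mult_op b x + mult_op h x"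
      by (rule hardy_eqI)
        (simp add: hardy_mult Hinf1_Hinf[OF p] Hinf1_Hinf[OF b] h(1) hardy_add algebra_simps)
    have minus: "mult_op (\<lambda>z. b z - h z) x = mult_op b x - mult_op h x"
      by (rule hardy_eqI)
        (simp add: hardy_mult Hinf1_Hinf[OF m] Hinf1_Hinf[OF b] h(1) hardy_diff algebra_simps)
    have "(norm (mult_op b x + mult_op h x))\<^sup>2 \<le> (norm x)\<^sup>2"
      unfolding plus[symmetric] by (rule power_mono[OF norm_mult_Hinf1[OF p] norm_ge_zero])
    moreover have "(norm (mult_op b x - mult_op h x))\<^sup>2 \<le> (norm x)\<^sup>2"
      unfolding minus[symmetric] by (rule power_mono[OF norm_mult_Hinf1[OF m] norm_ge_zero])
    ultimately show ?thesis using parallelogram[of "mult_op b x" "mult_op h x"] by linarith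
  qed
  have "cmod (cf (adj (mult_op b) x) 0) \<le> norm v * norm (rootop b x)" for x
  proof -
    let ?y = "adj (mult_op b) x"
    have "0 \<le> (norm (x - mult_op b ?y))\<^sup>2" by simp
    also have "\<dots> = (norm x)\<^sup>2 - 2 * (x \<bullet> mult_op b ?y) + (norm (mult_op b ?y))\<^sup>2"
      unfolding power2_norm_eq_inner by (simp add: inner_diff inner_commute)
    also have "x \<bullet> mult_op b ?y = (norm ?y)\<^sup>2"
      unfolding power2_norm_eq_inner by (simp add: adj_left)
    finally have "(norm ?y)\<^sup>2 - (norm (mult_op b ?y))\<^sup>2 \<le> (norm (rootop b x))\<^sup>2"
      unfolding norm_rootop[OF b] by simp
    then have "(norm (mult_op h ?y))\<^sup>2 \<le> (norm (rootop b x))\<^sup>2" using h_le[of ?y] by linarith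
    then have le: "norm (mult_op h ?y) \<le> norm (rootop b x)" by (rule power2_le_imp_le) simp
    have "cf ?y 0 = cinner (mult_op h ?y) v"
      by (simp add: cinner_adj[OF clin_mult[OF h(1)]] v cinner_unit_seq)
    also have "cmod \<dots> \<le> norm (mult_op h ?y) * norm v" by (rule cmod_cinner_le)
    also have "\<dots> \<le> norm (rootop b x) * norm v" by (intro mult_right_mono le) simp
    finally show ?thesis by (simp add: mult.commute)
  qed
  then show thesis by (rule that[rotated]) simp
qed

text \<open>With \<open>R\<close> the root and \<open>S\<close> the shift one has
  \<open>|R S\<^sup>* x|\<^sup>2 = |R x|\<^sup>2 - |x\<^sub>0|\<^sup>2 + |(T\<^sub>b\<^sup>* x)\<^sub>0|\<^sup>2\<close>, where the last term is the pairing of \<open>x\<close> with \<open>b\<close> that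
  has just been estimated; Douglas's criterion does the rest.\<close>

lemma dBR_shift_invariant:
  assumes b: "b \<in> Hinf1" and ne: "\<not> extreme_Hinf1 b" and f: "f \<in> dBR b"
  shows "(\<lambda>z. z * f z) \<in> dBR b"
proof -
  let ?R = "rootop b" and ?T = "adj (mult_op b)" and ?S = "adj shift"
  obtain C where C: "0 \<le> C" "\<And>x. cmod (cf (?T x) 0) \<le> C * norm (?R x)"
    by (rule non_extreme_pairing[OF b ne]) blast
  obtain y where y: "f = hardy (?R y)" using f by (auto simp: dBR_eq[OF b])
  have bd: "norm (?R (?S x)) \<le> (1 + C) * norm (?R x)" for x
  proof -
    have "?T (?S x) = ?S (?T x)"
      by (rule adj_mult_op_commute[OF Hinf1_Hinf[OF b] Hinf1_Hinf[OF id_Hinf1]])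
    then have "(norm (?R (?S x)))\<^sup>2 = (norm x)\<^sup>2 - (cmod (cf x 0))\<^sup>2 - ((norm (?T x))\<^sup>2 - (cmod (cf (?T x) 0))\<^sup>2)"
      by (simp add: norm_rootop[OF b] norm_adj_shift)
    also have "\<dots> \<le> (norm (?R x))\<^sup>2 + (cmod (cf (?T x) 0))\<^sup>2"
      by (simp add: norm_rootop[OF b])
    also have "\<dots> \<le> (norm (?R x))\<^sup>2 + (C * norm (?R x))\<^sup>2"
      by (intro add_left_mono power_mono C) simp
    also have "\<dots> \<le> (norm (?R x) + C * norm (?R x))\<^sup>2"
      using C(1) by (simp add: power2_sum)
    finally have "norm (?R (?S x)) \<le> norm (?R x) + C * norm (?R x)"
      by (rule power2_le_imp_le) (use C(1) in simp)
    then show ?thesis by (simp add: algebra_simps)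
  qed
  have "hardy (shift (?R y)) \<in> dBR b"
  proof (rule in_range_rootop[OF b])
    show "0 \<le> norm y * (1 + C)" using C(1) by simp
    show "shift (?R y) \<bullet> v \<le> norm y * (1 + C) * norm (?R v)" for v
    proof -
      have "shift (?R y) \<bullet> v = y \<bullet> ?R (?S v)"
        unfolding adj_right[of shift] using rootop(1)[OF b] by (simp add: selfadj_def)
      also have "\<dots> \<le> norm y * norm (?R (?S v))" by (rule norm_cauchy_schwarz)
      also have "\<dots> \<le> norm y * ((1 + C) * norm (?R v))" by (intro mult_left_mono bd) simp
      finally show ?thesis by (simp add: mult_ac)
    qed
  qed
  then show ?thesis by (simp add: hardy_mult Hinf1_Hinf[OF id_Hinf1] y)
qed

section \<open>From unitary equivalence to a factorization of kernels\<close>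

lemma dBR_comb:
  assumes b: "b \<in> Hinf1" and "f \<in> dBR b" "g \<in> dBR b"
  shows "(\<lambda>z. c * f z + d * g z) \<in> dBR b"
proof -
  obtain x y where xy: "f = hardy (rootop b x)" "g = hardy (rootop b y)"
    using assms(2,3) by (auto simp: dBR_eq[OF b])
  have "(\<lambda>z. c * f z + d * g z) = hardy (rootop b (cs c x + cs d y))"
    by (rule ext) (simp add: xy blinfun.add_right clinD[OF clin_rootop[OF b]] hardy_add hardy_cs)
  then show ?thesis by (auto simp: dBR_eq[OF b])
qed

lemma one_minus_cmod_sq: "1 - cnj a * a = of_real (1 - (cmod a)\<^sup>2)"
proof -
  have "of_real ((cmod a)\<^sup>2) = cnj a * a" unfolding complex_norm_square by simp
  then show ?thesis by simp
qed

lemma one_minus_cmod_sq_pos: "cmod a < 1 \<Longrightarrow> 0 < 1 - (cmod a)\<^sup>2"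
  by (simp add: power_less_one_iff abs_square_less_1)

lemma dBR_kernel_diag_nz:
  assumes b: "b \<in> Hinf1" and w: "w \<in> \<bbbD>" and bw: "cmod (b w) < 1"
  shows "dBR_kernel b w w \<noteq> 0"
  using one_minus_cmod_sq_pos[OF bw] one_minus_cmod_sq_pos[of w] w
  unfolding dBR_kernel_eq[OF b w w] one_minus_cmod_sq by (simp del: of_real_diff of_real_power)

text \<open>An intertwining unitary maps functions vanishing at \<open>w\<close> to functions vanishing at \<open>w\<close>, because
  such a function is \<open>z - w\<close> times a function of the space. Hence the unitary is multiplication by a
  function \<open>\<phi>\<close>, and the reproducing property turns this into a relation between the kernels.\<close>

lemma kernel_factor:
  assumes b1: "b1 \<in> Hinf1" and ne1: "\<not> extreme_Hinf1 b1" and b2: "b2 \<in> Hinf1"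
    and eq: "unitarily_equivalent (dBR b1) (dBR_inner b1) (dBR_shift b1)
               (dBR b2) (dBR_inner b2) (dBR_shift b2)"
  obtains \<phi> where "\<And>z w. z \<in> \<bbbD> \<Longrightarrow> w \<in> \<bbbD> \<Longrightarrow>
    1 - cnj (b2 w) * b2 z = \<phi> z * cnj (\<phi> w) * (1 - cnj (b1 w) * b1 z)"
proof -
  obtain U where U: "unitary_between (dBR b1) (dBR_inner b1) (dBR b2) (dBR_inner b2) U"
    and comm: "\<And>f. f \<in> dBR b1 \<Longrightarrow> U (dBR_shift b1 f) = dBR_shift b2 (U f)"
    using eq unfolding unitarily_equivalent_def by blast
  have lin: "U (\<lambda>z. c * f z + d * g z) = (\<lambda>z. c * U f z + d * U g z)" if "f \<in> dBR b1" "g \<in> dBR b1" for f g c d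
    using U that unfolding unitary_between_def clinear_on_def by blast
  have bij: "bij_betw U (dBR b1) (dBR b2)"
    and iso: "\<And>f g. f \<in> dBR b1 \<Longrightarrow> g \<in> dBR b1 \<Longrightarrow> dBR_inner b2 (U f) (U g) = dBR_inner b1 f g"
    using U unfolding unitary_between_def by blast+
  have U_in: "U f \<in> dBR b2" if "f \<in> dBR b1" for f using bij that by (rule bij_betw_apply)
  define \<phi> where "\<phi> w = U (dBR_kernel b1 w) w / dBR_kernel b1 w w" for w
  have vanish: "U f w = 0" if f: "f \<in> dBR b1" and w: "w \<in> \<bbbD>" and fw: "f w = 0" for f w
  proof -
    obtain g where g: "g \<in> dBR b1" "f = (\<lambda>z. (z - w) * g z)" using dBR_divide[OF b1 f w fw] .
    have zg: "(\<lambda>z. z * g z) \<in> dBR b1" by (rule dBR_shift_invariant[OF b1 ne1 g(1)])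
    have "U f = U (\<lambda>z. 1 * (z * g z) + (- w) * g z)" by (simp add: g(2) algebra_simps)
    also have "\<dots> = (\<lambda>z. 1 * U (\<lambda>z. z * g z) z + (- w) * U g z)" by (rule lin[OF zg g(1)])
    also have "U (\<lambda>z. z * g z) = (\<lambda>z. z * U g z)"
      using comm[OF g(1)] g(1) U_in[OF g(1)] by (simp add: dBR_shift_def)
    finally show ?thesis by simp
  qed
  have mult: "U f w = \<phi> w * f w" if f: "f \<in> dBR b1" and w: "w \<in> \<bbbD>" for f w
  proof -
    let ?k = "dBR_kernel b1 w"
    have k: "?k \<in> dBR b1" by (rule dBR_kernel_in[OF b1])
    have kw: "?k w \<noteq> 0" by (rule dBR_kernel_diag_nz[OF b1 w non_extreme_less_1[OF b1 ne1 w]])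
    have "U (\<lambda>z. 1 * f z + (- (f w / ?k w)) * ?k z) w = 0"
      using kw by (intro vanish dBR_comb b1 f k w) simp
    then have "U f w = f w / ?k w * U ?k w" unfolding lin[OF f k] by simp
    then show ?thesis by (simp add: \<phi>_def)
  qed
  show thesis
  proof (rule that[of \<phi>])
    fix z w assume z: "z \<in> \<bbbD>" and w: "w \<in> \<bbbD>"
    let ?k1 = "dBR_kernel b1" and ?k2 = "dBR_kernel b2"
    have kin: "?k1 u \<in> dBR b1" "?k2 u \<in> dBR b2" for u by (rule dBR_kernel_in b1 b2)+
    obtain f where f: "f \<in> dBR b1" "?k2 w = U f"
      using bij kin(2)[of w] unfolding bij_betw_def by (metis imageE)
    have "?k2 w z = U f z" by (simp add: f(2))
    also have "\<dots> = \<phi> z * dBR_inner b1 f (?k1 z)" by (simp add: mult[OF f(1) z] dBR_reproducing[OF b1 f(1) z])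
    also have "\<dots> = \<phi> z * dBR_inner b2 (?k2 w) (U (?k1 z))" by (simp add: f iso kin)
    also have "dBR_inner b2 (?k2 w) (U (?k1 z)) = cnj (dBR_inner b2 (U (?k1 z)) (?k2 w))"
      by (intro dBR_inner_commute b2 kin U_in)
    also have "\<dots> = cnj (\<phi> w) * cnj (?k1 z w)"
      by (simp add: dBR_reproducing[OF b2 U_in[OF kin(1)] w] mult[OF kin(1) w])
    finally have "?k2 w z = \<phi> z * (cnj (\<phi> w) * cnj (?k1 z w))" .
    moreover have "cnj (?k1 z w) = ?k1 w z"
      by (simp add: dBR_kernel_eq[OF b1 z w] dBR_kernel_eq[OF b1 w z] mult.commute)
    moreover have "1 - cnj w * z \<noteq> 0" using one_minus_nz[OF z, of "cnj w"] w by simp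
    ultimately show "1 - cnj (b2 w) * b2 z = \<phi> z * cnj (\<phi> w) * (1 - cnj (b1 w) * b1 z)"
      by (simp add: dBR_kernel_eq[OF b1 w z] dBR_kernel_eq[OF b2 w z])
  qed
qed

lemma pseudo_hyperbolic_identity:
  "(cmod (1 - cnj b * a))\<^sup>2 = (1 - (cmod a)\<^sup>2) * (1 - (cmod b)\<^sup>2) + (cmod (a - b))\<^sup>2"
  unfolding cmod_power2 by (simp add: power2_eq_square algebra_simps)

text \<open>The factor \<open>\<phi>\<close> cancels in \<open>K(z,z) K(w,w) / |K(z,w)|\<^sup>2\<close>, which is one minus the square of the
  pseudo-hyperbolic distance between \<open>b(z)\<close> and \<open>b(w)\<close>; the hyperbolic derivative is the
  infinitesimal form of this distance.\<close>

lemma pseudo_hyperbolic_eq: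
  assumes K: "1 - cnj b2 * a2 = p * cnj q * (1 - cnj b1 * a1)"
    and Ka: "1 - cnj a2 * a2 = p * cnj p * (1 - cnj a1 * a1)"
    and Kb: "1 - cnj b2 * b2 = q * cnj q * (1 - cnj b1 * b1)"
    and lt: "cmod a1 < 1" "cmod b1 < 1" "cmod a2 < 1" "cmod b2 < 1"
  shows "cmod (a1 - b1) / cmod (1 - cnj b1 * a1) = cmod (a2 - b2) / cmod (1 - cnj b2 * a2)"
proof -
  have real: "1 - (cmod x)\<^sup>2 = (cmod r)\<^sup>2 * (1 - (cmod y)\<^sup>2)"
    if "1 - cnj x * x = r * cnj r * (1 - cnj y * y)" for x y r
  proof -
    have "complex_of_real (1 - (cmod x)\<^sup>2) = of_real ((cmod r)\<^sup>2 * (1 - (cmod y)\<^sup>2))"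
      using that unfolding one_minus_cmod_sq complex_norm_square[symmetric] by simp
    then show ?thesis by (simp only: of_real_eq_iff)
  qed
  let ?P = "(cmod p)\<^sup>2 * (cmod q)\<^sup>2"
  have "0 < (cmod p)\<^sup>2 * (1 - (cmod a1)\<^sup>2)" "0 < (cmod q)\<^sup>2 * (1 - (cmod b1)\<^sup>2)"
    using real[OF Ka] real[OF Kb] one_minus_cmod_sq_pos lt by metis+
  then have nz: "?P \<noteq> 0" by (metis mult_eq_0_iff less_irrefl)
  have K2: "(cmod (1 - cnj b2 * a2))\<^sup>2 = ?P * (cmod (1 - cnj b1 * a1))\<^sup>2"
    unfolding K by (simp add: norm_mult power_mult_distrib)
  have "(cmod (a2 - b2))\<^sup>2 = ?P * (cmod (a1 - b1))\<^sup>2"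
    using pseudo_hyperbolic_identity[of b2 a2]
    unfolding K2 real[OF Ka] real[OF Kb] pseudo_hyperbolic_identity[of b1 a1]
    by (simp add: algebra_simps)
  then have "(cmod (a2 - b2))\<^sup>2 / (cmod (1 - cnj b2 * a2))\<^sup>2 = (cmod (a1 - b1))\<^sup>2 / (cmod (1 - cnj b1 * a1))\<^sup>2"
    using nz unfolding K2 by simp
  then have "(cmod (a1 - b1) / cmod (1 - cnj b1 * a1))\<^sup>2 = (cmod (a2 - b2) / cmod (1 - cnj b2 * a2))\<^sup>2"
    by (simp add: power_divide)
  then show ?thesis by (rule power2_eq_imp_eq) auto
qed

lemma hyperbolic_derivative_limit:
  assumes b: "b holomorphic_on \<bbbD>" and w: "w \<in> \<bbbD>" and bw: "cmod (b w) < 1"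
  shows "((\<lambda>z. cmod (b z - b w) / cmod (1 - cnj (b w) * b z) / cmod (z - w))
    \<longlongrightarrow> cmod (deriv b w) / (1 - (cmod (b w))\<^sup>2)) (at w)"
proof -
  have d: "(b has_field_derivative deriv b w) (at w)"
    using b w by (intro holomorphic_derivI[of b \<bbbD>]) auto
  then have "((\<lambda>z. (b z - b w) / (z - w)) \<longlongrightarrow> deriv b w) (at w)" by (simp add: has_field_derivative_iff)
  moreover have "(b \<longlongrightarrow> b w) (at w)" using DERIV_isCont[OF d] by (simp add: isCont_def)
  moreover have nz: "1 - cnj (b w) * b w \<noteq> 0"
    using one_minus_cmod_sq_pos[OF bw] unfolding one_minus_cmod_sq by (simp del: of_real_diff)
  ultimately have "((\<lambda>z. cmod ((b z - b w) / (z - w) / (1 - cnj (b w) * b z)))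
      \<longlongrightarrow> cmod (deriv b w / (1 - cnj (b w) * b w))) (at w)"
    by (intro tendsto_intros)
  moreover have "cmod (1 - cnj (b w) * b w) = 1 - (cmod (b w))\<^sup>2"
    using one_minus_cmod_sq_pos[OF bw] unfolding one_minus_cmod_sq norm_of_real by simp
  ultimately show ?thesis by (simp add: norm_divide norm_mult mult.commute)
qed

lemma hyperbolic_derivative_eq:
  assumes b1: "b1 \<in> Hinf1" and b2: "b2 \<in> Hinf1"
    and lt: "\<And>z. z \<in> \<bbbD> \<Longrightarrow> cmod (b1 z) < 1" "\<And>z. z \<in> \<bbbD> \<Longrightarrow> cmod (b2 z) < 1"
    and K: "\<And>z w. z \<in> \<bbbD> \<Longrightarrow> w \<in> \<bbbD> \<Longrightarrow>
      1 - cnj (b2 w) * b2 z = \<phi> z * cnj (\<phi> w) * (1 - cnj (b1 w) * b1 z)"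
    and w: "w \<in> \<bbbD>"
  shows "cmod (deriv b1 w) / (1 - (cmod (b1 w))\<^sup>2) = cmod (deriv b2 w) / (1 - (cmod (b2 w))\<^sup>2)"
proof (rule tendsto_unique[of "at w"])
  have hol: "b1 holomorphic_on \<bbbD>" "b2 holomorphic_on \<bbbD>" using b1 b2 by (auto simp: Hinf1_iff)
  show "((\<lambda>z. cmod (b1 z - b1 w) / cmod (1 - cnj (b1 w) * b1 z) / cmod (z - w))
    \<longlongrightarrow> cmod (deriv b1 w) / (1 - (cmod (b1 w))\<^sup>2)) (at w)"
    by (rule hyperbolic_derivative_limit[OF hol(1) w lt(1)[OF w]])
  have "\<forall>\<^sub>F z in at w. z \<in> \<bbbD>" using w by (intro eventually_at_in_open') auto
  then have "\<forall>\<^sub>F z in at w. cmod (b2 z - b2 w) / cmod (1 - cnj (b2 w) * b2 z) / cmod (z - w)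
      = cmod (b1 z - b1 w) / cmod (1 - cnj (b1 w) * b1 z) / cmod (z - w)"
  proof eventually_elim
    case (elim z)
    show ?case
      using pseudo_hyperbolic_eq[OF K[OF elim w] K[OF elim elim] K[OF w w]
          lt(1)[OF elim] lt(1)[OF w] lt(2)[OF elim] lt(2)[OF w]] by simp
  qed
  then show "((\<lambda>z. cmod (b1 z - b1 w) / cmod (1 - cnj (b1 w) * b1 z) / cmod (z - w))
    \<longlongrightarrow> cmod (deriv b2 w) / (1 - (cmod (b2 w))\<^sup>2)) (at w)"
    using hyperbolic_derivative_limit[OF hol(2) w lt(2)[OF w]] by (rule Lim_transform_eventually[rotated])
qed simp

section \<open>From equal hyperbolic derivatives to a factorization of kernels\<close>

subsection \<open>Polarization\<close>

text \<open>Finite sums of products of a holomorphic function of \<open>z\<close> and an antiholomorphic function of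
  \<open>w\<close>. The sums are indexed by lists, as in the applications the terms are written down explicitly.\<close>

abbreviation sesq :: "((complex \<Rightarrow> complex) \<times> (complex \<Rightarrow> complex)) list \<Rightarrow> complex \<Rightarrow> complex \<Rightarrow> complex" where
  "sesq L z w \<equiv> (\<Sum>(f, g)\<leftarrow>L. f z * cnj (g w))"

abbreviation derivL :: "((complex \<Rightarrow> complex) \<times> (complex \<Rightarrow> complex)) list \<Rightarrow> ((complex \<Rightarrow> complex) \<times> (complex \<Rightarrow> complex)) list" where
  "derivL \<equiv> map (\<lambda>(f, g). (deriv f, g))"

definition hol_pairs :: "complex set \<Rightarrow> ((complex \<Rightarrow> complex) \<times> (complex \<Rightarrow> complex)) list \<Rightarrow> bool" where
  "hol_pairs S L \<longleftrightarrow> (\<forall>(f, g)\<in>set L. f holomorphic_on S \<and> g holomorphic_on S)"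

lemma hol_pairs_simps [simp]:
  "hol_pairs S []"
  "hol_pairs S ((f, g) # L) \<longleftrightarrow> f holomorphic_on S \<and> g holomorphic_on S \<and> hol_pairs S L"
  by (auto simp: hol_pairs_def)

lemma hol_pairs_derivL: "open S \<Longrightarrow> hol_pairs S L \<Longrightarrow> hol_pairs S (derivL L)"
  by (induction L) (auto intro: holomorphic_deriv)

lemma sesq_diagonal_derivative:
  assumes "open S" "hol_pairs S L" "z \<in> S"
  shows "((\<lambda>t. sesq L (z + of_real t * u) (z + of_real t * u)) has_vector_derivative
    (u * sesq (derivL L) z z + cnj u * (\<Sum>(f, g)\<leftarrow>L. f z * cnj (deriv g z)))) (at 0)"
  using assms(2)
proof (induction L)
  case (Cons p L)
  obtain f g where p: "p = (f, g)" by (cases p)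
  have dir: "((\<lambda>t. h (z + of_real t * u)) has_vector_derivative u * deriv h z) (at 0)"
    if "h holomorphic_on S" for h
  proof -
    have "((\<lambda>t. z + of_real t * u) has_vector_derivative u) (at 0)"
      by (auto intro!: derivative_eq_intros simp: has_vector_derivative_def scaleR_conv_of_real)
    moreover have "(h has_field_derivative deriv h z) (at (z + of_real 0 * u))"
      using holomorphic_derivI[OF that assms(1,3)] by simp
    ultimately show ?thesis using field_vector_diff_chain_at[of "\<lambda>t. z + of_real t * u" u 0 h "deriv h z"]
      by (simp add: o_def)
  qed
  have "((\<lambda>t. f (z + of_real t * u) * cnj (g (z + of_real t * u))) has_vector_derivative
      (f (z + of_real 0 * u) * cnj (u * deriv g z) + u * deriv f z * cnj (g (z + of_real 0 * u)))) (at 0)"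
    using Cons.prems p by (intro has_vector_derivative_mult has_vector_derivative_cnj dir) auto
  from has_vector_derivative_add[OF this Cons.IH] show ?case
    using Cons.prems by (simp add: p algebra_simps)
qed simp

text \<open>The derivative of the restriction to the diagonal in direction \<open>u\<close> is \<open>u A + cnj u B\<close>. If it
  vanishes for \<open>u = 1\<close> and \<open>u = \<i>\<close>, then \<open>A = 0\<close>.\<close>

lemma sesq_derivL:
  assumes S: "open S" and L: "hol_pairs S L" and 0: "\<And>z. z \<in> S \<Longrightarrow> sesq L z z = 0" and z: "z \<in> S"
  shows "sesq (derivL L) z z = 0"
proof -
  let ?A = "sesq (derivL L) z z" and ?B = "\<Sum>(f, g)\<leftarrow>L. f z * cnj (deriv g z)"
  have "u * ?A + cnj u * ?B = 0" for u
  proof (rule vector_derivative_unique_at)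
    show "((\<lambda>t. sesq L (z + of_real t * u) (z + of_real t * u)) has_vector_derivative
        (u * ?A + cnj u * ?B)) (at 0)"
      by (rule sesq_diagonal_derivative[OF S L z])
    have "continuous_on UNIV (\<lambda>t::real. z + of_real t * u)" by (intro continuous_intros)
    then have o: "open ((\<lambda>t::real. z + of_real t * u) -` S)" using S by (simp add: open_vimage)
    show "((\<lambda>t. sesq L (z + of_real t * u) (z + of_real t * u)) has_vector_derivative 0) (at 0)"
    proof (rule has_vector_derivative_transform_within_open[OF has_vector_derivative_const o])
      show "(0::real) \<in> (\<lambda>t::real. z + of_real t * u) -` S" using z by simp
      show "0 = sesq L (z + of_real t * u) (z + of_real t * u)"
        if "t \<in> (\<lambda>t::real. z + of_real t * u) -` S" for t using 0[of "z + of_real t * u"] that by simp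
    qed
  qed
  from this[of 1] this[of \<i>] show ?thesis by (simp add: complex_eq_iff)
qed

lemma higher_deriv_sesq:
  assumes "open S" "hol_pairs S L" "z \<in> S"
  shows "(deriv ^^ n) (\<lambda>z. sesq L z w) z = sesq ((derivL ^^ n) L) z w"
  using assms(2)
proof (induction L)
  case Nil
  have "(derivL ^^ n) [] = []" by (induction n) auto
  moreover have "(deriv ^^ n) (\<lambda>z::complex. 0::complex) = (\<lambda>z. 0)" by (induction n) auto
  ultimately show ?case by simp
next
  case (Cons p L)
  obtain f g where p: "p = (f, g)" by (cases p)
  have hL: "(\<lambda>z. sesq L z w) holomorphic_on S"
    using Cons.prems by (induction L) (auto intro!: holomorphic_intros simp: p)
  have f: "f holomorphic_on S" using Cons.prems p by simp
  have "(derivL ^^ n) (p # L) = ((deriv ^^ n) f, g) # (derivL ^^ n) L" by (induction n) (auto simp: p)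
  moreover have "(deriv ^^ n) (\<lambda>z. cnj (g w) * f z) z = cnj (g w) * (deriv ^^ n) f z"
    by (rule higher_deriv_cmult[OF f assms(3,1)])
  moreover have "(deriv ^^ n) (\<lambda>z. cnj (g w) * f z + sesq L z w) z
      = (deriv ^^ n) (\<lambda>z. cnj (g w) * f z) z + (deriv ^^ n) (\<lambda>z. sesq L z w) z"
    by (rule higher_deriv_add[OF _ hL assms(1,3)]) (intro holomorphic_intros f)
  ultimately show ?case using Cons by (simp add: p mult.commute)
qed

text \<open>If a finite sum of products of holomorphic and antiholomorphic functions vanishes on the
  diagonal, then so do its derivatives in the holomorphic variable; these are all Taylor
  coefficients of the sum in that variable at a point of the diagonal.\<close>

lemma polarization:
  assumes S: "open S" "connected S" and L: "hol_pairs S L" and 0: "\<And>z. z \<in> S \<Longrightarrow> sesq L z z = 0"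
    and z: "z \<in> S" and w: "w \<in> S"
  shows "sesq L z w = 0"
proof (rule holomorphic_fun_eq_0_on_connected[of "\<lambda>z. sesq L z w" S w z])
  show "(\<lambda>z. sesq L z w) holomorphic_on S"
    using L by (induction L) (auto intro!: holomorphic_intros)
  have "hol_pairs S ((derivL ^^ n) L) \<and> (\<forall>z\<in>S. sesq ((derivL ^^ n) L) z z = 0)" for n
  proof (induction n)
    case (Suc n)
    then show ?case
      using hol_pairs_derivL[OF S(1)] sesq_derivL[OF S(1), of "(derivL ^^ n) L"] by simp
  qed (use L 0 in simp)
  then show "(deriv ^^ n) (\<lambda>z. sesq L z w) w = 0" for n
    using w by (simp add: higher_deriv_sesq[OF S(1) L w])
qed (use S z w in auto)

subsection \<open>The factorization\<close>

text \<open>For constant symbols the kernels are constant, and \<open>\<phi>\<close> is the square root of their quotient.\<close>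

lemma factor_constant:
  assumes h: "b1 holomorphic_on \<bbbD>" "b2 holomorphic_on \<bbbD>"
    and lt: "\<And>z. z \<in> \<bbbD> \<Longrightarrow> cmod (b1 z) < 1" "\<And>z. z \<in> \<bbbD> \<Longrightarrow> cmod (b2 z) < 1"
    and d: "\<And>z. z \<in> \<bbbD> \<Longrightarrow> deriv b1 z = 0" "\<And>z. z \<in> \<bbbD> \<Longrightarrow> deriv b2 z = 0"
  obtains \<phi> where "\<phi> \<in> Hinf" "\<And>z w. z \<in> \<bbbD> \<Longrightarrow> w \<in> \<bbbD> \<Longrightarrow>
    1 - cnj (b2 w) * b2 z = \<phi> z * cnj (\<phi> w) * (1 - cnj (b1 w) * b1 z)"
proof -
  have const: "b z = b 0" if h: "b holomorphic_on \<bbbD>" and d: "\<And>z. z \<in> \<bbbD> \<Longrightarrow> deriv b z = 0" and z: "z \<in> \<bbbD>" for b z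
  proof -
    have "\<exists>c. \<forall>x\<in>\<bbbD>. b x = c"
    proof (rule has_field_derivative_zero_constant)
      fix x assume x: "x \<in> \<bbbD>"
      show "(b has_field_derivative 0) (at x within \<bbbD>)"
        using holomorphic_derivI[OF h open_ball x, of \<bbbD>] unfolding d[OF x] .
    qed simp
    then obtain c where c: "\<forall>x\<in>\<bbbD>. b x = c" by blast
    have "(0 :: complex) \<in> \<bbbD>" by simp
    then show ?thesis using c z by metis
  qed
  have c1: "b1 z = b1 0" if "z \<in> \<bbbD>" for z by (rule const[OF h(1) d(1) that])
  have c2: "b2 z = b2 0" if "z \<in> \<bbbD>" for z by (rule const[OF h(2) d(2) that])
  define r where "r = sqrt ((1 - (cmod (b2 0))\<^sup>2) / (1 - (cmod (b1 0))\<^sup>2))"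
  have pos: "0 < 1 - (cmod (b1 0))\<^sup>2" "0 < 1 - (cmod (b2 0))\<^sup>2"
    using lt[of 0] one_minus_cmod_sq_pos by auto
  then have r: "r * r * (1 - (cmod (b1 0))\<^sup>2) = 1 - (cmod (b2 0))\<^sup>2" by (simp add: r_def)
  show thesis
  proof (rule that[of "\<lambda>_. of_real r"])
    show "(\<lambda>_. of_real r) \<in> Hinf" unfolding Hinf_def bounded_iff by auto
    show "1 - cnj (b2 w) * b2 z = of_real r * cnj (of_real r) * (1 - cnj (b1 w) * b1 z)"
      if "z \<in> \<bbbD>" "w \<in> \<bbbD>" for z w
      unfolding c1[OF that(1)] c1[OF that(2)] c2[OF that(1)] c2[OF that(2)] one_minus_cmod_sq r[symmetric]
      by (simp del: of_real_diff)
  qed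
qed

text \<open>Equality of the hyperbolic derivatives polarizes twice. The first polarization gives
  \<open>b\<^sub>2' = c b\<^sub>1' \<theta>\<^sup>2\<close> with \<open>\<theta>\<close> the quotient of the two kernels with one argument frozen. Inserting this
  in the equation leaves \<open>1 - |b\<^sub>2|\<^sup>2 = |c| |\<theta>|\<^sup>2 (1 - |b\<^sub>1|\<^sup>2)\<close>, at first away from the zeros of \<open>b\<^sub>1'\<close>, and
  the second polarization is the claim.\<close>

lemma factor_nonconstant:
  assumes h: "b1 holomorphic_on \<bbbD>" "b2 holomorphic_on \<bbbD>"
    and lt: "\<And>z. z \<in> \<bbbD> \<Longrightarrow> cmod (b1 z) < 1" "\<And>z. z \<in> \<bbbD> \<Longrightarrow> cmod (b2 z) < 1"
    and eq: "\<And>z. z \<in> \<bbbD> \<Longrightarrow> cmod (deriv b1 z) * (1 - (cmod (b2 z))\<^sup>2) = cmod (deriv b2 z) * (1 - (cmod (b1 z))\<^sup>2)"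
    and w0: "w0 \<in> \<bbbD>" "deriv b1 w0 \<noteq> 0"
  obtains \<phi> where "\<phi> \<in> Hinf" "\<And>z w. z \<in> \<bbbD> \<Longrightarrow> w \<in> \<bbbD> \<Longrightarrow>
    1 - cnj (b2 w) * b2 z = \<phi> z * cnj (\<phi> w) * (1 - cnj (b1 w) * b1 z)"
proof -
  define d1 d2 where "d1 = deriv b1" and "d2 = deriv b2"
  have hd: "d1 holomorphic_on \<bbbD>" "d2 holomorphic_on \<bbbD>"
    unfolding d1_def d2_def using h by (auto intro: holomorphic_deriv)
  have pos: "0 < 1 - (cmod (b1 z))\<^sup>2" "0 < 1 - (cmod (b2 z))\<^sup>2" if "z \<in> \<bbbD>" for z
    using lt[OF that] one_minus_cmod_sq_pos by auto
  have nz: "1 - cnj (b1 w) * b1 z \<noteq> 0" "1 - cnj (b2 w) * b2 z \<noteq> 0" if "z \<in> \<bbbD>" "w \<in> \<bbbD>" for z w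
    using one_minus_nz[of "b1 z" "cnj (b1 w)"] one_minus_nz[of "b2 z" "cnj (b2 w)"]
      lt[OF that(1)] lt[OF that(2)] by auto
  have pol1: "d1 z * cnj (d1 w) * (1 - cnj (b2 w) * b2 z)\<^sup>2 = d2 z * cnj (d2 w) * (1 - cnj (b1 w) * b1 z)\<^sup>2"
    if zw: "z \<in> \<bbbD>" "w \<in> \<bbbD>" for z w
  proof -
    \<comment> \<open>the difference of the squares of the two sides of the hypothesis, expanded\<close>
    let ?L = "[(d1, d1), (\<lambda>z. - 2 * d1 z * b2 z, \<lambda>z. d1 z * b2 z), (\<lambda>z. d1 z * (b2 z)\<^sup>2, \<lambda>z. d1 z * (b2 z)\<^sup>2),
      (\<lambda>z. - d2 z, d2), (\<lambda>z. 2 * d2 z * b1 z, \<lambda>z. d2 z * b1 z), (\<lambda>z. - d2 z * (b1 z)\<^sup>2, \<lambda>z. d2 z * (b1 z)\<^sup>2)]"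
    have L: "sesq ?L z w = d1 z * cnj (d1 w) * (1 - cnj (b2 w) * b2 z)\<^sup>2 - d2 z * cnj (d2 w) * (1 - cnj (b1 w) * b1 z)\<^sup>2" for z w
      by (simp add: power2_eq_square algebra_simps)
    have "sesq ?L z w = 0"
    proof (rule polarization[OF open_ball _ _ _ zw])
      show "hol_pairs \<bbbD> ?L" using h hd by (auto intro!: holomorphic_intros)
      show "sesq ?L z z = 0" if z: "z \<in> \<bbbD>" for z
      proof -
        have "(cmod (d1 z) * (1 - (cmod (b2 z))\<^sup>2))\<^sup>2 = (cmod (d2 z) * (1 - (cmod (b1 z))\<^sup>2))\<^sup>2"
          using eq[OF z] by (simp add: d1_def d2_def)
        then have "(of_real ((cmod (d1 z))\<^sup>2 * (1 - (cmod (b2 z))\<^sup>2)\<^sup>2) :: complex) = of_real ((cmod (d2 z))\<^sup>2 * (1 - (cmod (b1 z))\<^sup>2)\<^sup>2)"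
          by (simp add: power_mult_distrib del: of_real_mult of_real_power)
        then show ?thesis
          unfolding L one_minus_cmod_sq complex_norm_square[symmetric] by simp
      qed
    qed simp
    then show ?thesis unfolding L by simp
  qed
  \<comment> \<open>the first polarization with \<open>w = w\<^sub>0\<close> expresses \<open>b\<^sub>2'\<close> by \<open>b\<^sub>1'\<close> and \<open>\<theta>\<close>\<close>
  define \<theta> where "\<theta> z = (1 - cnj (b2 w0) * b2 z) / (1 - cnj (b1 w0) * b1 z)" for z
  define \<kappa> where "\<kappa> = cmod (d1 w0) / cmod (d2 w0)"
  have d20: "d2 w0 \<noteq> 0" using eq[OF w0(1)] w0 pos[OF w0(1)] by (auto simp: d2_def)
  have d2_eq: "d2 z = cnj (d1 w0 / d2 w0) * d1 z * (\<theta> z)\<^sup>2" if z: "z \<in> \<bbbD>" for z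
    using pol1[OF z w0(1)] d20 nz(1)[OF z w0(1)] by (simp add: \<theta>_def power_divide field_simps)
  have cd2: "cmod (d2 z) = \<kappa> * cmod (d1 z) * (cmod (\<theta> z))\<^sup>2" if z: "z \<in> \<bbbD>" for z
    unfolding d2_eq[OF z] by (simp add: \<kappa>_def norm_mult norm_divide norm_power)
  define \<phi> where "\<phi> z = of_real (sqrt \<kappa>) * \<theta> z" for z
  have \<kappa>: "0 \<le> \<kappa>" by (simp add: \<kappa>_def)
  have c\<phi>: "(cmod (\<phi> z))\<^sup>2 = \<kappa> * (cmod (\<theta> z))\<^sup>2" for z
    using \<kappa> by (simp add: \<phi>_def norm_mult power_mult_distrib)
  have h\<theta>: "\<theta> holomorphic_on \<bbbD>" unfolding \<theta>_def by (intro holomorphic_intros h nz w0)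
  have h\<phi>: "\<phi> holomorphic_on \<bbbD>" unfolding \<phi>_def by (intro holomorphic_intros h\<theta>)
  have diag: "1 - (cmod (b2 z))\<^sup>2 = (cmod (\<phi> z))\<^sup>2 * (1 - (cmod (b1 z))\<^sup>2)" if z: "z \<in> \<bbbD>" for z
  proof (rule ccontr)
    \<comment> \<open>the defect is continuous, so near a point where it is not zero \<open>b\<^sub>1'\<close> would vanish\<close>
    define E where "E z = 1 - (cmod (b2 z))\<^sup>2 - (cmod (\<phi> z))\<^sup>2 * (1 - (cmod (b1 z))\<^sup>2)" for z
    assume "\<not> ?thesis"
    then have Ez: "E z \<noteq> 0" by (simp add: E_def)
    have "continuous_on \<bbbD> E" unfolding E_def
      by (intro continuous_intros holomorphic_on_imp_continuous_on h h\<phi>)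
    then have o: "open (\<bbbD> \<inter> E -` (- {0}))" by (intro continuous_open_preimage) auto
    let ?N = "\<bbbD> \<inter> E -` (- {0})"
    have "d1 u = 0" if u: "u \<in> ?N" for u
    proof (rule ccontr)
      assume "d1 u \<noteq> 0"
      have "cmod (d1 u) * (1 - (cmod (b2 u))\<^sup>2) = cmod (d1 u) * (\<kappa> * (cmod (\<theta> u))\<^sup>2 * (1 - (cmod (b1 u))\<^sup>2))"
        using eq[of u] cd2[of u] u by (simp add: d1_def d2_def mult_ac)
      then have "E u = 0" using \<open>d1 u \<noteq> 0\<close> by (simp add: E_def c\<phi>)
      then show False using u by simp
    qed
    then have "d1 w0 = 0"
      using analytic_continuation[OF hd(1) open_ball _ _ z, of ?N w0] z Ez w0(1)
        open_imp_islimpt[OF o] islimpt_subset by (simp add: interior_limit_point interior_open o)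
    then show False using w0(2) by (simp add: d1_def)
  qed
  have pol2: "1 - cnj (b2 w) * b2 z = \<phi> z * cnj (\<phi> w) * (1 - cnj (b1 w) * b1 z)"
    if zw: "z \<in> \<bbbD>" "w \<in> \<bbbD>" for z w
  proof -
    let ?L = "[(\<lambda>z. 1, \<lambda>z. 1), (\<lambda>z. - b2 z, b2), (\<lambda>z. - \<phi> z, \<phi>), (\<lambda>z. \<phi> z * b1 z, \<lambda>z. \<phi> z * b1 z)]"
    have L: "sesq ?L z w = 1 - cnj (b2 w) * b2 z - \<phi> z * cnj (\<phi> w) * (1 - cnj (b1 w) * b1 z)" for z w
      by (simp add: algebra_simps)
    have "sesq ?L z w = 0"
    proof (rule polarization[OF open_ball _ _ _ zw])
      show "hol_pairs \<bbbD> ?L" using h h\<phi> by (auto intro!: holomorphic_intros)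
      show "sesq ?L z z = 0" if z: "z \<in> \<bbbD>" for z
        unfolding L one_minus_cmod_sq complex_norm_square[symmetric] diag[OF z] by simp
    qed simp
    then show ?thesis unfolding L by simp
  qed
  have "cmod (\<phi> z) \<le> sqrt \<kappa> * (2 / (1 - cmod (b1 w0)))" if z: "z \<in> \<bbbD>" for z
  proof -
    have "cmod (1 - cnj (b2 w0) * b2 z) \<le> 1 + cmod (cnj (b2 w0) * b2 z)"
      using norm_triangle_ineq4[of 1 "cnj (b2 w0) * b2 z"] by simp
    also have "cmod (cnj (b2 w0) * b2 z) \<le> 1"
      using lt(2)[OF z] lt(2)[OF w0(1)] by (simp add: norm_mult mult_le_one)
    finally have n: "cmod (1 - cnj (b2 w0) * b2 z) \<le> 2" by simp
    have "1 - cmod (b1 w0) \<le> 1 - cmod (cnj (b1 w0) * b1 z)"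
      using lt(1)[OF z] by (simp add: norm_mult mult_left_le)
    also have "\<dots> \<le> cmod (1 - cnj (b1 w0) * b1 z)"
      using norm_triangle_ineq2[of 1 "cnj (b1 w0) * b1 z"] by simp
    finally have "cmod (\<theta> z) \<le> 2 / (1 - cmod (b1 w0))"
      unfolding \<theta>_def norm_divide using n lt(1)[OF w0(1)] by (intro frac_le) auto
    then have "sqrt \<kappa> * cmod (\<theta> z) \<le> sqrt \<kappa> * (2 / (1 - cmod (b1 w0)))"
      using \<kappa> by (intro mult_left_mono) auto
    then show ?thesis using \<kappa> by (simp add: \<phi>_def norm_mult)
  qed
  then have "bounded (\<phi> ` \<bbbD>)" unfolding bounded_iff by blast
  then have "\<phi> \<in> Hinf" using h\<phi> by (simp add: Hinf_def)
  then show thesis using that pol2 by blast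
qed

lemma factor_from_hyperbolic_derivative:
  assumes b1: "b1 \<in> Hinf1" and b2: "b2 \<in> Hinf1"
    and lt: "\<And>z. z \<in> \<bbbD> \<Longrightarrow> cmod (b1 z) < 1" "\<And>z. z \<in> \<bbbD> \<Longrightarrow> cmod (b2 z) < 1"
    and eq: "\<And>z. z \<in> \<bbbD> \<Longrightarrow> cmod (deriv b1 z) / (1 - (cmod (b1 z))\<^sup>2) = cmod (deriv b2 z) / (1 - (cmod (b2 z))\<^sup>2)"
  obtains \<phi> where "\<phi> \<in> Hinf" "\<And>z w. z \<in> \<bbbD> \<Longrightarrow> w \<in> \<bbbD> \<Longrightarrow>
    1 - cnj (b2 w) * b2 z = \<phi> z * cnj (\<phi> w) * (1 - cnj (b1 w) * b1 z)"
proof -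
  have h: "b1 holomorphic_on \<bbbD>" "b2 holomorphic_on \<bbbD>" using b1 b2 by (auto simp: Hinf1_iff)
  have eq': "cmod (deriv b1 z) * (1 - (cmod (b2 z))\<^sup>2) = cmod (deriv b2 z) * (1 - (cmod (b1 z))\<^sup>2)" if z: "z \<in> \<bbbD>" for z
    using eq[OF z] one_minus_cmod_sq_pos[OF lt(1)[OF z]] one_minus_cmod_sq_pos[OF lt(2)[OF z]]
    by (simp add: frac_eq_eq)
  show thesis
  proof (cases "\<exists>w0\<in>\<bbbD>. deriv b1 w0 \<noteq> 0")
    case True
    then obtain w0 where w0: "w0 \<in> \<bbbD>" "deriv b1 w0 \<noteq> 0" by blast
    show thesis by (rule factor_nonconstant[OF h lt eq' w0 that])
  next
    case False
    then have d1: "deriv b1 z = 0" if "z \<in> \<bbbD>" for z using that by blast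
    have d2: "deriv b2 z = 0" if "z \<in> \<bbbD>" for z
      using eq'[OF that] d1[OF that] one_minus_cmod_sq_pos[OF lt(1)[OF that]] by auto
    show thesis by (rule factor_constant[OF h lt d1 d2 that])
  qed
qed

section \<open>From a factorization of kernels to unitary equivalence\<close>

lemma clin_compose: "clin A \<Longrightarrow> clin B \<Longrightarrow> clin (A o\<^sub>L B)"
  by (simp add: clin_def)

text \<open>The factorization of the kernels is the operator identity
  \<open>I - T\<^sub>2 T\<^sub>2\<^sup>* = T\<^sub>\<phi> (I - T\<^sub>1 T\<^sub>1\<^sup>*) T\<^sub>\<phi>\<^sup>*\<close>, tested on Szego kernels.\<close>

lemma factor_operator_identity:
  assumes b1: "b1 \<in> Hinf1" and b2: "b2 \<in> Hinf1" and \<phi>: "\<phi> \<in> Hinf"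
    and K: "\<And>z w. z \<in> \<bbbD> \<Longrightarrow> w \<in> \<bbbD> \<Longrightarrow>
      1 - cnj (b2 w) * b2 z = \<phi> z * cnj (\<phi> w) * (1 - cnj (b1 w) * b1 z)"
  shows "mult_op \<phi> (rootop b1 (rootop b1 (adj (mult_op \<phi>) x))) = rootop b2 (rootop b2 x)"
proof -
  let ?A = "mult_op \<phi> o\<^sub>L rootop b1 o\<^sub>L rootop b1 o\<^sub>L adj (mult_op \<phi>)" and ?B = "rootop b2 o\<^sub>L rootop b2"
  have c1: "clin (rootop b1)" and c2: "clin (rootop b2)" and cm: "clin (mult_op \<phi>)"
    using clin_rootop b1 b2 clin_mult[OF \<phi>] by blast+
  have "?A = ?B"
  proof (rule eq_on_szego)
    show "clin ?A" "clin ?B" by (intro clin_compose clin_adj c1 c2 cm)+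
    fix w assume w: "w \<in> \<bbbD>"
    show "?A (szego w) = ?B (szego w)"
    proof (rule hardy_eqI)
      fix z assume z: "z \<in> \<bbbD>"
      have "hardy (?A (szego w)) z = \<phi> z * (cnj (\<phi> w) * dBR_kernel b1 w z)"
        by (simp add: adj_mult_szego[OF \<phi> w] clinD[OF c1] hardy_mult[OF \<phi>] hardy_cs dBR_kernel_def)
      also have "\<dots> = dBR_kernel b2 w z"
        by (simp add: dBR_kernel_eq[OF b1 w z] dBR_kernel_eq[OF b2 w z] K[OF z w])
      finally show "hardy (?A (szego w)) z = hardy (?B (szego w)) z" by (simp add: dBR_kernel_def)
    qed
  qed
  then have "?A x = ?B x" by simp
  then show ?thesis by simp
qed

text \<open>With \<open>R\<^sub>1\<close>, \<open>R\<^sub>2\<close> the roots and \<open>A = T\<^sub>\<phi> R\<^sub>1\<close>, the operator identity is \<open>A A\<^sup>* = R\<^sub>2 R\<^sub>2\<^sup>*\<close>. So \<open>A\<close> and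
  \<open>R\<^sub>2\<close> have the same range, and matching preimages \<open>x\<close>, \<open>V x\<close> orthogonal to the kernels have the same
  norm, hence by linearity of \<open>V\<close> the same inner products.\<close>

lemma unitarily_equivalent_from_factor:
  assumes b1: "b1 \<in> Hinf1" and b2: "b2 \<in> Hinf1" and \<phi>: "\<phi> \<in> Hinf"
    and lt: "\<And>z. z \<in> \<bbbD> \<Longrightarrow> cmod (b2 z) < 1"
    and K: "\<And>z w. z \<in> \<bbbD> \<Longrightarrow> w \<in> \<bbbD> \<Longrightarrow>
      1 - cnj (b2 w) * b2 z = \<phi> z * cnj (\<phi> w) * (1 - cnj (b1 w) * b1 z)"
  shows "unitarily_equivalent (dBR b1) (dBR_inner b1) (dBR_shift b1)
               (dBR b2) (dBR_inner b2) (dBR_shift b2)"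
proof -
  let ?R1 = "rootop b1" and ?R2 = "rootop b2"
  define A where "A = mult_op \<phi> o\<^sub>L ?R1"
  have \<phi>nz: "\<phi> z \<noteq> 0" if z: "z \<in> \<bbbD>" for z
  proof
    assume "\<phi> z = 0"
    then have "complex_of_real (1 - (cmod (b2 z))\<^sup>2) = 0" using K[OF z z] unfolding one_minus_cmod_sq by simp
    then show False using one_minus_cmod_sq_pos[OF lt[OF z]] unfolding of_real_eq_0_iff by simp
  qed
  have hA: "hardy (A x) = (\<lambda>z. \<phi> z * hardy (?R1 x) z)" for x by (simp add: A_def hardy_mult[OF \<phi>])
  have A0: "A x = 0 \<longleftrightarrow> ?R1 x = 0" for x
  proof
    assume "A x = 0"
    then have "\<phi> z * hardy (?R1 x) z = 0" for z using hA[of x] hardy_zero by (metis)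
    then show "?R1 x = 0" using \<phi>nz by (intro hardy_eqI) (auto simp: hardy_zero)
  qed (simp add: A_def)
  then have cA: "coker A = coker ?R1" by (simp add: coker_def)
  have adjA: "adj A v = ?R1 (adj (mult_op \<phi>) v)" for v
  proof -
    have "x \<bullet> adj A v = x \<bullet> ?R1 (adj (mult_op \<phi>) v)" for x
      unfolding adj_right[of A, symmetric] using rootop(1)[OF b1]
      by (simp add: A_def adj_right[of "mult_op \<phi>"] selfadj_def)
    then show ?thesis using vector_eq_ldot by blast
  qed
  have id: "mult_op \<phi> (?R1 (?R1 (adj (mult_op \<phi>) v))) = ?R2 (?R2 v)" for v
    by (rule factor_operator_identity[OF b1 b2 \<phi> K])
  have norms: "norm (adj A v) = norm (adj ?R2 v)" for v
  proof -
    have "adj A v \<bullet> adj A v = A (adj A v) \<bullet> v" by (rule adj_right[symmetric])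
    also have "A (adj A v) = ?R2 (?R2 v)"
      unfolding adjA id[symmetric] by (simp add: A_def)
    also have "?R2 (?R2 v) \<bullet> v = adj ?R2 v \<bullet> adj ?R2 v"
      unfolding selfadj_adj[OF rootop(1)[OF b2]] using rootop(1)[OF b2] by (simp add: selfadj_def)
    finally show ?thesis unfolding norm_eq_sqrt_inner by simp
  qed
  have ex: "\<exists>y. y \<in> coker ?R2 \<and> ?R2 y = A x \<and> norm y = norm x" if x: "x \<in> coker ?R1" for x
    using same_range_norm[OF norms x[folded cA]] by metis
  define V where "V x = (SOME y. y \<in> coker ?R2 \<and> ?R2 y = A x \<and> norm y = norm x)" for x
  have V: "V x \<in> coker ?R2" "?R2 (V x) = A x" "norm (V x) = norm x" if "x \<in> coker ?R1" for x
    using someI_ex[OF ex[OF that]] unfolding V_def by blast+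
  have V_add: "V (x + y) = V x + V y" if x: "x \<in> coker ?R1" and y: "y \<in> coker ?R1" for x y
  proof (rule coker_inj[of _ ?R2])
    have xy: "x + y \<in> coker ?R1" by (intro subspace_add subspace_coker x y)
    show "V (x + y) \<in> coker ?R2" by (rule V[OF xy])
    show "V x + V y \<in> coker ?R2" by (intro subspace_add subspace_coker V x y)
    show "?R2 (V (x + y)) = ?R2 (V x + V y)" by (simp add: V x y xy blinfun.add_right)
  qed
  have coker_i: "cs \<i> x \<in> coker (rootop b)" if b: "b \<in> Hinf1" and x: "x \<in> coker (rootop b)" for b x
  proof -
    have "cs \<i> x \<bullet> k = 0" if k: "rootop b k = 0" for k
    proof -
      \<comment> \<open>the kernel of the root is a complex subspace\<close>
      have "cs (- \<i>) 0 = 0" by (rule ell2_eqI) simp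
      then have "rootop b (cs (- \<i>) k) = 0" using k clinD[OF clin_rootop[OF b]] by simp
      then show ?thesis using x by (simp add: inner_cs_left coker_def)
    qed
    then show ?thesis by (simp add: coker_def)
  qed
  have V_i: "V (cs \<i> x) = cs \<i> (V x)" if x: "x \<in> coker ?R1" for x
  proof (rule coker_inj[of _ ?R2])
    have ix: "cs \<i> x \<in> coker ?R1" by (rule coker_i[OF b1 x])
    show "V (cs \<i> x) \<in> coker ?R2" by (rule V[OF ix])
    show "cs \<i> (V x) \<in> coker ?R2" by (rule coker_i[OF b2 V(1)[OF x]])
    have "A (cs \<i> x) = cs \<i> (A x)"
      by (simp add: A_def clinD[OF clin_rootop[OF b1]] clinD[OF clin_mult[OF \<phi>]])
    then show "?R2 (V (cs \<i> x)) = ?R2 (cs \<i> (V x))"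
      by (simp add: V ix x clinD[OF clin_rootop[OF b2]])
  qed
  have V_inner: "V x \<bullet> V y = x \<bullet> y" if x: "x \<in> coker ?R1" and y: "y \<in> coker ?R1" for x y
    unfolding dot_norm V_add[OF x y, symmetric] by (simp add: V x y subspace_add subspace_coker)
  have V_cinner: "cinner (V x) (V y) = cinner x y" if x: "x \<in> coker ?R1" and y: "y \<in> coker ?R1" for x y
    unfolding cinner_def V_i[OF y, symmetric] by (simp add: V_inner x y coker_i[OF b1])
  define U where "U f = (\<lambda>z. \<phi> z * f z)" for f :: "complex \<Rightarrow> complex"
  have UV: "U (hardy (?R1 x)) = hardy (?R2 (V x))" if "x \<in> coker ?R1" for x
    by (simp add: U_def V(2)[OF that] hA)
  have into: "U f \<in> dBR b2" if "f \<in> dBR b1" for f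
    using dBR_cases[OF b1 that] UV dBR_eq[OF b2] by (metis imageI rangeI)
  have "bij_betw U (dBR b1) (dBR b2)"
  proof (rule bij_betwI')
    fix f g assume f: "f \<in> dBR b1" and g: "g \<in> dBR b1"
    obtain x y where xy: "f = hardy (?R1 x)" "g = hardy (?R1 y)" using f g by (auto simp: dBR_eq[OF b1])
    show "U f = U g \<longleftrightarrow> f = g"
    proof
      assume "U f = U g"
      then have "\<phi> z * f z = \<phi> z * g z" for z unfolding U_def by (rule fun_cong)
      from this have "hardy (?R1 x) z = hardy (?R1 y) z" if "z \<in> \<bbbD>" for z
        using \<phi>nz[OF that] unfolding xy mult_cancel_left by blast
      then show "f = g" unfolding xy by (metis hardy_eqI)
    qed simp
  next
    fix g assume "g \<in> dBR b2"
    then obtain y where y: "y \<in> coker ?R2" "g = hardy (?R2 y)" by (rule dBR_cases[OF b2])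
    obtain x where "A x = ?R2 y" using same_range_norm[OF norms[symmetric] y(1)] by metis
    then have "g = U (hardy (?R1 x))" by (simp add: y U_def flip: hA)
    then show "\<exists>f\<in>dBR b1. g = U f" by (auto simp: dBR_eq[OF b1])
  qed (rule into)
  moreover have "dBR_inner b2 (U f) (U g) = dBR_inner b1 f g" if f: "f \<in> dBR b1" and g: "g \<in> dBR b1" for f g
  proof -
    obtain x where x: "x \<in> coker ?R1" "f = hardy (?R1 x)" by (rule dBR_cases[OF b1 f])
    obtain y where y: "y \<in> coker ?R1" "g = hardy (?R1 y)" by (rule dBR_cases[OF b1 g])
    show ?thesis
      unfolding x(2) y(2) UV[OF x(1)] UV[OF y(1)] dBR_inner_root[OF b1 x(1) y(1)]
        dBR_inner_root[OF b2 V(1)[OF x(1)] V(1)[OF y(1)]]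
      by (rule V_cinner[OF x(1) y(1)])
  qed
  moreover have "clinear_on (dBR b1) U" by (auto simp: clinear_on_def U_def algebra_simps)
  ultimately have "unitary_between (dBR b1) (dBR_inner b1) (dBR b2) (dBR_inner b2) U"
    by (simp add: unitary_between_def)
  moreover have "U (dBR_shift b1 f) = dBR_shift b2 (U f)" if "f \<in> dBR b1" for f
    using that into[OF that] by (simp add: dBR_shift_def U_def fun_eq_iff)
  ultimately show ?thesis unfolding unitarily_equivalent_def by blast
qed

theorem theorem3p4:
  fixes b1 b2 :: "complex \<Rightarrow> complex"
  assumes "b1 \<in> Hinf1" and "\<not> extreme_Hinf1 b1"
    and "b2 \<in> Hinf1" and "\<not> extreme_Hinf1 b2"
  shows "unitarily_equivalent (dBR b1) (dBR_inner b1) (dBR_shift b1)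
                              (dBR b2) (dBR_inner b2) (dBR_shift b2) \<longleftrightarrow>
    (\<forall>\<omega>\<in>ball 0 1. cmod (deriv b1 \<omega>) / (1 - (cmod (b1 \<omega>))\<^sup>2)
                  = cmod (deriv b2 \<omega>) / (1 - (cmod (b2 \<omega>))\<^sup>2))"
    (is "?equiv \<longleftrightarrow> ?hyp")
proof
  have lt: "\<And>z. z \<in> \<bbbD> \<Longrightarrow> cmod (b1 z) < 1" "\<And>z. z \<in> \<bbbD> \<Longrightarrow> cmod (b2 z) < 1"
    using non_extreme_less_1 assms by blast+
  show ?hyp if eq: ?equiv
  proof -
    obtain \<phi> where \<phi>: "\<And>z w. z \<in> \<bbbD> \<Longrightarrow> w \<in> \<bbbD> \<Longrightarrow>
        1 - cnj (b2 w) * b2 z = \<phi> z * cnj (\<phi> w) * (1 - cnj (b1 w) * b1 z)"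
      using kernel_factor[OF assms(1-3) eq] by metis
    show ?thesis using hyperbolic_derivative_eq[OF assms(1,3) lt \<phi>] by blast
  qed
  show ?equiv if hyp: ?hyp
  proof -
    obtain \<phi> where \<phi>: "\<phi> \<in> Hinf" "\<And>z w. z \<in> \<bbbD> \<Longrightarrow> w \<in> \<bbbD> \<Longrightarrow>
        1 - cnj (b2 w) * b2 z = \<phi> z * cnj (\<phi> w) * (1 - cnj (b1 w) * b1 z)"
      using factor_from_hyperbolic_derivative[OF assms(1,3) lt hyp[rule_format]] by metis
    show ?thesis by (rule unitarily_equivalent_from_factor[OF assms(1,3) \<phi>(1) lt(2) \<phi>(2)])
  qed
qed

end
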